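(* Let $\mathfrak g=\mathfrak k\oplus\mathfrak p$ be the complexification of a real $\mathbb Z_2$-graded quadratic Lie algebra $\mathfrak g_0=\mathfrak k_0\oplus\mathfrak p_0$. Let $(\pi,M)$ be an admissible $(\mathfrak g,K)$-module with a nondegenerate $*$-invariant hermitian form $\langle\,,\,\rangle_M$ and with an infinitesimal character $\chi_M$, and let $\sigma$ be a simple finite-dimensional $\mathfrak k$-module with isotypic component $M(\sigma)$ in $M$. Suppose $x\in M(\sigma)\otimes S(\mathfrak p_0)$ is a simple tensor (i.e. $x=m\otimes p$ with $m\in M(\sigma)$, $p\in S(\mathfrak p_0)$). Then $$\langle D^+x,D^+x\rangle_{M\otimes\mathcal P}-\langle D^-x,D^-x\rangle_{M\otimes\mathcal P}=\big(-\chi_M(\Omega(\mathfrak g))+\sigma(\Omega(\mathfrak k))\big)\langle x,x\rangle_{M\otimes\mathcal P}.$$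
   Context: $\mathfrak g_0=\mathfrak k_0\oplus\mathfrak p_0$ is a finite-dimensional real Lie algebra with a $\mathbb Z_2$-gradation ($[\mathfrak k_0,\mathfrak k_0]\subset\mathfrak k_0$, $[\mathfrak k_0,\mathfrak p_0]\subset\mathfrak p_0$, $[\mathfrak p_0,\mathfrak p_0]\subset\mathfrak k_0$) and a nondegenerate invariant symmetric bilinear form $B$ for which $\mathfrak k_0\perp\mathfrak p_0$ and $B|_{\mathfrak p_0}$ is positive definite; $B$ is extended complex-bilinearly to $\mathfrak g$. $K$ is the group with complexified Lie algebra $\mathfrak k$ of the usual notion of $(\mathfrak g,K)$-module. The bar denotes complex conjugation on $\mathfrak g$ with real points $\mathfrak g_0$ (and the induced conjugation on $S(\mathfrak p)$, whose real points are $S(\mathfrak p_0)$). $\Omega(\mathfrak g),\Omega(\mathfrak k)$ are the Casimir elements with respect to $B$ (sums $\sum_k w_kw^k$ over $B$-dual bases). $\mathcal W=\mathcal W(\mathfrak p\oplus\mathfrak p^*,\omega)$ is the Weyl algebra: the quotient of the tensor algebra by $vw-wv=\omega(v,w)$, where $\mathfrak p,\mathfrak p^*$ are isotropic and $\omega(\alpha,v)=\alpha(v)$ for $\alpha\in\mathfrak p^*,v\in\mathfrak p$. For a basis $\{z_i\}$ of $\mathfrak p$ with $B$-dual basis $\{z^i\}\subset\mathfrak p$ and dual basis $\{z_i^*\}\subset\mathfrak p^*$: $D^-=\sum_iz_i\otimes z_i^*$, $D^+=\sum_iz_i\otimes z^i$ in $U(\mathfrak g)\otimes\mathcal W$. $\mathcal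 P=S(\mathfrak p)$ is a $\mathcal W$-module: $v\in\mathfrak p$ acts by multiplication and $\alpha\in\mathfrak p^*$ by the derivation with $v\mapsto\alpha(v)$. $U(\mathfrak g)\otimes\mathcal W$ acts on $M\otimes\mathcal P$. The hermitian pairing on $\mathcal P$ is $\langle P_1,P_2\rangle_{\mathcal P}=\partial_{P_2}(\overline{P_1})$ (evaluated at $0$), where $\partial_{P}$ is the constant-coefficient differential operator defined by $P$ (via $z_i\mapsto z_i^*$ for a $B$-orthonormal basis $\{z_i\}$ of $\mathfrak p_0$). The star operation on $U(\mathfrak g)$ is the conjugate-linear anti-involution with $x^*=-\overline x$ for $x\in\mathfrak g$, and $*$-invariance of $\langle\,,\,\rangle_M$ means $\langle\pi(u)m,m'\rangle_M=\langle m,\pi(u^* )m'\rangle_M$. Hermitian forms are conjugate-linear in the first and linear in the second variable, and $\langle\,,\,\rangle_{M\otimes\mathcal P}=\langle\,,\,\rangle_M\langle\,,\,\rangle_{\mathcal P}$. $\chi_M(\Omega(\mathfrak g))$ and $\sigma(\Omega(\mathfrak k))$ denote the scalars by which $\Omega(\mathfrak g)$ acts on $M$ and $\Omega(\mathfrak k)$ acts on $\sigma$. *)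

theory Defs
  imports
    "HOL-Analysis.Analysis"
    "HOL-Algebra.Module"
    "HOL-Algebra.QuotRing"
    "HOL-Library.Poly_Mapping"
    "HOL-Library.Function_Algebras"
begin

section \<open>Complexification\<close>

text \<open>The complexification of a real vector space \<open>V\<close> is \<open>V \<times> V\<close>, the pair
  \<open>(x, y)\<close> standing for \<open>x + \<i> y\<close>; the complexification of a real subspace \<open>U\<close> is
  \<open>U \<times> U\<close>.\<close>

definition cscale :: "complex \<Rightarrow> 'g::real_vector \<times> 'g \<Rightarrow> 'g \<times> 'g" where
  "cscale c = (\<lambda>(x, y). (Re c *\<^sub>R x - Im c *\<^sub>R y, Re c *\<^sub>R y + Im c *\<^sub>R x))"

definition cconj :: "'g::real_vector \<times> 'g \<Rightarrow> 'g \<times> 'g" where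
  "cconj = (\<lambda>(x, y). (x, - y))"

definition cbracket :: "('g::real_vector \<Rightarrow> 'g \<Rightarrow> 'g) \<Rightarrow> 'g \<times> 'g \<Rightarrow> 'g \<times> 'g \<Rightarrow> 'g \<times> 'g" where
  "cbracket br = (\<lambda>(x, y) (x', y'). (br x x' - br y y', br x y' + br y x'))"

definition cform :: "('g::real_vector \<Rightarrow> 'g \<Rightarrow> real) \<Rightarrow> 'g \<times> 'g \<Rightarrow> 'g \<times> 'g \<Rightarrow> complex" where
  "cform B = (\<lambda>(x, y) (x', y'). Complex (B x x' - B y y') (B x y' + B y x'))"

section \<open>Graded quadratic Lie algebras\<close>

text \<open>The norm on \<open>'g\<close> only provides the canonical topology of a finite-dimensional space.\<close>

locale graded_quadratic_lie_algebra =
  fixes br :: "'g::real_normed_vector \<Rightarrow> 'g \<Rightarrow> 'g"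
    and B :: "'g \<Rightarrow> 'g \<Rightarrow> real"
    and k0 p0 :: "'g set"
  assumes finite_dimensional: "\<exists>S :: 'g set. finite S \<and> span S = UNIV"
    and bracket_bilinear: "bilinear br"
    and bracket_alternating: "br x x = 0"
    and jacobi: "br x (br y z) + br y (br z x) + br z (br x y) = 0"
    and subspaces: "subspace k0" "subspace p0"
    and direct_sum: "k0 \<inter> p0 = {0}" "\<exists>a\<in>k0. \<exists>b\<in>p0. x = a + b"
    and grading_kk: "\<lbrakk>a \<in> k0; b \<in> k0\<rbrakk> \<Longrightarrow> br a b \<in> k0"
    and grading_kp: "\<lbrakk>a \<in> k0; b \<in> p0\<rbrakk> \<Longrightarrow> br a b \<in> p0"
    and grading_pp: "\<lbrakk>a \<in> p0; b \<in> p0\<rbrakk> \<Longrightarrow> br a b \<in> k0"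
    and form_bilinear: "bilinear B"
    and form_symmetric: "B x y = B y x"
    and form_invariant: "B (br x y) z + B y (br x z) = 0"
    and form_nondegenerate: "(\<And>y. B x y = 0) \<Longrightarrow> x = 0"
    and form_orthogonal: "\<lbrakk>a \<in> k0; b \<in> p0\<rbrakk> \<Longrightarrow> B a b = 0"
    and form_positive: "\<lbrakk>b \<in> p0; b \<noteq> 0\<rbrakk> \<Longrightarrow> 0 < B b b"

definition is_basis :: "('v set) \<Rightarrow> (complex \<Rightarrow> 'v \<Rightarrow> 'v) \<Rightarrow> nat \<Rightarrow> (nat \<Rightarrow> 'v::ab_group_add) \<Rightarrow> bool" where
  "is_basis V s n w \<longleftrightarrow>
     inj_on w {..<n} \<and> \<not> module.dependent s (w ` {..<n}) \<and> module.span s (w ` {..<n}) = V"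

text \<open>\<open>w\<close> is a basis of the complex subspace \<open>V\<close> of the complexification and \<open>w'\<close> its dual basis
  in \<open>V\<close> with respect to the complex-bilinear extension of \<open>B\<close>.\<close>

definition dual_bases ::
  "('g::real_vector \<Rightarrow> 'g \<Rightarrow> real) \<Rightarrow> ('g \<times> 'g) set \<Rightarrow> nat \<Rightarrow> (nat \<Rightarrow> 'g \<times> 'g) \<Rightarrow> (nat \<Rightarrow> 'g \<times> 'g) \<Rightarrow> bool"
  where
  "dual_bases B V n w w' \<longleftrightarrow>
     is_basis V cscale n w \<and>
     (\<forall>i<n. w' i \<in> V) \<and>
     (\<forall>i<n. \<forall>j<n. cform B (w i) (w' j) = (if i = j then 1 else 0))"

section \<open>Presented algebras\<close>

text \<open>Complex vector spaces and algebras given by a carrier are HOL-Algebra \<open>module\<close> records over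
  the field below. In records that are merely vector spaces the fields \<open>mult\<close> and \<open>one\<close> are
  meaningless.\<close>

definition complex_field :: "complex ring" where
  "complex_field = \<lparr>carrier = UNIV, mult = (*), one = 1, zero = 0, add = (+)\<rparr>"

definition vspace :: "'v::ab_group_add set \<Rightarrow> (complex \<Rightarrow> 'v \<Rightarrow> 'v) \<Rightarrow> (complex, 'v) module" where
  "vspace V s = \<lparr>carrier = V, mult = (\<lambda>_ _. undefined), one = undefined, zero = 0, add = (+),
                 smult = s\<rparr>"

definition pm_scale :: "complex \<Rightarrow> ('b \<Rightarrow>\<^sub>0 complex) \<Rightarrow> 'b \<Rightarrow>\<^sub>0 complex" where
  "pm_scale c = Poly_Mapping.map ((*) c)"

text \<open>The quotient of an algebra by an ideal (or of a vector space by a subspace, when \<open>A\<close> has no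
  multiplication).\<close>

definition quotient_record :: "(complex, 'a) module \<Rightarrow> 'a set \<Rightarrow> (complex, 'a set) module" where
  "quotient_record A I =
     ring.extend (A Quot I) (module.fields (\<lambda>c X. \<Union>x\<in>X. I +>\<^bsub>A\<^esub> (c \<odot>\<^bsub>A\<^esub> x)))"

text \<open>The free monoid; its monoid operation is concatenation, written additively because
  \<open>Poly_Mapping\<close> builds monoid algebras over additive monoids.\<close>

datatype 'v free_monoid = Mon (letters: "'v list")

instantiation free_monoid :: (type) monoid_add
begin
definition zero_free_monoid :: "'a free_monoid" where "0 = Mon []"
definition plus_free_monoid :: "'a free_monoid \<Rightarrow> 'a free_monoid \<Rightarrow> 'a free_monoid" where
  "x + y = Mon (letters x @ letters y)"
instance by standard (auto simp: zero_free_monoid_def plus_free_monoid_def)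
end

type_synonym 'v free_alg = "'v free_monoid \<Rightarrow>\<^sub>0 complex"

definition free_algebra :: "'v set \<Rightarrow> (complex, 'v free_alg) module" where
  "free_algebra V =
     \<lparr>carrier = {a. \<forall>w \<in> Poly_Mapping.keys a. set (letters w) \<subseteq> V},
      mult = (*), one = 1, zero = 0, add = (+), smult = pm_scale\<rparr>"

definition generator :: "'v \<Rightarrow> 'v free_alg" where
  "generator v = Poly_Mapping.single (Mon [v]) 1"

text \<open>The quotient of the free algebra on the set \<open>V\<close> by these relations is the tensor algebra of
  the vector space \<open>V\<close>.\<close>

definition linear_relations :: "(complex, 'v) module \<Rightarrow> 'v free_alg set" where
  "linear_relations V =
     {generator (v \<oplus>\<^bsub>V\<^esub> w) - generator v - generator w | v w. v \<in> carrier V \<and> w \<in> carrier V} \<union>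
     {generator (c \<odot>\<^bsub>V\<^esub> v) - pm_scale c (generator v) | c v. v \<in> carrier V}"

definition relation_ideal :: "(complex, 'v) module \<Rightarrow> 'v free_alg set \<Rightarrow> 'v free_alg set" where
  "relation_ideal V R = genideal (free_algebra (carrier V)) (linear_relations V \<union> R)"

text \<open>The quotient of the tensor algebra of \<open>V\<close> by the two-sided ideal generated by \<open>R\<close>.\<close>

definition presented_algebra ::
  "(complex, 'v) module \<Rightarrow> 'v free_alg set \<Rightarrow> (complex, 'v free_alg set) module" where
  "presented_algebra V R = quotient_record (free_algebra (carrier V)) (relation_ideal V R)"

definition presented_gen ::
  "(complex, 'v) module \<Rightarrow> 'v free_alg set \<Rightarrow> 'v \<Rightarrow> 'v free_alg set" where
  "presented_gen V R v = relation_ideal V R +>\<^bsub>free_algebra (carrier V)\<^esub> generator v"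

text \<open>The action on the vector space \<open>N\<close> of (a class \<open>u\<close> of) noncommutative polynomials in the
  letters \<open>v\<close>, when each letter acts by the operator \<open>f v\<close>. It does not depend on the
  representative of \<open>u\<close> when the operators satisfy the defining relations.\<close>

definition free_action ::
  "(complex, 'n) module \<Rightarrow> ('v \<Rightarrow> 'n \<Rightarrow> 'n) \<Rightarrow> 'v free_alg \<Rightarrow> 'n \<Rightarrow> 'n" where
  "free_action N f a y =
     (\<Oplus>\<^bsub>N\<^esub>w\<in>Poly_Mapping.keys a. Poly_Mapping.lookup a w \<odot>\<^bsub>N\<^esub> foldr f (letters w) y)"

definition presented_action ::
  "(complex, 'n) module \<Rightarrow> ('v \<Rightarrow> 'n \<Rightarrow> 'n) \<Rightarrow> 'v free_alg set \<Rightarrow> 'n \<Rightarrow> 'n" where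
  "presented_action N f u y = free_action N f (SOME a. a \<in> u) y"

text \<open>Conjugate-linear extension of a map between words.\<close>

definition conj_extend ::
  "('v free_monoid \<Rightarrow> 'v free_monoid) \<Rightarrow> 'v free_alg \<Rightarrow> 'v free_alg" where
  "conj_extend h a =
     (\<Sum>w\<in>Poly_Mapping.keys a. Poly_Mapping.single (h w) (cnj (Poly_Mapping.lookup a w)))"

section \<open>Enveloping algebras\<close>

definition env_relations ::
  "('g::real_vector \<Rightarrow> 'g \<Rightarrow> 'g) \<Rightarrow> ('g \<times> 'g) set \<Rightarrow> ('g \<times> 'g) free_alg set" where
  "env_relations br L =
     {generator x * generator y - generator y * generator x - generator (cbracket br x y) | x y.
        x \<in> L \<and> y \<in> L}"

text \<open>\<open>L\<close> is a complex subalgebra of the complexified Lie algebra: \<open>UNIV\<close> for the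
  whole algebra, and \<open>k0 \<times> k0\<close> for the complexification of \<open>k0\<close>.\<close>

definition env :: "('g::real_vector \<Rightarrow> 'g \<Rightarrow> 'g) \<Rightarrow> ('g \<times> 'g) set \<Rightarrow>
    (complex, ('g \<times> 'g) free_alg set) module" where
  "env br L = presented_algebra (vspace L cscale) (env_relations br L)"

definition env_gen :: "('g::real_vector \<Rightarrow> 'g \<Rightarrow> 'g) \<Rightarrow> ('g \<times> 'g) set \<Rightarrow>
    'g \<times> 'g \<Rightarrow> ('g \<times> 'g) free_alg set" where
  "env_gen br L = presented_gen (vspace L cscale) (env_relations br L)"

text \<open>The image of a coset in the enveloping algebra under the conjugate-linear anti-automorphism
  of the free algebra with \<open>x \<mapsto> - cconj x\<close> is again a coset.\<close>

definition env_star :: "('g::real_vector \<times> 'g) free_alg set \<Rightarrow> ('g \<times> 'g) free_alg set" where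
  "env_star u = conj_extend (\<lambda>w. Mon (rev (map (\<lambda>x. - cconj x) (letters w)))) ` u"

definition env_center :: "('g::real_vector \<Rightarrow> 'g \<Rightarrow> 'g) \<Rightarrow> ('g \<times> 'g) free_alg set set" where
  "env_center br =
     {z \<in> carrier (env br UNIV). \<forall>u \<in> carrier (env br UNIV).
        u \<otimes>\<^bsub>env br UNIV\<^esub> z = z \<otimes>\<^bsub>env br UNIV\<^esub> u}"

definition casimir :: "('g::real_vector \<Rightarrow> 'g \<Rightarrow> 'g) \<Rightarrow> ('g \<times> 'g) set \<Rightarrow>
    nat \<Rightarrow> (nat \<Rightarrow> 'g \<times> 'g) \<Rightarrow> (nat \<Rightarrow> 'g \<times> 'g) \<Rightarrow> ('g \<times> 'g) free_alg set" where
  "casimir br L n w w' =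
     (\<Oplus>\<^bsub>env br L\<^esub>i\<in>{..<n}. env_gen br L (w i) \<otimes>\<^bsub>env br L\<^esub> env_gen br L (w' i))"

section \<open>The symmetric algebra and the Weyl algebra\<close>

definition sym_relations :: "'v set \<Rightarrow> 'v free_alg set" where
  "sym_relations V =
     {generator x * generator y - generator y * generator x | x y. x \<in> V \<and> y \<in> V}"

definition sym_alg :: "('g::real_vector \<times> 'g) set \<Rightarrow> (complex, ('g \<times> 'g) free_alg set) module" where
  "sym_alg p = presented_algebra (vspace p cscale) (sym_relations p)"

definition sym_gen :: "('g::real_vector \<times> 'g) set \<Rightarrow> 'g \<times> 'g \<Rightarrow> ('g \<times> 'g) free_alg set" where
  "sym_gen p = presented_gen (vspace p cscale) (sym_relations p)"

definition sym_conj :: "('g::real_vector \<times> 'g) free_alg set \<Rightarrow> ('g \<times> 'g) free_alg set" where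
  "sym_conj X = conj_extend (\<lambda>w. Mon (map cconj (letters w))) ` X"

definition sym_real :: "('g::real_vector \<times> 'g) set \<Rightarrow> ('g \<times> 'g) free_alg set set" where
  "sym_real p = {X \<in> carrier (sym_alg p). sym_conj X = X}"

text \<open>Evaluation at \<open>0\<close>: all representatives of a class have the same constant term.\<close>

definition sym_eval0 :: "('g::real_vector \<times> 'g) free_alg set \<Rightarrow> complex" where
  "sym_eval0 X = Poly_Mapping.lookup (SOME a. a \<in> X) 0"

definition is_derivation :: "(complex, 'a) module \<Rightarrow> ('a \<Rightarrow> 'a) \<Rightarrow> bool" where
  "is_derivation A d \<longleftrightarrow>
     (\<forall>a\<in>carrier A. d a \<in> carrier A) \<and>
     (\<forall>a\<in>carrier A. \<forall>b\<in>carrier A. d (a \<oplus>\<^bsub>A\<^esub> b) = d a \<oplus>\<^bsub>A\<^esub> d b) \<and>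
     (\<forall>c. \<forall>a\<in>carrier A. d (c \<odot>\<^bsub>A\<^esub> a) = c \<odot>\<^bsub>A\<^esub> d a) \<and>
     (\<forall>a\<in>carrier A. \<forall>b\<in>carrier A. d (a \<otimes>\<^bsub>A\<^esub> b) = d a \<otimes>\<^bsub>A\<^esub> b \<oplus>\<^bsub>A\<^esub> a \<otimes>\<^bsub>A\<^esub> d b)"

text \<open>The dual space; functionals are extended by \<open>0\<close> outside \<open>p\<close> so that they are determined by
  their values on \<open>p\<close>.\<close>

definition dual_space :: "('g::real_vector \<times> 'g) set \<Rightarrow> ('g \<times> 'g \<Rightarrow> complex) set" where
  "dual_space p =
     {\<alpha>. (\<forall>x\<in>p. \<forall>y\<in>p. \<alpha> (x + y) = \<alpha> x + \<alpha> y) \<and>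
         (\<forall>c. \<forall>x\<in>p. \<alpha> (cscale c x) = c * \<alpha> x) \<and>
         (\<forall>x. x \<notin> p \<longrightarrow> \<alpha> x = 0)}"

text \<open>The derivation with \<open>v \<mapsto> \<alpha>(v)\<close>; these conditions determine it on the carrier.\<close>

definition sym_deriv :: "('g::real_vector \<times> 'g) set \<Rightarrow> ('g \<times> 'g \<Rightarrow> complex) \<Rightarrow>
    ('g \<times> 'g) free_alg set \<Rightarrow> ('g \<times> 'g) free_alg set" where
  "sym_deriv p \<alpha> =
     (SOME d. is_derivation (sym_alg p) d \<and>
        (\<forall>v\<in>p. d (sym_gen p v) = \<alpha> v \<odot>\<^bsub>sym_alg p\<^esub> \<one>\<^bsub>sym_alg p\<^esub>))"

text \<open>The operator \<open>\<partial>\<^sub>Q\<close>. The linear extension of \<open>z\<^sub>i \<mapsto> z\<^sub>i\<^sup>*\<close> for a \<open>B\<close>-orthonormal basis is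
  \<open>v \<mapsto> B(v, \<cdot>)\<close>.\<close>

definition sym_diff_op :: "('g::real_vector \<Rightarrow> 'g \<Rightarrow> real) \<Rightarrow> ('g \<times> 'g) set \<Rightarrow>
    ('g \<times> 'g) free_alg set \<Rightarrow> ('g \<times> 'g) free_alg set \<Rightarrow> ('g \<times> 'g) free_alg set" where
  "sym_diff_op B p =
     presented_action (sym_alg p) (\<lambda>v. sym_deriv p (\<lambda>y. if y \<in> p then cform B v y else 0))"

definition sym_pairing :: "('g::real_vector \<Rightarrow> 'g \<Rightarrow> real) \<Rightarrow> ('g \<times> 'g) set \<Rightarrow>
    ('g \<times> 'g) free_alg set \<Rightarrow> ('g \<times> 'g) free_alg set \<Rightarrow> complex" where
  "sym_pairing B p P1 P2 = sym_eval0 (sym_diff_op B p P2 (sym_conj P1))"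

type_synonym 'g weyl_vec = "('g \<times> 'g) \<times> ('g \<times> 'g \<Rightarrow> complex)"

definition weyl_space :: "('g::real_vector \<times> 'g) set \<Rightarrow> (complex, 'g weyl_vec) module" where
  "weyl_space p = vspace (p \<times> dual_space p) (\<lambda>c (v, \<alpha>). (cscale c v, \<lambda>x. c * \<alpha> x))"

text \<open>The symplectic form with \<open>\<omega>(\<alpha>, v) = \<alpha>(v)\<close>.\<close>

definition weyl_omega :: "'g weyl_vec \<Rightarrow> 'g weyl_vec \<Rightarrow> complex" where
  "weyl_omega = (\<lambda>(v, \<alpha>) (w, \<beta>). \<alpha> w - \<beta> v)"

definition weyl_relations :: "('g::real_vector \<times> 'g) set \<Rightarrow> 'g weyl_vec free_alg set" where
  "weyl_relations p =
     {generator x * generator y - generator y * generator x - Poly_Mapping.single 0 (weyl_omega x y)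
      | x y. x \<in> p \<times> dual_space p \<and> y \<in> p \<times> dual_space p}"

definition weyl :: "('g::real_vector \<times> 'g) set \<Rightarrow> (complex, 'g weyl_vec free_alg set) module" where
  "weyl p = presented_algebra (weyl_space p) (weyl_relations p)"

definition weyl_gen :: "('g::real_vector \<times> 'g) set \<Rightarrow> 'g weyl_vec \<Rightarrow> 'g weyl_vec free_alg set" where
  "weyl_gen p = presented_gen (weyl_space p) (weyl_relations p)"

definition weyl_action :: "('g::real_vector \<times> 'g) set \<Rightarrow> 'g weyl_vec free_alg set \<Rightarrow>
    ('g \<times> 'g) free_alg set \<Rightarrow> ('g \<times> 'g) free_alg set" where
  "weyl_action p =
     presented_action (sym_alg p)
       (\<lambda>(v, \<alpha>) q. (sym_gen p v \<otimes>\<^bsub>sym_alg p\<^esub> q) \<oplus>\<^bsub>sym_alg p\<^esub> sym_deriv p \<alpha> q)"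

section \<open>Tensor products\<close>

definition free_vspace :: "'b set \<Rightarrow> (complex, 'b \<Rightarrow>\<^sub>0 complex) module" where
  "free_vspace S = vspace {a. Poly_Mapping.keys a \<subseteq> S} pm_scale"

definition tensor_relations ::
  "(complex, 'a) module \<Rightarrow> (complex, 'b) module \<Rightarrow> ('a \<times> 'b \<Rightarrow>\<^sub>0 complex) set" where
  "tensor_relations V W =
     {Poly_Mapping.single (a \<oplus>\<^bsub>V\<^esub> a', b) 1 - Poly_Mapping.single (a, b) 1 - Poly_Mapping.single (a', b) 1
      | a a' b. a \<in> carrier V \<and> a' \<in> carrier V \<and> b \<in> carrier W} \<union>
     {Poly_Mapping.single (a, b \<oplus>\<^bsub>W\<^esub> b') 1 - Poly_Mapping.single (a, b) 1 - Poly_Mapping.single (a, b') 1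
      | a b b'. a \<in> carrier V \<and> b \<in> carrier W \<and> b' \<in> carrier W} \<union>
     {Poly_Mapping.single (c \<odot>\<^bsub>V\<^esub> a, b) 1 - Poly_Mapping.single (a, b) c
      | c a b. a \<in> carrier V \<and> b \<in> carrier W} \<union>
     {Poly_Mapping.single (a, c \<odot>\<^bsub>W\<^esub> b) 1 - Poly_Mapping.single (a, b) c
      | c a b. a \<in> carrier V \<and> b \<in> carrier W}"

definition tensor_null ::
  "(complex, 'a) module \<Rightarrow> (complex, 'b) module \<Rightarrow> ('a \<times> 'b \<Rightarrow>\<^sub>0 complex) set" where
  "tensor_null V W =
     (\<lambda>N. submodule N complex_field (free_vspace (carrier V \<times> carrier W))) hull tensor_relations V W"

definition tensor ::
  "(complex, 'a) module \<Rightarrow> (complex, 'b) module \<Rightarrow> (complex, ('a \<times> 'b \<Rightarrow>\<^sub>0 complex) set) module" where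
  "tensor V W = quotient_record (free_vspace (carrier V \<times> carrier W)) (tensor_null V W)"

definition tensor_class :: "(complex, 'a) module \<Rightarrow> (complex, 'b) module \<Rightarrow>
    ('a \<times> 'b \<Rightarrow>\<^sub>0 complex) \<Rightarrow> ('a \<times> 'b \<Rightarrow>\<^sub>0 complex) set" where
  "tensor_class V W t = tensor_null V W +>\<^bsub>free_vspace (carrier V \<times> carrier W)\<^esub> t"

definition simple_tensor :: "(complex, 'a) module \<Rightarrow> (complex, 'b) module \<Rightarrow>
    'a \<Rightarrow> 'b \<Rightarrow> ('a \<times> 'b \<Rightarrow>\<^sub>0 complex) set" where
  "simple_tensor V W a b = tensor_class V W (Poly_Mapping.single (a, b) 1)"

text \<open>If \<open>u\<close> acts on \<open>V\<close> by \<open>actU u\<close> and \<open>w\<close> acts on \<open>W\<close> by \<open>actW w\<close>, both bilinearly, this is the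
  bilinear action on \<open>V \<otimes> W\<close> with \<open>(u \<otimes> w)(a \<otimes> b) = actU u a \<otimes> actW w b\<close>.\<close>

definition tensor_action ::
  "(complex, 'a) module \<Rightarrow> (complex, 'b) module \<Rightarrow> ('u \<Rightarrow> 'a \<Rightarrow> 'a) \<Rightarrow> ('w \<Rightarrow> 'b \<Rightarrow> 'b) \<Rightarrow>
   ('u \<times> 'w \<Rightarrow>\<^sub>0 complex) set \<Rightarrow> ('a \<times> 'b \<Rightarrow>\<^sub>0 complex) set \<Rightarrow> ('a \<times> 'b \<Rightarrow>\<^sub>0 complex) set" where
  "tensor_action V W actU actW T X =
     (let t = (SOME t. t \<in> T); x = (SOME x. x \<in> X) in
      tensor_class V W
        (\<Sum>(u, w)\<in>Poly_Mapping.keys t. \<Sum>(a, b)\<in>Poly_Mapping.keys x.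
           Poly_Mapping.single (actU u a, actW w b)
             (Poly_Mapping.lookup t (u, w) * Poly_Mapping.lookup x (a, b))))"

text \<open>The sesquilinear form (conjugate-linear in the first variable) on a tensor product given by
  the product of two sesquilinear forms on simple tensors.\<close>

definition tensor_form :: "('a \<Rightarrow> 'a \<Rightarrow> complex) \<Rightarrow> ('b \<Rightarrow> 'b \<Rightarrow> complex) \<Rightarrow>
    ('a \<times> 'b \<Rightarrow>\<^sub>0 complex) set \<Rightarrow> ('a \<times> 'b \<Rightarrow>\<^sub>0 complex) set \<Rightarrow> complex" where
  "tensor_form h h' X Y =
     (let x = (SOME x. x \<in> X); y = (SOME y. y \<in> Y) in
      \<Sum>(a, b)\<in>Poly_Mapping.keys x. \<Sum>(a', b')\<in>Poly_Mapping.keys y.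
        cnj (Poly_Mapping.lookup x (a, b)) * Poly_Mapping.lookup y (a', b') * (h a a' * h' b b'))"

section \<open>The operators \<open>D\<^sup>-\<close> and \<open>D\<^sup>+\<close>\<close>

definition Dminus :: "('g::real_vector \<Rightarrow> 'g \<Rightarrow> 'g) \<Rightarrow> ('g \<times> 'g) set \<Rightarrow> nat \<Rightarrow> (nat \<Rightarrow> 'g \<times> 'g) \<Rightarrow>
    (nat \<Rightarrow> 'g \<times> 'g \<Rightarrow> complex) \<Rightarrow>
    (('g \<times> 'g) free_alg set \<times> 'g weyl_vec free_alg set \<Rightarrow>\<^sub>0 complex) set" where
  "Dminus br p n z zs =
     (\<Oplus>\<^bsub>tensor (env br UNIV) (weyl p)\<^esub>i\<in>{..<n}.
        simple_tensor (env br UNIV) (weyl p) (env_gen br UNIV (z i)) (weyl_gen p (0, zs i)))"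

definition Dplus :: "('g::real_vector \<Rightarrow> 'g \<Rightarrow> 'g) \<Rightarrow> ('g \<times> 'g) set \<Rightarrow> nat \<Rightarrow> (nat \<Rightarrow> 'g \<times> 'g) \<Rightarrow>
    (nat \<Rightarrow> 'g \<times> 'g) \<Rightarrow>
    (('g \<times> 'g) free_alg set \<times> 'g weyl_vec free_alg set \<Rightarrow>\<^sub>0 complex) set" where
  "Dplus br p n z z' =
     (\<Oplus>\<^bsub>tensor (env br UNIV) (weyl p)\<^esub>i\<in>{..<n}.
        simple_tensor (env br UNIV) (weyl p) (env_gen br UNIV (z i)) (weyl_gen p (z' i, 0)))"

section \<open>Lie groups\<close>

text \<open>\<open>C\<^sup>n\<close> maps on a relatively open subset \<open>S\<close> of a finite-dimensional subspace \<open>E\<close>: all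
  iterated directional derivatives along \<open>E\<close> up to order \<open>n\<close> exist and are continuous on \<open>S\<close>.\<close>

primrec Cn_on :: "nat \<Rightarrow> 'a::real_normed_vector set \<Rightarrow> 'a set \<Rightarrow> ('a \<Rightarrow> 'b::real_normed_vector) \<Rightarrow> bool"
  where
  "Cn_on 0 E S f \<longleftrightarrow> continuous_on S f"
| "Cn_on (Suc n) E S f \<longleftrightarrow>
     continuous_on S f \<and>
     (\<forall>v\<in>E. \<exists>f'. (\<forall>x\<in>S. ((\<lambda>t. f (x + t *\<^sub>R v)) has_vector_derivative f' x) (at 0)) \<and> Cn_on n E S f')"

definition smooth_on :: "'a::real_normed_vector set \<Rightarrow> 'a set \<Rightarrow> ('a \<Rightarrow> 'b::real_normed_vector) \<Rightarrow> bool"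
  where "smooth_on E S f \<longleftrightarrow> (\<forall>n. Cn_on n E S f)"

text \<open>A chart \<open>(U, \<phi>, \<psi>)\<close> consists of an open set, a homeomorphism onto an open subset of the model
  space \<open>E\<close>, and its inverse.\<close>

type_synonym ('k, 'g) chart = "'k set \<times> ('k \<Rightarrow> 'g) \<times> ('g \<Rightarrow> 'k)"

locale lie_group = group K
  for K :: "'k::{t2_space, second_countable_topology} monoid" +
  fixes E :: "'g::real_normed_vector set" and atlas :: "('k, 'g) chart set"
  assumes carrier_UNIV: "carrier K = UNIV"
    and model: "\<exists>S. finite S \<and> span S = E"
    and charts: "(U, \<phi>, \<psi>) \<in> atlas \<Longrightarrow>
      open U \<and> openin (top_of_set E) (\<phi> ` U) \<and> homeomorphism U (\<phi> ` U) \<phi> \<psi>"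
    and cover: "\<exists>U \<phi> \<psi>. (U, \<phi>, \<psi>) \<in> atlas \<and> g \<in> U"
    and compatible: "\<lbrakk>(U, \<phi>, \<psi>) \<in> atlas; (U', \<phi>', \<psi>') \<in> atlas\<rbrakk> \<Longrightarrow>
      smooth_on E (\<phi> ` (U \<inter> U')) (\<lambda>x. \<phi>' (\<psi> x))"
    and mult_continuous: "continuous_on UNIV (\<lambda>(g, h). g \<otimes>\<^bsub>K\<^esub> h)"
    and mult_smooth:
      "\<lbrakk>(U, \<phi>, \<psi>) \<in> atlas; (U', \<phi>', \<psi>') \<in> atlas; (U'', \<phi>'', \<psi>'') \<in> atlas\<rbrakk> \<Longrightarrow>
       smooth_on (E \<times> E) {(x, y). x \<in> \<phi> ` U \<and> y \<in> \<phi>' ` U' \<and> \<psi> x \<otimes>\<^bsub>K\<^esub> \<psi>' y \<in> U''}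
         (\<lambda>(x, y). \<phi>'' (\<psi> x \<otimes>\<^bsub>K\<^esub> \<psi>' y))"
    and inv_continuous: "continuous_on UNIV (\<lambda>g. inv\<^bsub>K\<^esub> g)"
    and inv_smooth:
      "\<lbrakk>(U, \<phi>, \<psi>) \<in> atlas; (U', \<phi>', \<psi>') \<in> atlas\<rbrakk> \<Longrightarrow>
       smooth_on E {x \<in> \<phi> ` U. inv\<^bsub>K\<^esub> (\<psi> x) \<in> U'} (\<lambda>x. \<phi>' (inv\<^bsub>K\<^esub> (\<psi> x)))"

text \<open>The one-parameter subgroup \<open>t \<mapsto> exp(t X)\<close>: a chart \<open>\<phi>\<close> centred at \<open>\<one>\<close> identifies the tangent
  space at \<open>\<one>\<close> with the model space.\<close>

definition one_parameter :: "'k::topological_space monoid \<Rightarrow> ('k \<Rightarrow> 'g::real_normed_vector) \<Rightarrow> 'g \<Rightarrow>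
    (real \<Rightarrow> 'k) \<Rightarrow> bool" where
  "one_parameter K \<phi> X \<gamma> \<longleftrightarrow>
     continuous_on UNIV \<gamma> \<and> (\<forall>s t. \<gamma> (s + t) = \<gamma> s \<otimes>\<^bsub>K\<^esub> \<gamma> t) \<and>
     ((\<lambda>t. \<phi> (\<gamma> t)) has_vector_derivative X) (at 0)"

text \<open>The adjoint action, the differential at \<open>\<one>\<close> of conjugation by \<open>g\<close>.\<close>

definition lie_Ad :: "'k monoid \<Rightarrow> ('k, 'g::real_normed_vector) chart \<Rightarrow> 'k \<Rightarrow> 'g \<Rightarrow> 'g" where
  "lie_Ad K = (\<lambda>(U, \<phi>, \<psi>) g Y.
     vector_derivative (\<lambda>t. \<phi> (g \<otimes>\<^bsub>K\<^esub> \<psi> (t *\<^sub>R Y) \<otimes>\<^bsub>K\<^esub> inv\<^bsub>K\<^esub> g)) (at 0))"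

section \<open>\<open>(g, K)\<close>-modules\<close>

text \<open>\<open>K\<close> is a Lie group whose Lie algebra is identified with \<open>k0\<close> by the differential of the
  chart \<open>(U, \<phi>, \<psi>)\<close> centred at \<open>\<one>\<close>, and \<open>Ad\<close> is an action of \<open>K\<close> on the complexification of \<open>'g\<close> by
  Lie algebra automorphisms which extends the adjoint action of \<open>K\<close> and has differential \<open>ad\<close>.\<close>

locale gK_pair = lie_group K k0 atlas
  for K :: "'k::{t2_space, second_countable_topology} monoid"
    and k0 :: "'g::real_normed_vector set"
    and atlas :: "('k, 'g) chart set" +
  fixes br :: "'g \<Rightarrow> 'g \<Rightarrow> 'g"
    and U :: "'k set" and \<phi> :: "'k \<Rightarrow> 'g" and \<psi> :: "'g \<Rightarrow> 'k"
    and Ad :: "'k \<Rightarrow> 'g \<times> 'g \<Rightarrow> 'g \<times> 'g"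
  assumes chart_one: "(U, \<phi>, \<psi>) \<in> atlas" "\<one>\<^bsub>K\<^esub> \<in> U" "\<phi> \<one>\<^bsub>K\<^esub> = 0"
    and lie_algebra: "\<lbrakk>X \<in> k0; Y \<in> k0; one_parameter K \<phi> X \<gamma>\<rbrakk> \<Longrightarrow>
      ((\<lambda>t. lie_Ad K (U, \<phi>, \<psi>) (\<gamma> t) Y) has_vector_derivative br X Y) (at 0)"
    and Ad_linear: "Ad g (x + y) = Ad g x + Ad g y" "Ad g (cscale c x) = cscale c (Ad g x)"
    and Ad_bracket: "Ad g (cbracket br x y) = cbracket br (Ad g x) (Ad g y)"
    and Ad_action: "Ad \<one>\<^bsub>K\<^esub> x = x" "Ad (g \<otimes>\<^bsub>K\<^esub> h) x = Ad g (Ad h x)"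
    and Ad_continuous: "continuous_on UNIV (\<lambda>g. Ad g x)"
    and Ad_k0: "Y \<in> k0 \<Longrightarrow> Ad g (Y, 0) = (lie_Ad K (U, \<phi>, \<psi>) g Y, 0)"
    and Ad_differential: "\<lbrakk>X \<in> k0; one_parameter K \<phi> X \<gamma>\<rbrakk> \<Longrightarrow>
      ((\<lambda>t. Ad (\<gamma> t) x) has_vector_derivative cbracket br (X, 0) x) (at 0)"

text \<open>A module over the complex Lie subalgebra \<open>L\<close> of the complexification.\<close>

definition lie_module :: "('g::real_vector \<Rightarrow> 'g \<Rightarrow> 'g) \<Rightarrow> ('g \<times> 'g) set \<Rightarrow>
    (complex \<Rightarrow> 'm \<Rightarrow> 'm) \<Rightarrow> ('g \<times> 'g \<Rightarrow> 'm \<Rightarrow> 'm::ab_group_add) \<Rightarrow> bool" where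
  "lie_module br L s \<rho> \<longleftrightarrow>
     vector_space s \<and>
     (\<forall>x\<in>L. Vector_Spaces.linear s s (\<rho> x)) \<and>
     (\<forall>x\<in>L. \<forall>y\<in>L. \<forall>v. \<rho> (x + y) v = \<rho> x v + \<rho> y v) \<and>
     (\<forall>c. \<forall>x\<in>L. \<forall>v. \<rho> (cscale c x) v = s c (\<rho> x v)) \<and>
     (\<forall>x\<in>L. \<forall>y\<in>L. \<forall>v. \<rho> (cbracket br x y) v = \<rho> x (\<rho> y v) - \<rho> y (\<rho> x v))"

text \<open>The vectors \<open>\<kappa> g m\<close>, for fixed \<open>m\<close>, span a finite-dimensional space; continuity and
  differentiability there (in its canonical topology) are tested with linear functionals.\<close>

locale gK_module = gK_pair K k0 atlas br U \<phi> \<psi> Ad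
  for K :: "'k::{t2_space, second_countable_topology} monoid"
    and k0 :: "'g::real_normed_vector set"
    and atlas br U \<phi> \<psi> Ad +
  fixes s :: "complex \<Rightarrow> 'm \<Rightarrow> 'm::ab_group_add"
    and \<pi> :: "'g \<times> 'g \<Rightarrow> 'm \<Rightarrow> 'm"
    and \<kappa> :: "'k \<Rightarrow> 'm \<Rightarrow> 'm"
  assumes g_module: "lie_module br UNIV s \<pi>"
    and K_linear: "Vector_Spaces.linear s s (\<kappa> g)"
    and K_action: "\<kappa> \<one>\<^bsub>K\<^esub> m = m" "\<kappa> (g \<otimes>\<^bsub>K\<^esub> h) m = \<kappa> g (\<kappa> h m)"
    and K_locally_finite: "\<exists>F. finite F \<and> (\<forall>g. \<kappa> g m \<in> module.span s F)"
    and K_continuous: "Vector_Spaces.linear s (*) l \<Longrightarrow> continuous_on UNIV (\<lambda>g. l (\<kappa> g m))"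
    and K_differential: "\<lbrakk>X \<in> k0; one_parameter K \<phi> X \<gamma>; Vector_Spaces.linear s (*) l\<rbrakk> \<Longrightarrow>
      ((\<lambda>t. l (\<kappa> (\<gamma> t) m)) has_vector_derivative l (\<pi> (X, 0) m)) (at 0)"
    and K_compatible: "\<kappa> g (\<pi> x m) = \<pi> (Ad g x) (\<kappa> g m)"

definition K_irreducible ::
  "(complex \<Rightarrow> 'm \<Rightarrow> 'm::ab_group_add) \<Rightarrow> ('k \<Rightarrow> 'm \<Rightarrow> 'm) \<Rightarrow> 'm set \<Rightarrow> bool" where
  "K_irreducible s \<kappa> V \<longleftrightarrow>
     module.subspace s V \<and> (\<forall>g. \<kappa> g ` V \<subseteq> V) \<and> V \<noteq> {0} \<and>
     (\<forall>W. module.subspace s W \<and> (\<forall>g. \<kappa> g ` W \<subseteq> W) \<and> W \<subseteq> V \<longrightarrow> W = {0} \<or> W = V)"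

text \<open>The isotypic component of the type of \<open>V\<close>: the sum of all submodules isomorphic to \<open>V\<close>.
  Every linear map defined on \<open>V\<close> is the restriction of one defined everywhere.\<close>

definition K_isotypic ::
  "(complex \<Rightarrow> 'm \<Rightarrow> 'm::ab_group_add) \<Rightarrow> ('k \<Rightarrow> 'm \<Rightarrow> 'm) \<Rightarrow> 'm set \<Rightarrow> 'm set" where
  "K_isotypic s \<kappa> V =
     module.span s (\<Union>{f ` V | f. Vector_Spaces.linear s s f \<and> inj_on f V \<and>
                                 (\<forall>g. \<forall>v\<in>V. f (\<kappa> g v) = \<kappa> g (f v))})"

definition admissible ::
  "(complex \<Rightarrow> 'm \<Rightarrow> 'm::ab_group_add) \<Rightarrow> ('k \<Rightarrow> 'm \<Rightarrow> 'm) \<Rightarrow> bool" where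
  "admissible s \<kappa> \<longleftrightarrow>
     (\<forall>V. K_irreducible s \<kappa> V \<longrightarrow> (\<exists>F. finite F \<and> K_isotypic s \<kappa> V \<subseteq> module.span s F))"

definition env_action :: "(complex \<Rightarrow> 'm \<Rightarrow> 'm::ab_group_add) \<Rightarrow> ('g \<times> 'g \<Rightarrow> 'm \<Rightarrow> 'm) \<Rightarrow>
    ('g \<times> 'g) free_alg set \<Rightarrow> 'm \<Rightarrow> 'm" where
  "env_action s \<rho> = presented_action (vspace UNIV s) \<rho>"

text \<open>\<open>chi\<close> is an algebra homomorphism from the centre of the enveloping algebra to \<open>\<complex>\<close>, by which the
  centre acts.\<close>

definition infinitesimal_character :: "('g::real_vector \<Rightarrow> 'g \<Rightarrow> 'g) \<Rightarrow>
    (complex \<Rightarrow> 'm \<Rightarrow> 'm::ab_group_add) \<Rightarrow> ('g \<times> 'g \<Rightarrow> 'm \<Rightarrow> 'm) \<Rightarrow>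
    (('g \<times> 'g) free_alg set \<Rightarrow> complex) \<Rightarrow> bool" where
  "infinitesimal_character br s \<pi> chi \<longleftrightarrow>
     chi \<one>\<^bsub>env br UNIV\<^esub> = 1 \<and>
     (\<forall>y\<in>env_center br. \<forall>z\<in>env_center br. chi (y \<oplus>\<^bsub>env br UNIV\<^esub> z) = chi y + chi z) \<and>
     (\<forall>y\<in>env_center br. \<forall>z\<in>env_center br. chi (y \<otimes>\<^bsub>env br UNIV\<^esub> z) = chi y * chi z) \<and>
     (\<forall>c. \<forall>z\<in>env_center br. chi (c \<odot>\<^bsub>env br UNIV\<^esub> z) = c * chi z) \<and>
     (\<forall>z\<in>env_center br. \<forall>m. env_action s \<pi> z m = s (chi z) m)"

definition nondegenerate_hermitian ::
  "(complex \<Rightarrow> 'm \<Rightarrow> 'm::ab_group_add) \<Rightarrow> ('m \<Rightarrow> 'm \<Rightarrow> complex) \<Rightarrow> bool" where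
  "nondegenerate_hermitian s h \<longleftrightarrow>
     (\<forall>m a b. h m (a + b) = h m a + h m b) \<and>
     (\<forall>c m a. h m (s c a) = c * h m a) \<and>
     (\<forall>a b. h b a = cnj (h a b)) \<and>
     (\<forall>a. (\<forall>b. h a b = 0) \<longrightarrow> a = 0)"

definition star_invariant :: "('g::real_vector \<Rightarrow> 'g \<Rightarrow> 'g) \<Rightarrow>
    (complex \<Rightarrow> 'm \<Rightarrow> 'm::ab_group_add) \<Rightarrow> ('g \<times> 'g \<Rightarrow> 'm \<Rightarrow> 'm) \<Rightarrow> ('m \<Rightarrow> 'm \<Rightarrow> complex) \<Rightarrow> bool" where
  "star_invariant br s \<pi> h \<longleftrightarrow>
     (\<forall>u \<in> carrier (env br UNIV). \<forall>m m'.
        h (env_action s \<pi> u m) m' = h m (env_action s \<pi> (env_star u) m'))"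

definition simple_findim_lie_module :: "('g::real_vector \<Rightarrow> 'g \<Rightarrow> 'g) \<Rightarrow> ('g \<times> 'g) set \<Rightarrow>
    (complex \<Rightarrow> 'm \<Rightarrow> 'm::ab_group_add) \<Rightarrow> ('g \<times> 'g \<Rightarrow> 'm \<Rightarrow> 'm) \<Rightarrow> bool" where
  "simple_findim_lie_module br L s \<rho> \<longleftrightarrow>
     lie_module br L s \<rho> \<and>
     (\<exists>F. finite F \<and> module.span s F = UNIV) \<and>
     (UNIV :: 'm set) \<noteq> {0} \<and>
     (\<forall>W. module.subspace s W \<and> (\<forall>x\<in>L. \<rho> x ` W \<subseteq> W) \<longrightarrow> W = {0} \<or> W = UNIV)"

text \<open>The sum of all \<open>L\<close>-submodules of \<open>'m\<close> isomorphic to the \<open>L\<close>-module \<open>'s\<close>.\<close>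

definition isotypic_component :: "('g \<times> 'g) set \<Rightarrow>
    (complex \<Rightarrow> 's \<Rightarrow> 's::ab_group_add) \<Rightarrow> ('g \<times> 'g \<Rightarrow> 's \<Rightarrow> 's) \<Rightarrow>
    (complex \<Rightarrow> 'm \<Rightarrow> 'm::ab_group_add) \<Rightarrow> ('g \<times> 'g \<Rightarrow> 'm \<Rightarrow> 'm) \<Rightarrow> 'm set" where
  "isotypic_component L sS \<sigma> sM \<pi> =
     module.span sM (\<Union>{range f | f. Vector_Spaces.linear sS sM f \<and> inj f \<and>
                                    (\<forall>x\<in>L. \<forall>v. f (\<sigma> x v) = \<pi> x (f v))})"

definition acting_scalar :: "(complex \<Rightarrow> 's \<Rightarrow> 's::ab_group_add) \<Rightarrow> ('g \<times> 'g \<Rightarrow> 's \<Rightarrow> 's) \<Rightarrow>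
    ('g \<times> 'g) free_alg set \<Rightarrow> complex" where
  "acting_scalar s \<rho> u = (THE c. \<forall>v. env_action s \<rho> u v = s c v)"

end

(*
  Let z_i be a basis of p with B-dual basis z'_i; then z_i^* is the functional B(z'_i, .). Expand both
  squared norms of D^+ x and D^- x, for x = m (x) q, as double sums with coefficients <z_i m, z_j m>.
  Multiplication by a vector and differentiation along its conjugate are adjoint on S(p) and commute up
  to a scalar, so, as q is real, the (i, j) terms of the two sums differ by B(z'_j, conj z'_i) <q, q>.
  By invariance <z_i m, z_j m> = -<m, conj(z_i) z_j m>, and summing over i recombines the conjugates
  into z'_j, which leaves -<m, (sum_j z'_j z_j) m> <q, q>. Finally sum_j z'_j z_j = Omega(g) - Omega(k),
  where Omega(g) acts through the infinitesimal character and Omega(k) on M(sigma) by Schur's lemma.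

  Elements of presented algebras are cosets of the free algebra; operators on them are lifted to the
  free algebra, where derivations commute exactly and no choice of representatives intervenes.
*)
theory Submission
  imports Defs "HOL-Computational_Algebra.Fundamental_Theorem_Algebra"
begin

section \<open>Linear extension\<close>

text \<open>The two Casimir elements lie in different presented algebras, U(g) and U(k), so their
  difference is never formed as an element. Every sum over dual bases is instead a sum of T(w_i,
  w'_i) for a map T bilinear on a subspace, and three facts about such sums do the work: the two
  slots may be exchanged, a skew map D acting as a derivation annihilates the sum, and the sum for g
  splits into those for k and p. With T(a, b) = \<pi>(a) \<pi>(b) m the first and third compare the
  actions on m. The second, with D = ad x, gives both centrality in U(g), where T takes values
  modulo the relation ideal, and commutation with k before Schur's lemma.

  No basis of U(g), S(p) or the Weyl algebra is needed. A relation ideal enters only through its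
  minimality: an operator descends to the quotient once it respects the generating relations. The
  constant term vanishes on the ideal of S(p) for the same reason, so evaluation at 0 is well
  defined.

  The cancellation of second order terms needs a symmetric pairing. The hermitian pairing is
  therefore factored into a complex-bilinear one, which is symmetric, and a conjugation of the first
  argument.\<close>

lemma lookup_pm_scale [simp]: "Poly_Mapping.lookup (pm_scale c a) w = c * Poly_Mapping.lookup a w"
  unfolding pm_scale_def by transfer (auto simp: when_def)

lemma pm_scale_single [simp]: "pm_scale c (Poly_Mapping.single w d) = Poly_Mapping.single w (c * d)"
  by (rule poly_mapping_eqI) (auto simp: lookup_single when_def)

lemma vector_space_pm_scale: "vector_space pm_scale"
  by unfold_locales (auto intro!: poly_mapping_eqI simp: lookup_add algebra_simps)

lemma keys_pm_scale: "Poly_Mapping.keys (pm_scale c a) \<subseteq> Poly_Mapping.keys a"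
  by (auto simp: in_keys_iff)

lemma pm_scale_mult_left: "pm_scale c (a :: 'b::monoid_add \<Rightarrow>\<^sub>0 complex) * b = pm_scale c (a * b)"
  by (simp add: pm_scale_def mult_map_scale_conv_mult mult.assoc)

text \<open>Freshness of \<open>w\<close> and \<open>c \<noteq> 0\<close> guarantee that the support
  grows by exactly \<open>w\<close>, which \<open>free_algebra_induct\<close> needs to stay inside a
  carrier defined by supports.\<close>

lemma pm_induct [case_names zero add]:
  assumes "P 0" "\<And>a w c. P a \<Longrightarrow> w \<notin> Poly_Mapping.keys a \<Longrightarrow> c \<noteq> 0 \<Longrightarrow> P (a + Poly_Mapping.single w c)"
  shows "P (a :: 'b \<Rightarrow>\<^sub>0 'c::ab_group_add)"
proof (induction a rule: update_induct)
  case const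
  then show ?case by fact
next
  case (update f a b)
  have "Poly_Mapping.update a b f = f + Poly_Mapping.single a b"
    using update(1)
    by (auto intro!: poly_mapping_eqI simp: lookup_update lookup_add lookup_single in_keys_iff when_def)
  then show ?case using update assms(2) by metis
qed

lemma single_zero_commute:
  "Poly_Mapping.single 0 c * a = a * Poly_Mapping.single (0::'b::monoid_add) (c::complex)"
  by (induction a rule: pm_induct)
     (auto simp: mult_single algebra_simps)

lemma pm_scale_mult_right: "(a :: 'b::monoid_add \<Rightarrow>\<^sub>0 complex) * pm_scale c b = pm_scale c (a * b)"
  unfolding pm_scale_def mult_map_scale_conv_mult
  by (metis mult.assoc single_zero_commute)

text \<open>The universal property of the free vector space. The scalar action \<open>s\<close> is a
  parameter so that conjugate-linear extensions are covered too, by twisting the action with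
  \<open>cnj\<close>.\<close>

definition lin :: "(complex \<Rightarrow> 'n \<Rightarrow> 'n::ab_group_add) \<Rightarrow> ('b \<Rightarrow> 'n) \<Rightarrow> ('b \<Rightarrow>\<^sub>0 complex) \<Rightarrow> 'n" where
  "lin s f a = (\<Sum>w\<in>Poly_Mapping.keys a. s (Poly_Mapping.lookup a w) (f w))"

locale complex_space = vector_space scale
  for scale :: "complex \<Rightarrow> 'n \<Rightarrow> 'n::ab_group_add"
begin

text \<open>Cancellation can shrink the support of a sum, so additivity is proved by evaluating all
  three terms over one common finite set.\<close>

lemma lin_superset:
  "finite A \<Longrightarrow> Poly_Mapping.keys a \<subseteq> A \<Longrightarrow> lin scale f a = (\<Sum>w\<in>A. scale (Poly_Mapping.lookup a w) (f w))"
  unfolding lin_def by (rule sum.mono_neutral_left) (auto simp: in_keys_iff)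

lemma lin_add: "lin scale f (a + b) = lin scale f a + lin scale f b"
proof -
  let ?A = "Poly_Mapping.keys a \<union> Poly_Mapping.keys b"
  have "lin scale f (a + b) = (\<Sum>w\<in>?A. scale (Poly_Mapping.lookup (a + b) w) (f w))"
    by (rule lin_superset) (auto simp: keys_add)
  also have "\<dots> = (\<Sum>w\<in>?A. scale (Poly_Mapping.lookup a w) (f w)) +
      (\<Sum>w\<in>?A. scale (Poly_Mapping.lookup b w) (f w))"
    by (simp add: lookup_add scale_left_distrib sum.distrib)
  finally show ?thesis
    by (simp add: lin_superset[of ?A])
qed

lemma lin_scale: "lin scale f (pm_scale c a) = scale c (lin scale f a)"
  by (subst lin_superset[OF _ keys_pm_scale]) (auto simp: lin_def scale_sum_right mult.commute)

lemma lin_single [simp]: "lin scale f (Poly_Mapping.single w c) = scale c (f w)"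
  by (simp add: lin_def)

lemma lin_zero [simp]: "lin scale f 0 = 0"
  by (simp add: lin_def)

lemma lin_linear: "Vector_Spaces.linear pm_scale scale (lin scale f)"
  by (intro Vector_Spaces.linear_iff[THEN iffD2] conjI allI vector_space_pm_scale
      vector_space_axioms lin_add lin_scale)

lemma lin_diff: "lin scale f (a - b) = lin scale f a - lin scale f b"
  using lin_add[of f "a - b" b] by simp

lemma lin_sum: "lin scale f (sum g A) = (\<Sum>i\<in>A. lin scale f (g i))"
  by (induction A rule: infinite_finite_induct) (auto simp: lin_add)

lemma lin_mem:
  assumes "subspace N" "\<And>w. w \<in> Poly_Mapping.keys a \<Longrightarrow> f w \<in> N"
  shows "lin scale f a \<in> N"
  unfolding lin_def using assms by (auto intro!: subspace_sum subspace_scale)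

lemma lin_cong: "(\<And>w. w \<in> Poly_Mapping.keys a \<Longrightarrow> f w = g w) \<Longrightarrow> lin scale f a = lin scale g a"
  by (simp add: lin_def)

lemma lin_fun_add: "lin scale (\<lambda>w. f w + g w) a = lin scale f a + lin scale g a"
  by (simp add: lin_def scale_right_distrib sum.distrib)

lemma lin_fun_diff: "lin scale (\<lambda>w. f w - g w) a = lin scale f a - lin scale g a"
  by (simp add: lin_def scale_right_diff_distrib sum_subtractf)

lemma lin_fun_scale: "lin scale (\<lambda>w. scale c (f w)) a = scale c (lin scale f a)"
  by (simp add: lin_def scale_sum_right mult.commute)

lemma lin_fun_zero [simp]: "lin scale (\<lambda>w. 0) a = 0"
  by (simp add: lin_def)

lemma linear_eq_lin:
  assumes "Vector_Spaces.linear pm_scale scale L"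
  shows "L a = lin scale (\<lambda>w. L (Poly_Mapping.single w 1)) a"
proof -
  interpret L: Vector_Spaces.linear pm_scale scale L by fact
  show ?thesis
  proof (induction a rule: pm_induct)
    case zero
    show ?case by (simp add: L.zero)
  next
    case (add a w c)
    then show ?case using L.scale[of c "Poly_Mapping.single w 1"] by (simp add: L.add lin_add)
  qed
qed

end

interpretation pm: complex_space pm_scale
  by (intro complex_space.intro vector_space_pm_scale)

lemma linear_lin:
  assumes "Vector_Spaces.linear s s' g"
  shows "g (lin s f a) = lin s' (\<lambda>w. g (f w)) a"
proof -
  interpret g: Vector_Spaces.linear s s' g by fact
  show ?thesis by (simp add: lin_def g.sum g.scale)
qed

text \<open>Brings the second argument of a bilinear extension into the outer position, where
  \<open>lin_null\<close> can be applied to it.\<close>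

lemma lin_swap:
  assumes "complex_space s"
  shows "lin s (\<lambda>w. lin s (f w) b) a = lin s (\<lambda>v. lin s (\<lambda>w. f w v) a) b"
proof -
  interpret complex_space s by fact
  show ?thesis
    unfolding lin_def scale_sum_right by (subst sum.swap) (simp add: mult.commute)
qed

section \<open>Quotients by subspaces\<close>

text \<open>Nothing is assumed about multiplication in \<open>A\<close>, so that the locale covers
  algebras modulo ideals as well as tensor products. The operations are those of the ambient type,
  which turns membership in a coset into membership of a difference in \<open>I\<close>.\<close>

locale quotient_space =
  fixes A :: "(complex, 'a::ab_group_add) Module.module" and s and I :: "'a set"
  assumes complex_space: "complex_space s"
    and record_simps: "add A = (+)" "zero A = 0" "smult A = s"
    and subspace_carrier: "module.subspace s (carrier A)"
    and subspace_I: "module.subspace s I"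
    and I_subset: "I \<subseteq> carrier A"
begin

sublocale vs: complex_space s by (rule complex_space)

abbreviation "Q \<equiv> quotient_record A I"
abbreviation cl :: "'a \<Rightarrow> 'a set" where "cl a \<equiv> I +>\<^bsub>A\<^esub> a"

lemma mem_cl: "x \<in> cl a \<longleftrightarrow> x - a \<in> I"
  by (force simp: a_r_coset_def r_coset_def record_simps)

lemma self_mem_cl: "a \<in> cl a"
  by (simp add: mem_cl vs.subspace_0[OF subspace_I])

lemma cl_eq_iff: "cl a = cl b \<longleftrightarrow> a - b \<in> I"
proof
  show "a - b \<in> I" if "cl a = cl b"
    using self_mem_cl[of a] that by (simp add: mem_cl)
  show "cl a = cl b" if ab: "a - b \<in> I"
  proof -
    have "x - a \<in> I \<longleftrightarrow> x - b \<in> I" for x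
      using vs.subspace_add[OF subspace_I _ ab, of "x - a"]
        vs.subspace_diff[OF subspace_I _ ab, of "x - b"] by auto
    then show ?thesis by (auto simp: mem_cl)
  qed
qed

lemma cl_zero: "cl 0 = I"
  by (auto simp: mem_cl)

lemma carrier_quotient: "carrier Q = cl ` carrier A"
  by (auto simp: quotient_record_def FactRing_def A_RCOSETS_def RCOSETS_def a_r_coset_def
      ring.extend_def module.fields_def)

lemma zero_quotient: "zero Q = cl 0"
  by (simp add: quotient_record_def FactRing_def ring.extend_def module.fields_def cl_zero)

lemma add_cl: "add Q (cl a) (cl b) = cl (a + b)"
proof -
  have "add Q (cl a) (cl b) = {x + y | x y. x \<in> cl a \<and> y \<in> cl b}"
    by (auto simp: quotient_record_def FactRing_def ring.extend_def module.fields_def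
        set_add_def set_mult_def record_simps)
  also have "\<dots> = cl (a + b)"
  proof (rule subset_antisym; rule subsetI)
    fix x assume "x \<in> {x + y | x y. x \<in> cl a \<and> y \<in> cl b}"
    then obtain u v where "x = u + v" "u - a \<in> I" "v - b \<in> I" by (auto simp: mem_cl)
    then have "x - (a + b) = (u - a) + (v - b)" by simp
    then show "x \<in> cl (a + b)"
      unfolding mem_cl
      using \<open>u - a \<in> I\<close> \<open>v - b \<in> I\<close> vs.subspace_add[OF subspace_I] by metis
  next
    fix x assume "x \<in> cl (a + b)"
    then have "x - b \<in> cl a" by (simp add: mem_cl algebra_simps)
    then have "x = (x - b) + b \<and> x - b \<in> cl a \<and> b \<in> cl b"
      using self_mem_cl by simp
    then show "x \<in> {x + y | x y. x \<in> cl a \<and> y \<in> cl b}" by blast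
  qed
  finally show ?thesis .
qed

lemma smult_cl: "smult Q c (cl a) = cl (s c a)"
proof -
  have "smult Q c (cl a) = (\<Union>x\<in>cl a. cl (s c x))"
    by (simp add: quotient_record_def FactRing_def ring.extend_def module.fields_def record_simps)
  \<comment> \<open>All cosets in the union that defines scalar multiplication coincide, so the
    union is a single coset.\<close>
  also have "cl (s c x) = cl (s c a)" if "x \<in> cl a" for x
    using that vs.subspace_scale[OF subspace_I, of "x - a" c]
    by (simp add: mem_cl cl_eq_iff vs.scale_right_diff_distrib)
  then have "(\<Union>x\<in>cl a. cl (s c x)) = cl (s c a)"
    using self_mem_cl by blast
  finally show ?thesis .
qed

text \<open>The one fact about \<open>SOME\<close> used for cosets: every definition through a
  chosen representative is evaluated by showing that a change by an element of \<open>I\<close> is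
  harmless.\<close>

lemma representative_cl:
  shows "(SOME x. x \<in> cl a) - a \<in> I"
  using self_mem_cl[of a] by (metis mem_cl someI)

lemma abelian_monoid_quotient: "abelian_monoid Q"
  by (rule abelian_monoidI)
     (auto simp: carrier_quotient zero_quotient add_cl vs.subspace_0[OF subspace_carrier]
       vs.subspace_add[OF subspace_carrier] add_ac)

lemma finsum_cl:
  assumes "finite S" "\<And>i. i \<in> S \<Longrightarrow> g i \<in> carrier A"
  shows "finsum Q (\<lambda>i. cl (g i)) S = cl (sum g S)"
proof -
  interpret Q: abelian_monoid Q by (rule abelian_monoid_quotient)
  show ?thesis
    using assms
    by (induction S rule: finite_induct) (auto simp: Q.finsum_insert add_cl carrier_quotient zero_quotient)
qed

end

section \<open>Presented algebras\<close>

text \<open>The operator of \<open>free_action\<close>, written with the sum of the ambient type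
  instead of the sum of a module record; it serves for M and for lifts to the free algebra
  alike.\<close>

definition free_act :: "(complex \<Rightarrow> 'n \<Rightarrow> 'n) \<Rightarrow> ('v \<Rightarrow> 'n \<Rightarrow> 'n) \<Rightarrow> 'v free_alg \<Rightarrow> 'n \<Rightarrow> 'n::ab_group_add" where
  "free_act s f a y = lin s (\<lambda>w. foldr f (letters w) y) a"

lemma letters_plus [simp]: "letters (v + w) = letters v @ letters w"
  by (simp add: plus_free_monoid_def)

lemma letters_zero [simp]: "letters 0 = []"
  by (simp add: zero_free_monoid_def)

text \<open>Exhibits the product of a monoid algebra as the bilinear extension of the monoid
  operation, so that an action can be pushed through both factors.\<close>

lemma pm_mult_eq_lin:
  fixes a b :: "'b::monoid_add \<Rightarrow>\<^sub>0 complex"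
  shows "a * b = lin pm_scale (\<lambda>w. lin pm_scale (\<lambda>v. Poly_Mapping.single (w + v) 1) b) a"
proof -
  have 1: "Vector_Spaces.linear pm_scale pm_scale (\<lambda>a. a * b)"
    by (intro Vector_Spaces.linear_iff[THEN iffD2] conjI allI vector_space_pm_scale)
       (auto simp: algebra_simps pm_scale_mult_left)
  have 2: "Vector_Spaces.linear pm_scale pm_scale (\<lambda>b. a * b)" for a :: "'b \<Rightarrow>\<^sub>0 complex"
    by (intro Vector_Spaces.linear_iff[THEN iffD2] conjI allI vector_space_pm_scale)
       (auto simp: algebra_simps pm_scale_mult_right)
  have "a * b = lin pm_scale (\<lambda>w. Poly_Mapping.single w 1 * b) a"
    by (rule pm.linear_eq_lin[OF 1])
  also have "(\<lambda>w. Poly_Mapping.single w 1 * b) =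
      (\<lambda>w. lin pm_scale (\<lambda>v. Poly_Mapping.single w 1 * Poly_Mapping.single v 1) b)"
    by (subst pm.linear_eq_lin[OF 2]) (rule refl)
  finally show ?thesis by (simp add: mult_single)
qed

lemma linear_foldr:
  assumes "complex_space s" "\<And>v. v \<in> set vs \<Longrightarrow> Vector_Spaces.linear s s (f v)"
  shows "Vector_Spaces.linear s s (foldr f vs)"
  using assms(2)
proof (induction vs)
  case Nil
  interpret complex_space s by fact
  show ?case by (simp add: linear_ident id_def)
next
  case (Cons v vs)
  then have "Vector_Spaces.linear s s (f v \<circ> foldr f vs)"
    by (intro Vector_Spaces.linear_compose) auto
  then show ?case by (simp add: comp_def)
qed

context complex_space
begin

lemma free_act_linear_left: "Vector_Spaces.linear pm_scale scale (\<lambda>a. free_act scale f a y)"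
  unfolding free_act_def by (rule lin_linear)

lemmas free_act_add_left = lin_add[of "\<lambda>w. foldr f (letters w) y" for f y, folded free_act_def]
lemmas free_act_diff_left = lin_diff[of "\<lambda>w. foldr f (letters w) y" for f y, folded free_act_def]
lemmas free_act_scale_left = lin_scale[of "\<lambda>w. foldr f (letters w) y" for f y, folded free_act_def]
lemmas free_act_sum_left = lin_sum[of "\<lambda>w. foldr f (letters w) y" for f y, folded free_act_def]

lemma free_act_single [simp]: "free_act scale f (Poly_Mapping.single w c) y = scale c (foldr f (letters w) y)"
  by (simp add: free_act_def)

lemma free_act_generator [simp]: "free_act scale f (generator v) y = f v y"
  by (simp add: generator_def)

lemma free_act_one [simp]: "free_act scale f 1 y = y"
  by (simp only: single_one[symmetric] free_act_single) simp

lemma free_act_zero_left [simp]: "free_act scale f 0 y = 0"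
  by (simp add: free_act_def)

lemma free_act_linear:
  assumes "\<And>w v. w \<in> Poly_Mapping.keys a \<Longrightarrow> v \<in> set (letters w) \<Longrightarrow> Vector_Spaces.linear scale scale (f v)"
  shows "Vector_Spaces.linear scale scale (free_act scale f a)"
proof -
  have lf: "Vector_Spaces.linear scale scale (foldr f (letters w))" if "w \<in> Poly_Mapping.keys a" for w
    by (rule linear_foldr) (use assms that complex_space_axioms in auto)
  have "free_act scale f a (y + z) = free_act scale f a y + free_act scale f a z" for y z
    unfolding free_act_def
    by (subst lin_fun_add[symmetric], rule lin_cong)
       (use lf in \<open>simp add: Vector_Spaces.linear_iff\<close>)
  moreover have "free_act scale f a (scale c y) = scale c (free_act scale f a y)" for c y
    unfolding free_act_def
    by (subst lin_fun_scale[symmetric], rule lin_cong)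
       (use lf in \<open>simp add: Vector_Spaces.linear_iff\<close>)
  ultimately show ?thesis
    using vector_space_axioms by (simp add: Vector_Spaces.linear_iff)
qed

text \<open>Concatenation of words becomes composition of \<open>foldr\<close>. Only operators for
  letters of \<open>a\<close> are applied to linear combinations, hence linearity is required of
  these alone.\<close>

lemma free_act_mult:
  assumes "\<And>w v. w \<in> Poly_Mapping.keys a \<Longrightarrow> v \<in> set (letters w) \<Longrightarrow> Vector_Spaces.linear scale scale (f v)"
  shows "free_act scale f (a * b) y = free_act scale f a (free_act scale f b y)"
proof -
  have "free_act scale f (a * b) y =
      lin scale (\<lambda>w. lin scale (\<lambda>v. foldr f (letters w) (foldr f (letters v) y)) b) a"
    by (simp add: pm_mult_eq_lin linear_lin[OF free_act_linear_left])
  also have "\<dots> = lin scale (\<lambda>w. foldr f (letters w) (free_act scale f b y)) a"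
  proof (rule lin_cong)
    fix w assume w: "w \<in> Poly_Mapping.keys a"
    have "Vector_Spaces.linear scale scale (foldr f (letters w))"
      by (rule linear_foldr) (use assms w complex_space_axioms in auto)
    then show "lin scale (\<lambda>v. foldr f (letters w) (foldr f (letters v) y)) b =
        foldr f (letters w) (free_act scale f b y)"
      unfolding free_act_def by (rule linear_lin[symmetric])
  qed
  finally show ?thesis by (simp add: free_act_def)
qed

lemma foldr_mem:
  "(\<And>v y. v \<in> set vs \<Longrightarrow> y \<in> N \<Longrightarrow> f v y \<in> N) \<Longrightarrow> y \<in> N \<Longrightarrow> foldr f vs y \<in> N"
  by (induction vs) auto

lemma free_act_mem:
  assumes "subspace N" "y \<in> N"
    and "\<And>w v z. w \<in> Poly_Mapping.keys a \<Longrightarrow> v \<in> set (letters w) \<Longrightarrow> z \<in> N \<Longrightarrow> f v z \<in> N"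
  shows "free_act scale f a y \<in> N"
  unfolding free_act_def using assms by (intro lin_mem foldr_mem) auto

end

lemma free_algebra_simps [simp]:
  "add (free_algebra L) = (+)" "zero (free_algebra L) = 0" "smult (free_algebra L) = pm_scale"
  "mult (free_algebra L) = (*)" "one (free_algebra L) = 1"
  by (simp_all add: free_algebra_def)

lemma carrier_free_algebra:
  "a \<in> carrier (free_algebra L) \<longleftrightarrow> (\<forall>w \<in> Poly_Mapping.keys a. set (letters w) \<subseteq> L)"
  by (simp add: free_algebra_def)

lemma single_in_free_algebra:
  "set (letters w) \<subseteq> L \<Longrightarrow> Poly_Mapping.single w c \<in> carrier (free_algebra L)"
  by (simp add: carrier_free_algebra)

lemma generator_in_free_algebra [simp]: "generator v \<in> carrier (free_algebra L) \<longleftrightarrow> v \<in> L"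
  by (simp add: generator_def carrier_free_algebra)

lemma one_in_free_algebra [simp]: "1 \<in> carrier (free_algebra L)"
  by (simp add: carrier_free_algebra)

lemma mult_in_free_algebra [simp]:
  "a \<in> carrier (free_algebra L) \<Longrightarrow> b \<in> carrier (free_algebra L) \<Longrightarrow> a * b \<in> carrier (free_algebra L)"
  unfolding carrier_free_algebra using keys_mult[of a b] by fastforce

lemma subspace_free_algebra: "pm.subspace (carrier (free_algebra L))"
  unfolding pm.subspace_def
proof (intro conjI ballI allI)
  show "a + b \<in> carrier (free_algebra L)"
    if "a \<in> carrier (free_algebra L)" "b \<in> carrier (free_algebra L)" for a b
    using that keys_add[of a b] unfolding carrier_free_algebra by blast
  show "pm_scale c a \<in> carrier (free_algebra L)" if "a \<in> carrier (free_algebra L)" for c a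
    using that keys_pm_scale[of c a] unfolding carrier_free_algebra by blast
qed (simp add: carrier_free_algebra)

lemmas free_algebra_closed [simp] =
  pm.subspace_add[OF subspace_free_algebra] pm.subspace_diff[OF subspace_free_algebra]
  pm.subspace_scale[OF subspace_free_algebra] pm.subspace_neg[OF subspace_free_algebra]
  pm.subspace_0[OF subspace_free_algebra]

lemma sum_in_free_algebra [simp]:
  "(\<And>i. i \<in> A \<Longrightarrow> f i \<in> carrier (free_algebra L)) \<Longrightarrow> sum f A \<in> carrier (free_algebra L)"
  by (rule pm.subspace_sum[OF subspace_free_algebra])

lemma ring_free_algebra: "ring (free_algebra L)"
proof (rule ringI)
  show "abelian_group (free_algebra L)"
    by (rule abelian_groupI) (auto simp: add_ac intro!: bexI[of _ "- x" for x])
  show "monoid (free_algebra L)"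
    by (rule monoidI) (auto simp: mult.assoc)
qed (auto simp: algebra_simps)

lemma ideal_free_algebraI:
  assumes "pm.subspace N" "N \<subseteq> carrier (free_algebra L)"
    and "\<And>a x. a \<in> N \<Longrightarrow> x \<in> carrier (free_algebra L) \<Longrightarrow> x * a \<in> N"
    and "\<And>a x. a \<in> N \<Longrightarrow> x \<in> carrier (free_algebra L) \<Longrightarrow> a * x \<in> N"
  shows "ideal N (free_algebra L)"
proof (rule idealI)
  interpret F: ring "free_algebra L" by (rule ring_free_algebra)
  show "subgroup N (add_monoid (free_algebra L))"
  proof (rule group.subgroupI[OF F.a_group])
    fix a assume a: "a \<in> N"
    have "\<ominus>\<^bsub>free_algebra L\<^esub> a = - a"
      by (rule F.minus_equality) (use a assms(2) in auto)
    then show "inv\<^bsub>add_monoid (free_algebra L)\<^esub> a \<in> N"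
      using pm.subspace_neg[OF assms(1) a] by (simp add: a_inv_def)
  qed (use assms pm.subspace_0[OF assms(1)] in \<open>auto intro: pm.subspace_add[OF assms(1)]\<close>)
qed (use assms ring_free_algebra in auto)

text \<open>Closure of the carrier under the two operations is what places the linear relations
  inside the free algebra; no further module axioms for \<open>V\<close> have to be
  supplied.\<close>

locale presentation =
  fixes V :: "(complex, 'v) Module.module" and R :: "'v free_alg set"
  assumes add_closed: "v \<in> carrier V \<Longrightarrow> w \<in> carrier V \<Longrightarrow> v \<oplus>\<^bsub>V\<^esub> w \<in> carrier V"
    and smult_closed: "v \<in> carrier V \<Longrightarrow> c \<odot>\<^bsub>V\<^esub> v \<in> carrier V"
    and R_subset: "R \<subseteq> carrier (free_algebra (carrier V))"
begin

abbreviation "F \<equiv> free_algebra (carrier V)"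
abbreviation "J \<equiv> relation_ideal V R"

lemma relations_subset: "linear_relations V \<union> R \<subseteq> carrier F"
  using R_subset by (auto simp: linear_relations_def intro!: free_algebra_closed add_closed smult_closed)

lemma ideal_J: "ideal J F"
  unfolding relation_ideal_def
  by (rule ring.genideal_ideal[OF ring_free_algebra relations_subset])

lemma relations_in_J: "linear_relations V \<union> R \<subseteq> J"
  unfolding relation_ideal_def
  by (rule ring.genideal_self[OF ring_free_algebra relations_subset])

text \<open>The induction principle for the relation ideal: a property of all its elements is proved
  by showing that the elements with this property form a two-sided ideal containing the
  relations.\<close>

lemma J_minimal:
  assumes "pm.subspace N" "N \<subseteq> carrier F"
    and "\<And>a x. a \<in> N \<Longrightarrow> x \<in> carrier F \<Longrightarrow> x * a \<in> N"
    and "\<And>a x. a \<in> N \<Longrightarrow> x \<in> carrier F \<Longrightarrow> a * x \<in> N"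
    and "linear_relations V \<subseteq> N" "R \<subseteq> N"
  shows "J \<subseteq> N"
  unfolding relation_ideal_def
  by (rule ring.genideal_minimal[OF ring_free_algebra ideal_free_algebraI]) (use assms in auto)

lemma J_subset: "J \<subseteq> carrier F"
  using ideal.Icarr[OF ideal_J] by auto

lemma J_mult: "a \<in> J \<Longrightarrow> x \<in> carrier F \<Longrightarrow> x * a \<in> J" "a \<in> J \<Longrightarrow> x \<in> carrier F \<Longrightarrow> a * x \<in> J"
  using ideal.I_l_closed[OF ideal_J] ideal.I_r_closed[OF ideal_J] by auto

lemma subspace_J: "pm.subspace J"
proof -
  interpret I: ideal J F by (rule ideal_J)
  show ?thesis
    unfolding pm.subspace_def
  proof (intro conjI ballI allI)
    show "0 \<in> J" using additive_subgroup.zero_closed[OF ideal.axioms(1)[OF ideal_J]] by simp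
    show "a + b \<in> J" if "a \<in> J" "b \<in> J" for a b
      using additive_subgroup.a_closed[OF ideal.axioms(1)[OF ideal_J] that] by simp
    \<comment> \<open>A ring ideal is closed under scalars because scaling by \<open>c\<close> is
      multiplication by the constant polynomial \<open>c\<close>.\<close>
    show "pm_scale c a \<in> J" if "a \<in> J" for c a
      using I.I_l_closed[OF that single_in_free_algebra[of 0 "carrier V" c]]
      by (simp add: pm_scale_def mult_map_scale_conv_mult)
  qed
qed

sublocale quotient_space F pm_scale J
  by unfold_locales (auto intro: subspace_free_algebra subspace_J J_subset[THEN subsetD])

lemma presented_algebra_eq: "presented_algebra V R = Q"
  by (simp add: presented_algebra_def)

lemma presented_gen_eq: "presented_gen V R v = cl (generator v)"
  by (simp add: presented_gen_def)

lemma one_quotient: "one Q = cl 1"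
  by (simp add: quotient_record_def FactRing_def ring.extend_def module.fields_def)

lemma mult_cl:
  assumes "a \<in> carrier F" "b \<in> carrier F"
  shows "mult Q (cl a) (cl b) = cl (a * b)"
  using ideal.rcoset_mult_add[OF ideal_J assms]
  by (simp add: quotient_record_def FactRing_def ring.extend_def module.fields_def)

lemma generator_add_in_J:
  "v \<in> carrier V \<Longrightarrow> w \<in> carrier V \<Longrightarrow> generator (v \<oplus>\<^bsub>V\<^esub> w) - generator v - generator w \<in> J"
  by (rule subsetD[OF relations_in_J]) (auto simp: linear_relations_def)

lemma generator_scale_in_J:
  "v \<in> carrier V \<Longrightarrow> generator (c \<odot>\<^bsub>V\<^esub> v) - pm_scale c (generator v) \<in> J"
  by (rule subsetD[OF relations_in_J]) (auto simp: linear_relations_def)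

text \<open>\<open>N\<close> is a space of lifts and \<open>N0\<close> the subspace to be divided
  out, modulo which the operators satisfy the relations. The elements mapping \<open>N\<close> into
  \<open>N0\<close> form a two-sided ideal: left multiples are fine since the letters preserve
  \<open>N0\<close>, right multiples since they preserve \<open>N\<close>. For M one takes
  \<open>UNIV\<close> and \<open>{0}\<close>, for S(p) the free algebra and its relation
  ideal.\<close>

lemma free_act_J:
  assumes s: "complex_space s"
    and N: "module.subspace s N" and N0: "module.subspace s N0" and N0_N: "N0 \<subseteq> N"
    and linear: "\<And>v. v \<in> carrier V \<Longrightarrow> Vector_Spaces.linear s s (f v)"
    and f_N: "\<And>v y. v \<in> carrier V \<Longrightarrow> y \<in> N \<Longrightarrow> f v y \<in> N"
    and f_N0: "\<And>v y. v \<in> carrier V \<Longrightarrow> y \<in> N0 \<Longrightarrow> f v y \<in> N0"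
    and f_add: "\<And>v w y. v \<in> carrier V \<Longrightarrow> w \<in> carrier V \<Longrightarrow> y \<in> N \<Longrightarrow>
      f (v \<oplus>\<^bsub>V\<^esub> w) y - f v y - f w y \<in> N0"
    and f_scale: "\<And>c v y. v \<in> carrier V \<Longrightarrow> y \<in> N \<Longrightarrow> f (c \<odot>\<^bsub>V\<^esub> v) y - s c (f v y) \<in> N0"
    and f_R: "\<And>r y. r \<in> R \<Longrightarrow> y \<in> N \<Longrightarrow> free_act s f r y \<in> N0"
    and a: "a \<in> J" and y: "y \<in> N"
  shows "free_act s f a y \<in> N0"
proof -
  interpret s: complex_space s by fact
  define I where "I = {a \<in> carrier F. \<forall>y\<in>N. free_act s f a y \<in> N0}"
  have lin: "Vector_Spaces.linear s s (f v)"
    if "a \<in> carrier F" "w \<in> Poly_Mapping.keys a" "v \<in> set (letters w)" for a w v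
    using that by (intro linear) (auto simp: carrier_free_algebra)
  have free_act_N: "free_act s f x y \<in> N" if "x \<in> carrier F" "y \<in> N" for x y
    using that by (intro s.free_act_mem[OF N] f_N) (auto simp: carrier_free_algebra)
  have free_act_N0: "free_act s f x y \<in> N0" if "x \<in> carrier F" "y \<in> N0" for x y
    using that by (intro s.free_act_mem[OF N0] f_N0) (auto simp: carrier_free_algebra)
  have "J \<subseteq> I"
  proof (rule J_minimal)
    show "pm.subspace I"
      unfolding pm.subspace_def I_def
      by (auto simp: s.free_act_add_left s.free_act_scale_left s.subspace_0[OF N0] s.subspace_add[OF N0]
          s.subspace_scale[OF N0])
    show "I \<subseteq> carrier F" by (auto simp: I_def)
    show "x * a \<in> I" if "a \<in> I" "x \<in> carrier F" for a x
      using that free_act_N0 by (auto simp: I_def s.free_act_mult[OF lin])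
    show "a * x \<in> I" if "a \<in> I" "x \<in> carrier F" for a x
      using that free_act_N by (auto simp: I_def s.free_act_mult[OF lin])
    show "linear_relations V \<subseteq> I"
      unfolding linear_relations_def I_def
      by (auto simp: s.free_act_diff_left s.free_act_scale_left f_add f_scale add_closed smult_closed)
    show "R \<subseteq> I" using f_R R_subset by (auto simp: I_def)
  qed
  then show ?thesis using a y by (auto simp: I_def)
qed

end

lemma vspace_simps [simp]:
  "carrier (vspace V s) = V" "add (vspace V s) = (+)" "zero (vspace V s) = 0" "smult (vspace V s) = s"
  by (simp_all add: vspace_def)

lemma finsum_vspace:
  assumes "finite S"
  shows "finsum (vspace UNIV s) g S = sum g S"
proof -
  interpret M: abelian_monoid "vspace UNIV s"
    by (rule abelian_monoidI) (auto simp: add_ac)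
  show ?thesis using assms by (induction S rule: finite_induct) (auto simp: M.finsum_insert)
qed

context presentation
begin

lemma presented_action_vspace:
  assumes s: "complex_space s"
    and linear: "\<And>v. v \<in> carrier V \<Longrightarrow> Vector_Spaces.linear s s (f v)"
    and f_add: "\<And>v w y. v \<in> carrier V \<Longrightarrow> w \<in> carrier V \<Longrightarrow> f (v \<oplus>\<^bsub>V\<^esub> w) y = f v y + f w y"
    and f_scale: "\<And>c v y. v \<in> carrier V \<Longrightarrow> f (c \<odot>\<^bsub>V\<^esub> v) y = s c (f v y)"
    and f_R: "\<And>r y. r \<in> R \<Longrightarrow> free_act s f r y = 0"
  shows "presented_action (vspace UNIV s) f (cl a) y = free_act s f a y"
proof -
  interpret s: complex_space s by fact
  have f0: "f v 0 = 0" if "v \<in> carrier V" for v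
    using linear[OF that] s.scale_zero_left[of 0] by (metis Vector_Spaces.linear_iff s.scale_zero_left)
  have act0: "free_act s f j y = 0" if "j \<in> J" for j
  proof -
    have "free_act s f j y \<in> {0}"
      by (rule free_act_J[where N = UNIV and N0 = "{0}", OF s])
         (use linear that in \<open>auto simp: f0 f_add f_scale f_R s.subspace_def Vector_Spaces.linear_iff\<close>)
    then show ?thesis by simp
  qed
  have "presented_action (vspace UNIV s) f (cl a) y = free_act s f (SOME x. x \<in> cl a) y"
    by (simp add: presented_action_def free_action_def free_act_def lin_def finsum_vspace)
  also have "\<dots> = free_act s f a y"
    using act0[OF representative_cl[of a]] by (simp add: s.free_act_diff_left)
  finally show ?thesis .
qed

text \<open>The operators \<open>f\<close> lift the operators \<open>f'\<close> from the quotient to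
  \<open>A\<close>. Afterwards a class acts through any representative, on any representative, and
  the relations have to be checked only modulo \<open>I\<close>.\<close>

lemma presented_action_quotient:
  assumes T: "quotient_space A s I"
    and f'_f: "\<And>v y. v \<in> carrier V \<Longrightarrow> y \<in> carrier A \<Longrightarrow> f' v (I +>\<^bsub>A\<^esub> y) = I +>\<^bsub>A\<^esub> f v y"
    and linear: "\<And>v. v \<in> carrier V \<Longrightarrow> Vector_Spaces.linear s s (f v)"
    and f_closed: "\<And>v y. v \<in> carrier V \<Longrightarrow> y \<in> carrier A \<Longrightarrow> f v y \<in> carrier A"
    and f_I: "\<And>v y. v \<in> carrier V \<Longrightarrow> y \<in> I \<Longrightarrow> f v y \<in> I"
    and f_add: "\<And>v w y. v \<in> carrier V \<Longrightarrow> w \<in> carrier V \<Longrightarrow> y \<in> carrier A \<Longrightarrow>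
      f (v \<oplus>\<^bsub>V\<^esub> w) y - f v y - f w y \<in> I"
    and f_scale: "\<And>c v y. v \<in> carrier V \<Longrightarrow> y \<in> carrier A \<Longrightarrow> f (c \<odot>\<^bsub>V\<^esub> v) y - s c (f v y) \<in> I"
    and f_R: "\<And>r y. r \<in> R \<Longrightarrow> y \<in> carrier A \<Longrightarrow> free_act s f r y \<in> I"
    and a: "a \<in> carrier F" and y: "y \<in> carrier A"
  shows "presented_action (quotient_record A I) f' (cl a) (I +>\<^bsub>A\<^esub> y) = I +>\<^bsub>A\<^esub> free_act s f a y"
proof -
  interpret T: quotient_space A s I by (rule T)
  \<comment> \<open>Membership in the carrier is carried along in the induction because
    \<open>f\<close> lifts \<open>f'\<close> only there.\<close>
  have foldr_f: "foldr f vs y \<in> carrier A \<and> foldr f' vs (T.cl y) = T.cl (foldr f vs y)"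
    if "set vs \<subseteq> carrier V" for vs
    using that y by (induction vs) (auto simp: f'_f f_closed)
  define x where "x = (SOME x. x \<in> cl a)"
  have x: "x - a \<in> J" unfolding x_def by (rule representative_cl)
  have xF: "x \<in> carrier F"
    using free_algebra_closed(1)[OF subsetD[OF J_subset x] a] by simp
  have "presented_action T.Q f' (cl a) (T.cl y) =
      finsum T.Q (\<lambda>w. T.cl (s (Poly_Mapping.lookup x w) (foldr f (letters w) y))) (Poly_Mapping.keys x)"
    unfolding presented_action_def free_action_def x_def[symmetric]
  proof (rule abelian_monoid.finsum_cong'[OF T.abelian_monoid_quotient refl])
    show "(\<lambda>w. T.cl (s (Poly_Mapping.lookup x w) (foldr f (letters w) y))) \<in>
        Poly_Mapping.keys x \<rightarrow> carrier T.Q"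
      using xF foldr_f T.vs.subspace_scale[OF T.subspace_carrier]
      by (auto simp: T.carrier_quotient carrier_free_algebra)
    show "smult T.Q (Poly_Mapping.lookup x w) (foldr f' (letters w) (T.cl y)) =
        T.cl (s (Poly_Mapping.lookup x w) (foldr f (letters w) y))" if "w \<in> Poly_Mapping.keys x" for w
      using that xF foldr_f by (auto simp: T.smult_cl carrier_free_algebra)
  qed
  also have "\<dots> = T.cl (free_act s f x y)"
    unfolding free_act_def lin_def
    by (rule T.finsum_cl)
       (use xF foldr_f T.vs.subspace_scale[OF T.subspace_carrier] in \<open>auto simp: carrier_free_algebra\<close>)
  also have "\<dots> = T.cl (free_act s f a y)"
  proof -
    have "free_act s f (x - a) y \<in> I"
      by (rule free_act_J[OF T.complex_space T.subspace_carrier T.subspace_I T.I_subset linear f_closed f_I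
            f_add f_scale f_R x y])
    then show ?thesis by (simp add: T.cl_eq_iff T.vs.free_act_diff_left)
  qed
  finally show ?thesis .
qed

end

section \<open>Conjugate-linear extension\<close>

interpretation pmc: complex_space "\<lambda>c. pm_scale (cnj c)"
  by unfold_locales (auto intro!: poly_mapping_eqI simp: lookup_add algebra_simps)

text \<open>Conjugate-linear extension is ordinary linear extension into the space with conjugated
  scalar action, so the results on \<open>lin\<close> apply to it.\<close>

lemma conj_extend_eq_lin:
  "conj_extend h a = lin (\<lambda>c. pm_scale (cnj c)) (\<lambda>w. Poly_Mapping.single (h w) 1) a"
  by (simp add: conj_extend_def lin_def)

lemma conj_extend_simps [simp]:
  "conj_extend h (a + b) = conj_extend h a + conj_extend h b"
  "conj_extend h (a - b) = conj_extend h a - conj_extend h b"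
  "conj_extend h (pm_scale c a) = pm_scale (cnj c) (conj_extend h a)"
  "conj_extend h (Poly_Mapping.single w c) = Poly_Mapping.single (h w) (cnj c)"
  "conj_extend h 0 = 0"
  by (simp_all add: conj_extend_eq_lin pmc.lin_add pmc.lin_diff pmc.lin_scale)

lemma conj_extend_involution:
  assumes "\<And>w. h (h w) = w"
  shows "conj_extend h (conj_extend h a) = a"
  by (induction a rule: pm_induct) (simp_all add: assms)

lemma conj_extend_mult:
  assumes "\<And>v w. h (v + w) = h v + h w"
  shows "conj_extend h (a * b) = conj_extend h a * conj_extend h b"
proof -
  have "conj_extend h (a * Poly_Mapping.single w c) = conj_extend h a * conj_extend h (Poly_Mapping.single w c)"
    for a w c
    by (induction a rule: pm_induct) (simp_all add: algebra_simps mult_single assms)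
  then show ?thesis
    by (induction b rule: pm_induct) (simp_all add: algebra_simps)
qed

lemma conj_extend_antimult:
  assumes "\<And>v w. h (v + w) = h w + h v"
  shows "conj_extend h (a * b) = conj_extend h b * conj_extend h a"
proof -
  have "conj_extend h (a * Poly_Mapping.single w c) = conj_extend h (Poly_Mapping.single w c) * conj_extend h a"
    for a w c
    by (induction a rule: pm_induct) (simp_all add: algebra_simps mult_single assms)
  then show ?thesis
    by (induction b rule: pm_induct) (simp_all add: algebra_simps)
qed

lemma conj_extend_closed:
  assumes "\<And>w. set (letters w) \<subseteq> L \<Longrightarrow> set (letters (h w)) \<subseteq> L" "a \<in> carrier (free_algebra L)"
  shows "conj_extend h a \<in> carrier (free_algebra L)"
  unfolding conj_extend_def using assms
  by (intro sum_in_free_algebra single_in_free_algebra) (auto simp: carrier_free_algebra)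

context presentation
begin

text \<open>Conjugation on S(p) is multiplicative, the star of U(g) anti-multiplicative. In the
  second case left and right multiples change places, which a two-sided ideal allows.\<close>

lemma conj_extend_J:
  assumes mult: "(\<forall>v w. h (v + w) = h v + h w) \<or> (\<forall>v w. h (v + w) = h w + h v)"
    and closed: "\<And>w. set (letters w) \<subseteq> carrier V \<Longrightarrow> set (letters (h w)) \<subseteq> carrier V"
    and relations: "conj_extend h ` linear_relations V \<subseteq> J" "conj_extend h ` R \<subseteq> J"
    and a: "a \<in> J"
  shows "conj_extend h a \<in> J"
proof -
  have "J \<subseteq> {a \<in> carrier F. conj_extend h a \<in> J}"
  proof (rule J_minimal)
    show "pm.subspace {a \<in> carrier F. conj_extend h a \<in> J}"
      unfolding pm.subspace_def
      using pm.subspace_0[OF subspace_J] pm.subspace_add[OF subspace_J] pm.subspace_scale[OF subspace_J]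
      by auto
    show "linear_relations V \<subseteq> {a \<in> carrier F. conj_extend h a \<in> J}"
      "R \<subseteq> {a \<in> carrier F. conj_extend h a \<in> J}"
      using relations relations_subset by auto
    fix a x assume a: "a \<in> {a \<in> carrier F. conj_extend h a \<in> J}" and x: "x \<in> carrier F"
    have hx: "conj_extend h x \<in> carrier F" by (rule conj_extend_closed[OF closed x])
    show "x * a \<in> {a \<in> carrier F. conj_extend h a \<in> J}"
      using mult
    proof
      assume "\<forall>v w. h (v + w) = h v + h w"
      then show ?thesis using a x J_mult(1)[OF _ hx] by (simp add: conj_extend_mult)
    next
      assume "\<forall>v w. h (v + w) = h w + h v"
      then show ?thesis using a x J_mult(2)[OF _ hx] by (simp add: conj_extend_antimult)
    qed
    show "a * x \<in> {a \<in> carrier F. conj_extend h a \<in> J}"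
      using mult
    proof
      assume "\<forall>v w. h (v + w) = h v + h w"
      then show ?thesis using a x J_mult(2)[OF _ hx] by (simp add: conj_extend_mult)
    next
      assume "\<forall>v w. h (v + w) = h w + h v"
      then show ?thesis using a x J_mult(1)[OF _ hx] by (simp add: conj_extend_antimult)
    qed
  qed auto
  then show ?thesis using a by auto
qed

text \<open>\<open>sym_conj\<close> and \<open>env_star\<close> are images of cosets. The involution
  property shows that such an image is a whole coset and not merely contained in one.\<close>

lemma conj_extend_image_cl:
  assumes mult: "(\<forall>v w. h (v + w) = h v + h w) \<or> (\<forall>v w. h (v + w) = h w + h v)"
    and closed: "\<And>w. set (letters w) \<subseteq> carrier V \<Longrightarrow> set (letters (h w)) \<subseteq> carrier V"
    and relations: "conj_extend h ` linear_relations V \<subseteq> J" "conj_extend h ` R \<subseteq> J"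
    and involution: "\<And>w. h (h w) = w"
  shows "conj_extend h ` cl a = cl (conj_extend h a)"
proof (rule subset_antisym; rule subsetI)
  fix x assume "x \<in> conj_extend h ` cl a"
  then obtain b where b: "x = conj_extend h b" "b - a \<in> J" by (auto simp: mem_cl)
  then show "x \<in> cl (conj_extend h a)"
    using conj_extend_J[OF mult closed relations b(2)] by (simp add: mem_cl)
next
  fix x assume "x \<in> cl (conj_extend h a)"
  then have "conj_extend h (x - conj_extend h a) \<in> J"
    by (intro conj_extend_J[OF mult closed relations]) (auto simp: mem_cl)
  then have "conj_extend h x \<in> cl a"
    by (simp add: mem_cl conj_extend_involution involution)
  moreover have "x = conj_extend h (conj_extend h x)"
    by (simp add: conj_extend_involution involution)
  ultimately show "x \<in> conj_extend h ` cl a" by blast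
qed

end

section \<open>Tensor products\<close>

lemma submodule_free_vspace_iff:
  "submodule N complex_field (free_vspace S) \<longleftrightarrow> pm.subspace N \<and> N \<subseteq> carrier (free_vspace S)"
proof
  assume "submodule N complex_field (free_vspace S)"
  then interpret N: submodule N complex_field "free_vspace S" .
  show "pm.subspace N \<and> N \<subseteq> carrier (free_vspace S)"
    using N.subset N.m_closed N.one_closed N.smult_closed
    by (auto simp: pm.subspace_def free_vspace_def complex_field_def)
next
  assume N: "pm.subspace N \<and> N \<subseteq> carrier (free_vspace S)"
  have keys: "Poly_Mapping.keys (a + b) \<subseteq> S"
    if "Poly_Mapping.keys a \<subseteq> S" "Poly_Mapping.keys b \<subseteq> S" for a b :: "'a \<Rightarrow>\<^sub>0 complex"
    using keys_add[of a b] that by blast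
  have grp: "group (add_monoid (free_vspace S))"
    by (rule groupI)
       (auto simp: free_vspace_def keys add_ac intro!: exI[of _ "- x" for x])
  show "submodule N complex_field (free_vspace S)"
  proof (intro submodule.intro submodule_axioms.intro group.subgroupI[OF grp])
    fix a assume a: "a \<in> N"
    have "inv\<^bsub>add_monoid (free_vspace S)\<^esub> a = - a"
      by (rule group.inv_equality[OF grp]) (use a N in \<open>auto simp: free_vspace_def\<close>)
    then show "inv\<^bsub>add_monoid (free_vspace S)\<^esub> a \<in> N"
      using N pm.subspace_neg[of N a] a by simp
  qed (use N pm.subspace_0[of N] in \<open>auto simp: free_vspace_def pm.subspace_def\<close>)
qed

definition bilinear_action ::
  "(complex, 'u, 'x) module_scheme \<Rightarrow> (complex, 'a, 'y) module_scheme \<Rightarrow> ('u \<Rightarrow> 'a \<Rightarrow> 'a) \<Rightarrow> bool" where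
  "bilinear_action U V f \<longleftrightarrow>
     (\<forall>u\<in>carrier U. \<forall>a\<in>carrier V. f u a \<in> carrier V \<and>
        (\<forall>u'\<in>carrier U. f (u \<oplus>\<^bsub>U\<^esub> u') a = f u a \<oplus>\<^bsub>V\<^esub> f u' a) \<and>
        (\<forall>a'\<in>carrier V. f u (a \<oplus>\<^bsub>V\<^esub> a') = f u a \<oplus>\<^bsub>V\<^esub> f u a') \<and>
        (\<forall>c. f (c \<odot>\<^bsub>U\<^esub> u) a = c \<odot>\<^bsub>V\<^esub> f u a \<and> f u (c \<odot>\<^bsub>V\<^esub> a) = c \<odot>\<^bsub>V\<^esub> f u a))"

definition sesquilinear_on :: "(complex, 'a, 'y) module_scheme \<Rightarrow> ('a \<Rightarrow> 'a \<Rightarrow> complex) \<Rightarrow> bool" where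
  "sesquilinear_on V h \<longleftrightarrow>
     (\<forall>a\<in>carrier V. \<forall>b\<in>carrier V.
        (\<forall>a'\<in>carrier V. h (a \<oplus>\<^bsub>V\<^esub> a') b = h a b + h a' b) \<and>
        (\<forall>b'\<in>carrier V. h a (b \<oplus>\<^bsub>V\<^esub> b') = h a b + h a b') \<and>
        (\<forall>c. h (c \<odot>\<^bsub>V\<^esub> a) b = cnj c * h a b \<and> h a (c \<odot>\<^bsub>V\<^esub> b) = c * h a b))"

locale tensor_product =
  fixes V :: "(complex, 'a) Module.module" and W :: "(complex, 'b) Module.module"
  assumes closed_V: "a \<in> carrier V \<Longrightarrow> a' \<in> carrier V \<Longrightarrow> a \<oplus>\<^bsub>V\<^esub> a' \<in> carrier V"
      "a \<in> carrier V \<Longrightarrow> c \<odot>\<^bsub>V\<^esub> a \<in> carrier V"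
    and closed_W: "b \<in> carrier W \<Longrightarrow> b' \<in> carrier W \<Longrightarrow> b \<oplus>\<^bsub>W\<^esub> b' \<in> carrier W"
      "b \<in> carrier W \<Longrightarrow> c \<odot>\<^bsub>W\<^esub> b \<in> carrier W"
begin

abbreviation "F \<equiv> free_vspace (carrier V \<times> carrier W)"
abbreviation "N \<equiv> tensor_null V W"

lemma carrier_F: "x \<in> carrier F \<longleftrightarrow> Poly_Mapping.keys x \<subseteq> carrier V \<times> carrier W"
  by (simp add: free_vspace_def)

lemma subspace_F: "pm.subspace (carrier F)"
  unfolding pm.subspace_def
proof (intro conjI ballI allI)
  show "a + b \<in> carrier F" if "a \<in> carrier F" "b \<in> carrier F" for a b
    using that keys_add[of a b] unfolding carrier_F by blast
  show "pm_scale c a \<in> carrier F" if "a \<in> carrier F" for c a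
    using that keys_pm_scale[of c a] unfolding carrier_F by blast
qed (simp add: carrier_F)

lemma single_F: "a \<in> carrier V \<Longrightarrow> b \<in> carrier W \<Longrightarrow> Poly_Mapping.single (a, b) c \<in> carrier F"
  by (simp add: carrier_F)

lemma relations_F: "tensor_relations V W \<subseteq> carrier F"
  unfolding tensor_relations_def
  by (auto intro!: pm.subspace_diff[OF subspace_F] single_F closed_V closed_W)

lemma null_eq: "N = \<Inter>{T. pm.subspace T \<and> T \<subseteq> carrier F \<and> tensor_relations V W \<subseteq> T}"
  by (auto simp: tensor_null_def hull_def submodule_free_vspace_iff)

lemma relations_null: "tensor_relations V W \<subseteq> N"
  by (auto simp: null_eq)

sublocale quotient_space F pm_scale N
proof
  show "pm.subspace N" by (auto simp: null_eq pm.subspace_def)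
  show "N \<subseteq> carrier F" using relations_F subspace_F by (auto simp: null_eq)
qed (use subspace_F in \<open>simp_all add: free_vspace_def\<close>)

lemma tensor_eq: "tensor V W = Q"
  by (simp add: tensor_def)

lemma tensor_class_eq: "tensor_class V W t = cl t"
  by (simp add: tensor_class_def)

lemma simple_tensor_eq: "simple_tensor V W a b = cl (Poly_Mapping.single (a, b) 1)"
  by (simp add: simple_tensor_def tensor_class_def)

text \<open>The universal property of the tensor product, in a form where bilinearity of
  \<open>k\<close> holds only modulo \<open>N0\<close>; this covers maps with values in another
  tensor product before its quotient is taken.\<close>

lemma lin_null:
  assumes s: "complex_space s" and N0: "module.subspace s N0"
    and k: "\<And>a a' b. a \<in> carrier V \<Longrightarrow> a' \<in> carrier V \<Longrightarrow> b \<in> carrier W \<Longrightarrow>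
        k (a \<oplus>\<^bsub>V\<^esub> a', b) - k (a, b) - k (a', b) \<in> N0"
      "\<And>a b b'. a \<in> carrier V \<Longrightarrow> b \<in> carrier W \<Longrightarrow> b' \<in> carrier W \<Longrightarrow>
        k (a, b \<oplus>\<^bsub>W\<^esub> b') - k (a, b) - k (a, b') \<in> N0"
      "\<And>c a b. a \<in> carrier V \<Longrightarrow> b \<in> carrier W \<Longrightarrow> k (c \<odot>\<^bsub>V\<^esub> a, b) - s c (k (a, b)) \<in> N0"
      "\<And>c a b. a \<in> carrier V \<Longrightarrow> b \<in> carrier W \<Longrightarrow> k (a, c \<odot>\<^bsub>W\<^esub> b) - s c (k (a, b)) \<in> N0"
    and n: "n \<in> N"
  shows "lin s k n \<in> N0"
proof -
  interpret s: complex_space s by fact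
  have "N \<subseteq> {n \<in> carrier F. lin s k n \<in> N0}"
    unfolding null_eq
  proof (rule Inter_lower, rule CollectI, intro conjI)
    show "pm.subspace {n \<in> carrier F. lin s k n \<in> N0}"
      using subspace_F s.subspace_0[OF N0] s.subspace_add[OF N0] s.subspace_scale[OF N0]
      by (auto simp: pm.subspace_def s.lin_add s.lin_scale)
    have "lin s k n \<in> N0" if "n \<in> tensor_relations V W" for n
      using that unfolding tensor_relations_def by (auto simp: s.lin_diff intro: k)
    then show "tensor_relations V W \<subseteq> {n \<in> carrier F. lin s k n \<in> N0}"
      using relations_F by blast
  qed auto
  then show ?thesis using n by auto
qed

lemma relation_in_null:
  "a \<in> carrier V \<Longrightarrow> a' \<in> carrier V \<Longrightarrow> b \<in> carrier W \<Longrightarrow>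
    Poly_Mapping.single (a \<oplus>\<^bsub>V\<^esub> a', b) 1 - Poly_Mapping.single (a, b) 1 - Poly_Mapping.single (a', b) 1 \<in> N"
  "a \<in> carrier V \<Longrightarrow> b \<in> carrier W \<Longrightarrow> b' \<in> carrier W \<Longrightarrow>
    Poly_Mapping.single (a, b \<oplus>\<^bsub>W\<^esub> b') 1 - Poly_Mapping.single (a, b) 1 - Poly_Mapping.single (a, b') 1 \<in> N"
  "a \<in> carrier V \<Longrightarrow> b \<in> carrier W \<Longrightarrow>
    Poly_Mapping.single (c \<odot>\<^bsub>V\<^esub> a, b) 1 - pm_scale c (Poly_Mapping.single (a, b) 1) \<in> N"
  "a \<in> carrier V \<Longrightarrow> b \<in> carrier W \<Longrightarrow>
    Poly_Mapping.single (a, c \<odot>\<^bsub>W\<^esub> b) 1 - pm_scale c (Poly_Mapping.single (a, b) 1) \<in> N"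
  by (rule subsetD[OF relations_null], force simp: tensor_relations_def)+

text \<open>Independence of both chosen representatives: the expression is bilinear in
  \<open>t\<close> and \<open>x\<close> and lands in the null space as soon as one argument is null
  and the other lies in the carrier.\<close>

lemma tensor_action_cl:
  fixes U :: "(complex, 'u) Module.module" and X :: "(complex, 'w) Module.module"
  assumes U: "tensor_product U X"
    and actU: "bilinear_action U V actU" and actW: "bilinear_action X W actW"
    and t: "t \<in> carrier (free_vspace (carrier U \<times> carrier X))" and x: "x \<in> carrier F"
  shows "tensor_action V W actU actW (tensor_class U X t) (tensor_class V W x) =
    tensor_class V W (lin pm_scale (\<lambda>(u, w). lin pm_scale (\<lambda>(a, b).
      Poly_Mapping.single (actU u a, actW w b) 1) x) t)"
proof -
  interpret T: tensor_product U X by fact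
  define \<Phi> where "\<Phi> t x = lin pm_scale (\<lambda>uw. lin pm_scale (\<lambda>ab.
      Poly_Mapping.single (actU (fst uw) (fst ab), actW (snd uw) (snd ab)) 1) x) t" for t x
  note bil = actU[unfolded bilinear_action_def, rule_format] actW[unfolded bilinear_action_def, rule_format]
  have eq: "(\<Sum>(u, w)\<in>Poly_Mapping.keys t. \<Sum>(a, b)\<in>Poly_Mapping.keys x.
           Poly_Mapping.single (actU u a, actW w b)
             (Poly_Mapping.lookup t (u, w) * Poly_Mapping.lookup x (a, b))) = \<Phi> t x" for t x
    by (simp add: \<Phi>_def lin_def pm.scale_sum_right split_beta)
  have left: "\<Phi> n x \<in> N" if n: "n \<in> T.N" and x: "x \<in> carrier F" for n x
    unfolding \<Phi>_def
    by (rule T.lin_null[OF pm.complex_space_axioms subspace_I _ _ _ _ n];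
        simp only: pm.lin_fun_diff[symmetric] pm.lin_fun_scale[symmetric];
        rule pm.lin_mem[OF subspace_I])
       (use x[unfolded carrier_F, THEN subsetD] in
          \<open>auto simp: bil intro!: relation_in_null simp del: pm_scale_single\<close>)
  have right: "\<Phi> t n \<in> N" if n: "n \<in> N" and t: "t \<in> carrier T.F" for n t
    unfolding \<Phi>_def
    \<comment> \<open>The null element sits in the inner extension here; exchanging the two
      extensions reduces to the pattern of \<open>left\<close>.\<close>
    by (subst lin_swap[OF pm.complex_space_axioms],
        rule lin_null[OF pm.complex_space_axioms subspace_I _ _ _ _ n];
        simp only: pm.lin_fun_diff[symmetric] pm.lin_fun_scale[symmetric];
        rule pm.lin_mem[OF subspace_I])
       (use t[unfolded T.carrier_F, THEN subsetD] in
          \<open>auto simp: bil intro!: relation_in_null simp del: pm_scale_single\<close>)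
  define t' where "t' = (SOME t'. t' \<in> T.cl t)"
  define x' where "x' = (SOME x'. x' \<in> cl x)"
  have t': "t' - t \<in> T.N" unfolding t'_def by (rule T.representative_cl)
  have x': "x' - x \<in> N" unfolding x'_def by (rule representative_cl)
  have x'F: "x' \<in> carrier F"
    using pm.subspace_add[OF subspace_F subsetD[OF I_subset x'] x] by simp
  \<comment> \<open>Telescoping changes one argument at a time, so each error term has exactly one
    null argument.\<close>
  have "\<Phi> t' x' = \<Phi> (t' - t) x' + \<Phi> t (x' - x) + \<Phi> t x"
    by (simp add: \<Phi>_def pm.lin_diff pm.lin_fun_diff)
  then have "\<Phi> t' x' - \<Phi> t x \<in> N"
    using pm.subspace_add[OF subspace_I left[OF t' x'F] right[OF x' t]] by simp
  then show ?thesis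
    unfolding tensor_action_def Let_def T.tensor_class_eq tensor_class_eq
    by (simp add: t'_def[symmetric] x'_def[symmetric] eq cl_eq_iff)
       (simp add: \<Phi>_def case_prod_unfold)
qed

lemma tensor_form_cl:
  assumes h: "sesquilinear_on V h" and h': "sesquilinear_on W h'"
    and x: "x \<in> carrier F" and y: "y \<in> carrier F"
  shows "tensor_form h h' (tensor_class V W x) (tensor_class V W y) =
    lin (*) (\<lambda>(a', b'). lin (\<lambda>c. (*) (cnj c)) (\<lambda>(a, b). h a a' * h' b b') x) y"
proof -
  interpret c: complex_space "(*) :: complex \<Rightarrow> _"
    by unfold_locales (auto simp: algebra_simps)
  interpret cc: complex_space "\<lambda>c. (*) (cnj c) :: complex \<Rightarrow> _"
    by unfold_locales (auto simp: algebra_simps)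
  define \<Phi> where "\<Phi> x y = lin (*) (\<lambda>v. lin (\<lambda>c. (*) (cnj c)) (\<lambda>u. h (fst u) (fst v) * h' (snd u) (snd v)) x) y"
    for x y
  note ses = h[unfolded sesquilinear_on_def, rule_format] h'[unfolded sesquilinear_on_def, rule_format]
  have eq: "(\<Sum>(a, b)\<in>Poly_Mapping.keys x. \<Sum>(a', b')\<in>Poly_Mapping.keys y.
        cnj (Poly_Mapping.lookup x (a, b)) * Poly_Mapping.lookup y (a', b') * (h a a' * h' b b')) = \<Phi> x y" for x y
    unfolding \<Phi>_def lin_def split_beta sum_distrib_left by (subst sum.swap) (simp add: mult_ac)
  have c0: "vector_space_over_itself.subspace {0 :: complex}" "cc.subspace {0}"
    by (simp_all add: vector_space_over_itself.subspace_def cc.subspace_def)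
  have left: "\<Phi> n y = 0" if n: "n \<in> N" and y: "y \<in> carrier F" for n y
  proof -
    have "lin (\<lambda>c. (*) (cnj c)) (\<lambda>u. h (fst u) (fst v) * h' (snd u) (snd v)) n \<in> {0}"
      if "v \<in> Poly_Mapping.keys y" for v
      using that y[unfolded carrier_F, THEN subsetD]
      by (cases v, intro lin_null[OF cc.complex_space_axioms c0(2) _ _ _ _ n])
         (auto simp: ses algebra_simps)
    then show ?thesis unfolding \<Phi>_def by (subst c.lin_cong[where g = "\<lambda>_. 0"]) auto
  qed
  have right: "\<Phi> x n = 0" if n: "n \<in> N" and x: "x \<in> carrier F" for n x
  proof -
    have "\<Phi> x n \<in> {0}"
      unfolding \<Phi>_def
      by (rule lin_null[OF c.complex_space_axioms c0(1) _ _ _ _ n];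
          use x[unfolded carrier_F, THEN subsetD] in
            \<open>auto simp: lin_def sum_distrib_left sum_subtractf[symmetric] ses algebra_simps
              intro!: sum.neutral\<close>)
    then show ?thesis by simp
  qed
  define x' where "x' = (SOME x'. x' \<in> cl x)"
  define y' where "y' = (SOME y'. y' \<in> cl y)"
  have x': "x' - x \<in> N" unfolding x'_def by (rule representative_cl)
  have y': "y' - y \<in> N" unfolding y'_def by (rule representative_cl)
  have y'F: "y' \<in> carrier F"
    using pm.subspace_add[OF subspace_F subsetD[OF I_subset y'] y] by simp
  have "\<Phi> x' y' = \<Phi> (x' - x) y' + \<Phi> x (y' - y) + \<Phi> x y"
    by (simp add: \<Phi>_def c.lin_diff cc.lin_diff c.lin_fun_diff)
  then have "\<Phi> x' y' = \<Phi> x y"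
    using left[OF x' y'F] right[OF y' x] by simp
  then show ?thesis
    unfolding tensor_form_def Let_def tensor_class_eq
    by (simp add: x'_def[symmetric] y'_def[symmetric] eq) (simp add: \<Phi>_def case_prod_unfold)
qed

end

section \<open>Derivations of the free algebra\<close>

lemma free_algebra_induct [consumes 1, case_names zero add]:
  assumes "a \<in> carrier (free_algebra L)" "P 0"
    and "\<And>a w c. a \<in> carrier (free_algebra L) \<Longrightarrow> set (letters w) \<subseteq> L \<Longrightarrow> P a \<Longrightarrow>
      P (a + Poly_Mapping.single w c)"
  shows "P a"
  using assms(1)
proof (induction a rule: pm_induct)
  case zero
  then show ?case by (simp add: assms)
next
  case (add a w c)
  have "Poly_Mapping.keys (a + Poly_Mapping.single w c) = insert w (Poly_Mapping.keys a)"
    using add.hyps by (auto simp: in_keys_iff lookup_add lookup_single when_def split: if_splits)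
  then show ?case using add by (auto intro!: assms(3) simp: carrier_free_algebra)
qed

lemma single_Cons: "Poly_Mapping.single (Mon (v # vs)) c = generator v * Poly_Mapping.single (Mon vs) c"
  by (simp add: generator_def mult_single plus_free_monoid_def)

lemma single_Nil: "Poly_Mapping.single (Mon []) (c :: complex) = pm_scale c 1"
  using single_one[where 'a = "'a free_monoid" and 'b = complex]
  by (metis zero_free_monoid_def pm_scale_single mult.right_neutral)

text \<open>The Leibniz rule on noncommutative words: a sum over positions, the letter there being
  deleted and replaced by its value under \<open>\<alpha>\<close>.\<close>

primrec word_deriv :: "('v \<Rightarrow> complex) \<Rightarrow> 'v list \<Rightarrow> 'v free_alg" where
  "word_deriv \<alpha> [] = 0"
| "word_deriv \<alpha> (v # vs) = Poly_Mapping.single (Mon vs) (\<alpha> v) + generator v * word_deriv \<alpha> vs"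

definition der :: "('v \<Rightarrow> complex) \<Rightarrow> 'v free_alg \<Rightarrow> 'v free_alg" where
  "der \<alpha> a = lin pm_scale (\<lambda>w. word_deriv \<alpha> (letters w)) a"

lemma der_simps [simp]:
  "der \<alpha> (a + b) = der \<alpha> a + der \<alpha> b" "der \<alpha> (a - b) = der \<alpha> a - der \<alpha> b"
  "der \<alpha> (pm_scale c a) = pm_scale c (der \<alpha> a)" "der \<alpha> 0 = 0"
  by (simp_all add: der_def pm.lin_add pm.lin_diff pm.lin_scale)

lemma linear_der: "Vector_Spaces.linear pm_scale pm_scale (der \<alpha>)"
  by (simp add: Vector_Spaces.linear_iff vector_space_pm_scale)

lemma der_single: "der \<alpha> (Poly_Mapping.single w c) = pm_scale c (word_deriv \<alpha> (letters w))"
  by (simp add: der_def)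

lemma word_deriv_append:
  "word_deriv \<alpha> (us @ vs) =
    word_deriv \<alpha> us * Poly_Mapping.single (Mon vs) 1 + Poly_Mapping.single (Mon us) 1 * word_deriv \<alpha> vs"
proof (induction us)
  case Nil
  then show ?case by (simp add: zero_free_monoid_def[symmetric])
next
  case (Cons u us)
  then show ?case
    by (simp add: algebra_simps mult_single plus_free_monoid_def single_Cons)
qed

lemma der_mult: "der \<alpha> (a * b) = der \<alpha> a * b + a * der \<alpha> b"
proof -
  have "der \<alpha> (Poly_Mapping.single w c * Poly_Mapping.single v d) =
      der \<alpha> (Poly_Mapping.single w c) * Poly_Mapping.single v d +
      Poly_Mapping.single w c * der \<alpha> (Poly_Mapping.single v d)" for w v c d
  proof -
    have single: "Poly_Mapping.single u e = pm_scale e (Poly_Mapping.single u 1)"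
      for u :: "'a free_monoid" and e :: complex
      by simp
    have "der \<alpha> (Poly_Mapping.single w 1 * Poly_Mapping.single v 1) =
        der \<alpha> (Poly_Mapping.single w 1) * Poly_Mapping.single v 1 +
        Poly_Mapping.single w 1 * der \<alpha> (Poly_Mapping.single v 1)"
      by (simp add: mult_single der_single word_deriv_append)
    then show ?thesis
      unfolding single[of w c] single[of v d]
      by (simp only: der_simps pm_scale_mult_left pm_scale_mult_right pm.scale_right_distrib)
    qed
  then have "der \<alpha> (a * Poly_Mapping.single v d) =
      der \<alpha> a * Poly_Mapping.single v d + a * der \<alpha> (Poly_Mapping.single v d)" for a v d
    by (induction a rule: pm_induct) (simp_all add: algebra_simps)
  then show ?thesis
    by (induction b rule: pm_induct) (simp_all add: algebra_simps)
qed

lemma der_one [simp]: "der \<alpha> 1 = 0"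
  using der_single[of \<alpha> 0 1] by simp

lemma der_generator [simp]: "der \<alpha> (generator v) = pm_scale (\<alpha> v) 1"
  by (simp add: generator_def der_single single_Nil)

lemma der_fun_add: "der (\<lambda>v. \<alpha> v + \<beta> v) a = der \<alpha> a + der \<beta> a"
proof -
  have "word_deriv (\<lambda>v. \<alpha> v + \<beta> v) vs = word_deriv \<alpha> vs + word_deriv \<beta> vs" for vs
    by (induction vs) (simp_all add: single_add algebra_simps)
  then show ?thesis by (simp add: der_def pm.lin_fun_add)
qed

lemma der_fun_scale: "der (\<lambda>v. c * \<alpha> v) a = pm_scale c (der \<alpha> a)"
proof -
  have "word_deriv (\<lambda>v. c * \<alpha> v) vs = pm_scale c (word_deriv \<alpha> vs)" for vs
    by (induction vs) (simp_all add: pm.scale_right_distrib pm_scale_mult_right)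
  then show ?thesis by (simp add: der_def pm.lin_fun_scale)
qed

text \<open>Either composite deletes two letters of a word and keeps the order of the others, so no
  commutators of letters arise. In the induction the terms from the first letter are \<alpha>(v)
  times the \<beta>-derivative plus \<beta>(v) times the \<alpha>-derivative, symmetric in the
  two.\<close>

lemma der_commute: "der \<alpha> (der \<beta> a) = der \<beta> (der \<alpha> a)"
proof -
  have "der \<alpha> (der \<beta> (Poly_Mapping.single (Mon vs) 1)) = der \<beta> (der \<alpha> (Poly_Mapping.single (Mon vs) 1))" for vs
  proof (induction vs)
    case Nil
    then show ?case by (simp add: single_Nil)
  next
    case (Cons v vs)
    have scale: "der \<gamma> (Poly_Mapping.single (Mon vs) c) = pm_scale c (der \<gamma> (Poly_Mapping.single (Mon vs) 1))"
      for \<gamma> and c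
      by (simp add: der_single)
    show ?case
      using Cons
      by (simp add: single_Cons der_mult pm_scale_mult_left scale[of _ "\<alpha> v"] scale[of _ "\<beta> v"])
  qed
  then have "der \<alpha> (der \<beta> (pm_scale c (Poly_Mapping.single (Mon vs) 1))) =
      der \<beta> (der \<alpha> (pm_scale c (Poly_Mapping.single (Mon vs) 1)))" for c vs
    by (simp del: pm_scale_single)
  then have "der \<alpha> (der \<beta> (Poly_Mapping.single w c)) = der \<beta> (der \<alpha> (Poly_Mapping.single w c))" for w c
    by (cases w) simp
  then show ?thesis by (induction a rule: pm_induct) simp_all
qed

lemma der_closed [simp]:
  assumes "a \<in> carrier (free_algebra L)"
  shows "der \<alpha> a \<in> carrier (free_algebra L)"
proof -
  have "set vs \<subseteq> L \<Longrightarrow> word_deriv \<alpha> vs \<in> carrier (free_algebra L)" for vs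
    by (induction vs) (auto intro!: free_algebra_closed(1) mult_in_free_algebra single_in_free_algebra)
  then show ?thesis
    using assms unfolding der_def
    by (intro pm.lin_mem[OF subspace_free_algebra]) (auto simp: carrier_free_algebra[of _ L])
qed

text \<open>The constant term is the augmentation homomorphism: the empty word factors only into two
  empty words.\<close>

lemma lookup_mult_zero:
  "Poly_Mapping.lookup (a * b) (0 :: 'v free_monoid) = Poly_Mapping.lookup a 0 * (Poly_Mapping.lookup b 0 :: complex)"
proof -
  have eq: "v + w = 0 \<longleftrightarrow> v = 0 \<and> w = 0" for v w :: "'v free_monoid"
    by (cases v; cases w) (auto simp: plus_free_monoid_def zero_free_monoid_def)
  have "Poly_Mapping.lookup (a * Poly_Mapping.single v d) (0 :: 'v free_monoid) =
      Poly_Mapping.lookup a 0 * (Poly_Mapping.lookup (Poly_Mapping.single v d) 0 :: complex)" for a v d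
    by (induction a rule: pm_induct)
       (auto simp: algebra_simps mult_single lookup_add lookup_single when_def eq)
  then show ?thesis
    by (induction b rule: pm_induct) (simp_all add: algebra_simps lookup_add)
qed

lemma lookup_generator_zero [simp]: "Poly_Mapping.lookup (generator v) 0 = 0"
  by (simp add: generator_def lookup_single zero_free_monoid_def)

section \<open>Complexification\<close>

lemma cscale_Pair: "cscale c (x, y) = (Re c *\<^sub>R x - Im c *\<^sub>R y, Re c *\<^sub>R y + Im c *\<^sub>R x)"
  by (simp add: cscale_def)

interpretation cs: complex_space "cscale :: complex \<Rightarrow> 'g::real_vector \<times> 'g \<Rightarrow> _"
  by unfold_locales (auto simp: cscale_Pair algebra_simps)

lemma cconj_simps [simp]:
  "cconj (cconj v) = v" "cconj (v + w) = cconj v + cconj w" "cconj (v - w) = cconj v - cconj w"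
  "cconj (cscale c v) = cscale (cnj c) (cconj v)" "cconj 0 = 0"
  by (auto simp: cconj_def cscale_def zero_prod_def split: prod.splits)

locale real_form =
  fixes B :: "'g::real_vector \<Rightarrow> 'g \<Rightarrow> real"
  assumes B_bilinear: "bilinear B" and B_symmetric: "B x y = B y x"
begin

lemma cform_simps:
  "cform B (v + v') w = cform B v w + cform B v' w" "cform B v (w + w') = cform B v w + cform B v w'"
  "cform B (v - v') w = cform B v w - cform B v' w" "cform B v (w - w') = cform B v w - cform B v w'"
  "cform B (cscale c v) w = c * cform B v w" "cform B v (cscale c w) = c * cform B v w"
  "cform B 0 w = 0" "cform B v 0 = 0"
  by (cases v; cases v'; cases w; cases w';
      simp add: cform_def cscale_def zero_prod_def complex_eq_iff bilinear_ladd[OF B_bilinear]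
        bilinear_radd[OF B_bilinear] bilinear_lsub[OF B_bilinear] bilinear_rsub[OF B_bilinear]
        bilinear_lmul[OF B_bilinear] bilinear_rmul[OF B_bilinear]
        bilinear_lzero[OF B_bilinear] bilinear_rzero[OF B_bilinear] algebra_simps)+

lemma cform_symmetric: "cform B v w = cform B w v"
  by (cases v; cases w)
     (simp add: cform_def B_symmetric add.commute)

lemma cform_cconj: "cform B (cconj v) (cconj w) = cnj (cform B v w)"
  by (auto simp: cform_def cconj_def complex_eq_iff bilinear_lneg[OF B_bilinear]
      bilinear_rneg[OF B_bilinear] split: prod.splits)

end

section \<open>The symmetric algebra\<close>

locale symmetric_algebra = real_form B
  for B :: "'g::real_vector \<Rightarrow> 'g \<Rightarrow> real" +
  fixes p :: "('g \<times> 'g) set"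
  assumes subspace_p: "cs.subspace p" and cconj_p: "v \<in> p \<Longrightarrow> cconj v \<in> p"
begin

lemmas p_add = cs.subspace_add[OF subspace_p] and p_scale = cs.subspace_scale[OF subspace_p]
  and p_0 = cs.subspace_0[OF subspace_p]

sublocale S: presentation "vspace p cscale" "sym_relations p"
  rewrites "carrier (vspace p cscale) = p" and "add (vspace p cscale) = (+)"
    and "smult (vspace p cscale) = cscale"
  by unfold_locales (auto simp: p_add p_scale sym_relations_def)

abbreviation "F \<equiv> free_algebra p"
abbreviation "Sym \<equiv> quotient_record F S.J"
abbreviation cl :: "('g \<times> 'g) free_alg \<Rightarrow> ('g \<times> 'g) free_alg set" where "cl a \<equiv> S.J +>\<^bsub>F\<^esub> a"

lemma sym_alg_eq: "sym_alg p = Sym"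
  by (simp add: sym_alg_def S.presented_algebra_eq)

lemma sym_gen_eq: "sym_gen p v = cl (generator v)"
  by (simp add: sym_gen_def S.presented_gen_eq)

lemma dual_spaceD:
  assumes "\<alpha> \<in> dual_space p"
  shows "v \<in> p \<Longrightarrow> w \<in> p \<Longrightarrow> \<alpha> (v + w) = \<alpha> v + \<alpha> w" "v \<in> p \<Longrightarrow> \<alpha> (cscale c v) = c * \<alpha> v"
  using assms by (auto simp: dual_space_def)

lemma generator_commutator_in_J:
  "v \<in> p \<Longrightarrow> w \<in> p \<Longrightarrow> generator v * generator w - generator w * generator v \<in> S.J"
  by (rule subsetD[OF S.relations_in_J], rule UnI2, unfold sym_relations_def) blast

text \<open>Each defining relation is annihilated exactly: the linear ones because
  \<open>\<alpha>\<close> is linear on \<open>p\<close>, the commutators because the scalars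
  produced by the Leibniz rule are central.\<close>

lemma der_J:
  assumes \<alpha>: "\<alpha> \<in> dual_space p" and a: "a \<in> S.J"
  shows "der \<alpha> a \<in> S.J"
proof -
  note J_add = pm.subspace_add[OF S.subspace_J]
  \<comment> \<open>Membership of \<open>a\<close> in the ideal belongs to the invariant because the
    Leibniz rule produces the multiples \<open>der \<alpha> x * a\<close> and
    \<open>a * der \<alpha> x\<close>.\<close>
  have "S.J \<subseteq> {a \<in> S.J. der \<alpha> a \<in> S.J}"
  proof (rule S.J_minimal)
    show "pm.subspace {a \<in> S.J. der \<alpha> a \<in> S.J}"
      using S.subspace_J by (auto simp: pm.subspace_def)
    have "der \<alpha> r = 0" if "r \<in> linear_relations (vspace p cscale) \<union> sym_relations p" for r
      using that unfolding linear_relations_def sym_relations_def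
      by (elim UnE CollectE exE conjE)
         (simp_all add: dual_spaceD[OF \<alpha>] pm.scale_left_distrib der_mult pm_scale_mult_left pm_scale_mult_right)
    then show "linear_relations (vspace p cscale) \<subseteq> {a \<in> S.J. der \<alpha> a \<in> S.J}"
      "sym_relations p \<subseteq> {a \<in> S.J. der \<alpha> a \<in> S.J}"
      using S.relations_in_J pm.subspace_0[OF S.subspace_J] by (simp_all add: subset_iff)
    fix a x assume "a \<in> {a \<in> S.J. der \<alpha> a \<in> S.J}" "x \<in> carrier F"
    then have "x * a \<in> S.J" "a * x \<in> S.J" "der \<alpha> x * a \<in> S.J" "x * der \<alpha> a \<in> S.J"
        "der \<alpha> a * x \<in> S.J" "a * der \<alpha> x \<in> S.J"
      using S.J_mult der_closed by auto
    then show "x * a \<in> {a \<in> S.J. der \<alpha> a \<in> S.J}" "a * x \<in> {a \<in> S.J. der \<alpha> a \<in> S.J}"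
      by (simp_all add: der_mult J_add)
  qed (use S.J_subset in blast)
  then show ?thesis using a by auto
qed

text \<open>\<open>sym_deriv\<close> is chosen among all derivations with the prescribed values on
  generators. \<open>der \<alpha>\<close> provides existence; uniqueness on the carrier follows
  along words from the Leibniz rule.\<close>

lemma sym_deriv_cl:
  assumes \<alpha>: "\<alpha> \<in> dual_space p" and a: "a \<in> carrier F"
  shows "sym_deriv p \<alpha> (cl a) = cl (der \<alpha> a)"
proof -
  define P where "P d \<longleftrightarrow> is_derivation (sym_alg p) d \<and>
      (\<forall>v\<in>p. d (sym_gen p v) = \<alpha> v \<odot>\<^bsub>sym_alg p\<^esub> \<one>\<^bsub>sym_alg p\<^esub>)" for d
  have "\<exists>d. P d"
  proof
    define d where "d X = cl (der \<alpha> (SOME a. a \<in> X))" for X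
    have d: "d (cl a) = cl (der \<alpha> a)" for a
      using der_J[OF \<alpha> S.representative_cl[of a]] by (simp add: d_def S.cl_eq_iff)
    show "P d"
      unfolding P_def is_derivation_def sym_alg_eq sym_gen_eq
      by (auto simp: S.carrier_quotient d S.add_cl S.smult_cl S.mult_cl S.one_quotient der_mult)
  qed
  then have "P (sym_deriv p \<alpha>)"
    unfolding sym_deriv_def P_def by (rule someI_ex)
  define d where "d = sym_deriv p \<alpha>"
  have "is_derivation Sym d" and d_gen: "\<And>v. v \<in> p \<Longrightarrow> d (cl (generator v)) = cl (pm_scale (\<alpha> v) 1)"
    using \<open>P (sym_deriv p \<alpha>)\<close>
    by (simp_all add: P_def d_def sym_alg_eq sym_gen_eq S.one_quotient S.smult_cl)
  then have d_closed: "\<And>a. a \<in> carrier F \<Longrightarrow> d (cl a) \<in> cl ` carrier F"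
    and d_add: "\<And>a b. a \<in> carrier F \<Longrightarrow> b \<in> carrier F \<Longrightarrow>
        d (cl (a + b)) = add Sym (d (cl a)) (d (cl b))"
    and d_scale: "\<And>c a. a \<in> carrier F \<Longrightarrow> d (cl (pm_scale c a)) = smult Sym c (d (cl a))"
    and d_mult: "\<And>a b. a \<in> carrier F \<Longrightarrow> b \<in> carrier F \<Longrightarrow> d (cl (a * b)) =
        add Sym (mult Sym (d (cl a)) (cl b)) (mult Sym (cl a) (d (cl b)))"
    unfolding is_derivation_def S.carrier_quotient
    by (auto simp flip: S.add_cl S.smult_cl S.mult_cl)
  \<comment> \<open>Differentiating 1 = 1 * 1 gives d(1) = d(1) + d(1).\<close>
  have d_one: "d (cl 1) = cl 0"
  proof -
    obtain e where e: "e \<in> carrier F" "d (cl 1) = cl e" using d_closed[of 1] by auto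
    have "cl e = cl (e + e)"
      using d_mult[of 1 1] e by (simp add: S.mult_cl S.add_cl)
    then show ?thesis using pm.subspace_neg[OF S.subspace_J, of "- e"] by (simp add: e(2) S.cl_eq_iff)
  qed
  have d_word: "d (cl (Poly_Mapping.single (Mon vs) 1)) = cl (der \<alpha> (Poly_Mapping.single (Mon vs) 1))"
    if "set vs \<subseteq> p" for vs
    using that
  proof (induction vs)
    case Nil
    then show ?case by (simp add: d_one zero_free_monoid_def[symmetric])
  next
    case (Cons v vs)
    then show ?case
      by (simp add: single_Cons d_mult d_gen der_mult S.mult_cl S.add_cl single_in_free_algebra)
  qed
  have "d (cl a) = cl (der \<alpha> a)"
    using a
  proof (induction a rule: free_algebra_induct)
    case zero
    show ?case using d_scale[of 1 0] d_one by (simp add: S.smult_cl)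
  next
    case (add a w c)
    have "d (cl (pm_scale c (Poly_Mapping.single w 1))) = cl (der \<alpha> (pm_scale c (Poly_Mapping.single w 1)))"
      using d_word[of "letters w"] add.hyps
      by (simp add: d_scale S.smult_cl single_in_free_algebra del: pm_scale_single)
    then show ?case
      using add by (simp add: d_add S.add_cl single_in_free_algebra)
  qed
  then show ?thesis by (simp add: d_def)
qed

text \<open>The isomorphism of p with its dual given by the form. Extension by 0 off
  \<open>p\<close> follows the convention of \<open>dual_space\<close> and makes it literally the
  functional inside \<open>sym_diff_op\<close>.\<close>

definition \<beta> :: "'g \<times> 'g \<Rightarrow> 'g \<times> 'g \<Rightarrow> complex" where
  "\<beta> v = (\<lambda>y. if y \<in> p then cform B v y else 0)"

lemma \<beta>_dual_space: "\<beta> v \<in> dual_space p"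
  by (auto simp: dual_space_def \<beta>_def cform_simps p_add p_scale)

lemma der_\<beta>_simps:
  "der (\<beta> (v + w)) a = der (\<beta> v) a + der (\<beta> w) a" "der (\<beta> (cscale c v)) a = pm_scale c (der (\<beta> v) a)"
  by (simp_all flip: der_fun_add der_fun_scale)
     (rule arg_cong[where f = "\<lambda>\<alpha>. der \<alpha> a"], simp add: fun_eq_iff \<beta>_def cform_simps)+

lemma sym_diff_op_cl:
  assumes "a \<in> carrier F" "y \<in> carrier F"
  shows "sym_diff_op B p (cl a) (cl y) = cl (free_act pm_scale (\<lambda>v. der (\<beta> v)) a y)"
proof -
  have "free_act pm_scale (\<lambda>v. der (\<beta> v)) r y = 0" if "r \<in> sym_relations p" for r y
    using that unfolding sym_relations_def
    by (elim CollectE exE conjE)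
       (simp add: pm.free_act_diff_left pm.free_act_mult[OF linear_der] der_commute[of "\<beta> _" "\<beta> _"])
  then show ?thesis
    unfolding sym_diff_op_def sym_alg_eq \<beta>_def[symmetric]
    by (intro S.presented_action_quotient[OF S.quotient_space_axioms])
       (use assms in \<open>auto simp: sym_deriv_cl \<beta>_dual_space linear_der der_J der_\<beta>_simps
         pm.subspace_0[OF S.subspace_J]\<close>)
qed

section \<open>The complex-bilinear differentiation pairing, its adjointness and its
  symmetry\<close>

definition pairing :: "('g \<times> 'g) free_alg \<Rightarrow> ('g \<times> 'g) free_alg \<Rightarrow> complex" where
  "pairing P Q = Poly_Mapping.lookup (free_act pm_scale (\<lambda>v. der (\<beta> v)) Q P) 0"

lemma free_act_der_add [simp]:
  "free_act pm_scale (\<lambda>v. der (\<beta> v)) Q (P + P') =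
    free_act pm_scale (\<lambda>v. der (\<beta> v)) Q P + free_act pm_scale (\<lambda>v. der (\<beta> v)) Q P'"
  and free_act_der_diff [simp]:
  "free_act pm_scale (\<lambda>v. der (\<beta> v)) Q (P - P') =
    free_act pm_scale (\<lambda>v. der (\<beta> v)) Q P - free_act pm_scale (\<lambda>v. der (\<beta> v)) Q P'"
  and free_act_der_scale [simp]:
  "free_act pm_scale (\<lambda>v. der (\<beta> v)) Q (pm_scale c P) = pm_scale c (free_act pm_scale (\<lambda>v. der (\<beta> v)) Q P)"
proof -
  interpret A: Vector_Spaces.linear pm_scale pm_scale "free_act pm_scale (\<lambda>v. der (\<beta> v)) Q"
    by (rule pm.free_act_linear) (rule linear_der)
  show "free_act pm_scale (\<lambda>v. der (\<beta> v)) Q (P + P') =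
    free_act pm_scale (\<lambda>v. der (\<beta> v)) Q P + free_act pm_scale (\<lambda>v. der (\<beta> v)) Q P'" by (rule A.add)
  show "free_act pm_scale (\<lambda>v. der (\<beta> v)) Q (P - P') =
    free_act pm_scale (\<lambda>v. der (\<beta> v)) Q P - free_act pm_scale (\<lambda>v. der (\<beta> v)) Q P'" by (rule A.diff)
  show "free_act pm_scale (\<lambda>v. der (\<beta> v)) Q (pm_scale c P) = pm_scale c (free_act pm_scale (\<lambda>v. der (\<beta> v)) Q P)"
    by (rule A.scale)
qed

lemma free_act_der_commute:
  "free_act pm_scale (\<lambda>v. der (\<beta> v)) Q (der \<alpha> P) = der \<alpha> (free_act pm_scale (\<lambda>v. der (\<beta> v)) Q P)"
proof -
  have "foldr (\<lambda>v. der (\<beta> v)) vs (der \<alpha> P) = der \<alpha> (foldr (\<lambda>v. der (\<beta> v)) vs P)" for vs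
    by (induction vs) (simp_all add: der_commute)
  then show ?thesis
    by (simp add: free_act_def linear_lin[OF linear_der])
qed

lemma pairing_simps [simp]:
  "pairing (P + P') Q = pairing P Q + pairing P' Q" "pairing P (Q + Q') = pairing P Q + pairing P Q'"
  "pairing (P - P') Q = pairing P Q - pairing P' Q" "pairing P (Q - Q') = pairing P Q - pairing P Q'"
  "pairing (pm_scale c P) Q = c * pairing P Q" "pairing P (pm_scale c Q) = c * pairing P Q"
  "pairing P 0 = 0" "pairing P 1 = Poly_Mapping.lookup P 0"
  by (simp_all add: pairing_def lookup_add lookup_minus pm.free_act_add_left pm.free_act_diff_left pm.free_act_scale_left)

lemma pairing_zero_left [simp]: "pairing 0 Q = 0"
  using pairing_simps(3)[of 0 0 Q] by simp

text \<open>The operator of a product is a composite, and the derivative along \<open>v\<close> can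
  be moved inside past all the others since derivations commute.\<close>

lemma pairing_generator_right: "pairing P (generator v * Q) = pairing (der (\<beta> v) P) Q"
  by (simp add: pairing_def pm.free_act_mult[OF linear_der] free_act_der_commute)

text \<open>Induction on the words of \<open>Q\<close>. For a first letter u, moving u to the left
  differentiates \<open>generator v * P\<close> along u and yields B(u, v) times a pairing with
  \<open>P\<close> plus the same situation for the derivative of \<open>P\<close>, hence
  \<open>P\<close> is arbitrary. Symmetry of B matches this with the Leibniz rule on the
  right.\<close>

lemma pairing_generator_left:
  assumes v: "v \<in> p" and Q: "Q \<in> carrier F"
  shows "pairing (generator v * P) Q = pairing P (der (\<beta> v) Q)"
proof -
  have word: "pairing (generator v * P) (Poly_Mapping.single (Mon vs) 1) =
      pairing P (der (\<beta> v) (Poly_Mapping.single (Mon vs) 1))" if "set vs \<subseteq> p" for vs P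
    using that
  proof (induction vs arbitrary: P)
    case Nil
    then show ?case by (simp add: zero_free_monoid_def[symmetric] lookup_mult_zero)
  next
    case (Cons u vs)
    then have "\<beta> u v = \<beta> v u" using v by (simp add: \<beta>_def cform_symmetric)
    moreover have "pairing P (Poly_Mapping.single (Mon vs) (\<beta> v u)) =
        \<beta> v u * pairing P (Poly_Mapping.single (Mon vs) 1)"
      using pairing_simps(6)[of P "\<beta> v u" "Poly_Mapping.single (Mon vs) 1"] by simp
    ultimately show ?case
      using Cons by (simp add: single_Cons pairing_generator_right der_mult pm_scale_mult_left)
  qed
  show ?thesis
    using Q
  proof (induction Q rule: free_algebra_induct)
    case zero
    show ?case by simp
  next
    case (add a w c)
    have "pairing (generator v * P) (pm_scale c (Poly_Mapping.single w 1)) =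
        pairing P (der (\<beta> v) (pm_scale c (Poly_Mapping.single w 1)))"
      using word[of "letters w"] add.hyps by (simp del: pm_scale_single)
    then show ?case using add by simp
  qed
qed

text \<open>Letters can be moved across in both directions as derivatives, so words of
  \<open>Q\<close> are stripped letter by letter. What remains is that pairing with 1 on either side
  gives the constant term.\<close>

lemma pairing_symmetric:
  assumes P: "P \<in> carrier F" and Q: "Q \<in> carrier F"
  shows "pairing P Q = pairing Q P"
proof -
  have one: "pairing 1 P = Poly_Mapping.lookup P 0" if "P \<in> carrier F" for P
    using that
  proof (induction P rule: free_algebra_induct)
    case (add a w c)
    have "pairing 1 (Poly_Mapping.single w 1) = Poly_Mapping.lookup (Poly_Mapping.single w (1::complex)) 0"
    proof (cases "letters w")
      case Nil
      then have "w = 0" by (cases w) (simp add: zero_free_monoid_def)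
      then show ?thesis by simp
    next
      case (Cons v vs)
      then have "w = Mon (v # vs)" by (cases w) simp
      then show ?thesis
        by (simp add: single_Cons pairing_generator_right lookup_mult_zero)
    qed
    then have "pairing 1 (pm_scale c (Poly_Mapping.single w 1)) =
        Poly_Mapping.lookup (pm_scale c (Poly_Mapping.single w (1::complex))) 0"
      by (simp del: pm_scale_single)
    then show ?case using add by (simp add: lookup_add)
  qed simp
  have word: "pairing P (Poly_Mapping.single (Mon vs) 1) = pairing (Poly_Mapping.single (Mon vs) 1) P"
    if "set vs \<subseteq> p" "P \<in> carrier F" for vs P
    using that
  proof (induction vs arbitrary: P)
    case Nil
    then show ?case using one by (simp add: zero_free_monoid_def[symmetric])
  next
    case (Cons v vs)
    then show ?case by (simp add: single_Cons pairing_generator_right pairing_generator_left)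
  qed
  show ?thesis
    using Q
  proof (induction Q rule: free_algebra_induct)
    case zero
    show ?case by simp
  next
    case (add a w c)
    have "pairing P (pm_scale c (Poly_Mapping.single w 1)) = pairing (pm_scale c (Poly_Mapping.single w 1)) P"
      using word[of "letters w" P] P add.hyps by (simp del: pm_scale_single)
    then show ?case using add by simp
  qed
qed

end

context presentation
begin

lemma bilinear_action_quotient:
  assumes T: "quotient_space A s I"
    and g: "\<And>a y. a \<in> carrier F \<Longrightarrow> y \<in> carrier A \<Longrightarrow> g (cl a) (I +>\<^bsub>A\<^esub> y) = I +>\<^bsub>A\<^esub> free_act s f a y"
    and linear: "\<And>v. v \<in> carrier V \<Longrightarrow> Vector_Spaces.linear s s (f v)"
    and f_closed: "\<And>v y. v \<in> carrier V \<Longrightarrow> y \<in> carrier A \<Longrightarrow> f v y \<in> carrier A"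
  shows "bilinear_action Q (quotient_record A I) g"
proof -
  interpret T: quotient_space A s I by (rule T)
  have closed: "free_act s f a y \<in> carrier A" if "a \<in> carrier F" "y \<in> carrier A" for a y
    using that by (intro T.vs.free_act_mem[OF T.subspace_carrier] f_closed) (auto simp: carrier_free_algebra)
  have "Vector_Spaces.linear s s (free_act s f a)" if "a \<in> carrier F" for a
    using that by (intro T.vs.free_act_linear linear) (auto simp: carrier_free_algebra)
  then have lin: "free_act s f a (y + z) = free_act s f a y + free_act s f a z" "free_act s f a (s c y) = s c (free_act s f a y)"
    if "a \<in> carrier F" for a y z c
    using that by (auto simp: Vector_Spaces.linear_iff)
  show ?thesis
    unfolding bilinear_action_def T.carrier_quotient carrier_quotient
    by (auto simp: add_cl smult_cl T.add_cl T.smult_cl g closed lin T.vs.free_act_add_left T.vs.free_act_scale_left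
        T.vs.subspace_add[OF T.subspace_carrier] T.vs.subspace_scale[OF T.subspace_carrier])
qed

lemma bilinear_action_vspace:
  assumes s: "complex_space s"
    and g: "\<And>a y. a \<in> carrier F \<Longrightarrow> g (cl a) y = free_act s f a y"
    and linear: "\<And>v. v \<in> carrier V \<Longrightarrow> Vector_Spaces.linear s s (f v)"
  shows "bilinear_action Q (vspace UNIV s) g"
proof -
  interpret s: complex_space s by fact
  have "Vector_Spaces.linear s s (free_act s f a)" if "a \<in> carrier F" for a
    using that by (intro s.free_act_linear linear) (auto simp: carrier_free_algebra)
  then have lin: "free_act s f a (y + z) = free_act s f a y + free_act s f a z" "free_act s f a (s c y) = s c (free_act s f a y)"
    if "a \<in> carrier F" for a y z c
    using that by (auto simp: Vector_Spaces.linear_iff)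
  show ?thesis
    unfolding bilinear_action_def carrier_quotient
    by (auto simp: add_cl smult_cl g lin s.free_act_add_left s.free_act_scale_left)
qed

end

section \<open>Conjugation on S(p), the hermitian pairing and its commutator identity\<close>

context symmetric_algebra
begin

abbreviation cj :: "('g \<times> 'g) free_alg \<Rightarrow> ('g \<times> 'g) free_alg" where
  "cj \<equiv> conj_extend (\<lambda>w. Mon (map cconj (letters w)))"

lemma cj_mult: "cj (a * b) = cj a * cj b"
  by (rule conj_extend_mult) (simp add: plus_free_monoid_def)

lemma cj_generator [simp]: "cj (generator v) = generator (cconj v)"
  by (simp add: generator_def)

lemma cj_closed [simp]: "a \<in> carrier F \<Longrightarrow> cj a \<in> carrier F"
  by (rule conj_extend_closed) (auto simp: cconj_p)

lemma sym_conj_cl: "sym_conj (cl a) = cl (cj a)"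
  unfolding sym_conj_def
proof (rule S.conj_extend_image_cl)
  show "cj ` linear_relations (vspace p cscale) \<subseteq> S.J"
  proof (rule image_subsetI)
    fix r assume "r \<in> linear_relations (vspace p cscale)"
    then show "cj r \<in> S.J"
      unfolding linear_relations_def
      by (elim UnE CollectE exE conjE) (simp_all add: cconj_p S.generator_add_in_J S.generator_scale_in_J)
  qed
  show "cj ` sym_relations p \<subseteq> S.J"
  proof (rule image_subsetI)
    fix r assume "r \<in> sym_relations p"
    then obtain v w where "r = generator v * generator w - generator w * generator v" "v \<in> p" "w \<in> p"
      unfolding sym_relations_def by blast
    then show "cj r \<in> S.J"
      by (simp add: cj_mult cconj_p generator_commutator_in_J)
  qed
qed (auto simp: plus_free_monoid_def cconj_p comp_def)

text \<open>The relations have no constant term and the augmentation is multiplicative; this makes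
  \<open>sym_eval0\<close> independent of the representative.\<close>

lemma lookup_J_zero:
  assumes "j \<in> S.J"
  shows "Poly_Mapping.lookup j 0 = 0"
proof -
  have "S.J \<subseteq> {a \<in> carrier F. Poly_Mapping.lookup a 0 = 0}"
  proof (rule S.J_minimal)
    have "Poly_Mapping.lookup r 0 = 0" if "r \<in> linear_relations (vspace p cscale) \<union> sym_relations p" for r
      using that unfolding linear_relations_def sym_relations_def
      by (elim UnE CollectE exE conjE) (simp_all add: lookup_minus lookup_mult_zero)
    then show "linear_relations (vspace p cscale) \<subseteq> {a \<in> carrier F. Poly_Mapping.lookup a 0 = 0}"
      "sym_relations p \<subseteq> {a \<in> carrier F. Poly_Mapping.lookup a 0 = 0}"
      using S.relations_subset by (simp_all add: subset_iff)
  qed (auto simp: pm.subspace_def lookup_add lookup_mult_zero)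
  then show ?thesis using assms by auto
qed

lemma sym_eval0_cl: "sym_eval0 (cl a) = Poly_Mapping.lookup a 0"
  using lookup_J_zero[OF S.representative_cl[of a]] by (simp add: sym_eval0_def lookup_minus)

lemma sym_pairing_cl:
  assumes "a \<in> carrier F" "b \<in> carrier F"
  shows "sym_pairing B p (cl a) (cl b) = pairing (cj a) b"
  using assms by (simp add: sym_pairing_def sym_conj_cl sym_diff_op_cl sym_eval0_cl pairing_def)

lemma sesquilinear_sym_pairing: "sesquilinear_on (sym_alg p) (sym_pairing B p)"
  unfolding sesquilinear_on_def sym_alg_eq S.carrier_quotient
  by (auto simp: S.add_cl S.smult_cl sym_pairing_cl)

lemma cj_der: "cj (der (\<beta> v) a) = der (\<beta> (cconj v)) (cj a)"
proof -
  have \<beta>: "cnj (\<beta> v u) = \<beta> (cconj v) (cconj u)" for u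
    \<comment> \<open>Conjugation preserves \<open>p\<close> in both directions, so the two
      extensions by 0 agree.\<close>
    using cconj_p[of u] cconj_p[of "cconj u"] by (auto simp: \<beta>_def cform_cconj)
  have "cj (word_deriv (\<beta> v) vs) = word_deriv (\<beta> (cconj v)) (map cconj vs)" for vs
    by (induction vs) (simp_all add: \<beta> cj_mult)
  then have "cj (der (\<beta> v) (Poly_Mapping.single w c)) = der (\<beta> (cconj v)) (cj (Poly_Mapping.single w c))" for w c
    by (simp add: der_single)
  then show ?thesis by (induction a rule: pm_induct) simp_all
qed

lemma pairing_J_left:
  assumes "j \<in> S.J" "Q \<in> carrier F"
  shows "pairing j Q = 0"
  unfolding pairing_def
  by (intro lookup_J_zero pm.free_act_mem[OF S.subspace_J] assms(1) der_J \<beta>_dual_space)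

text \<open>The commutator of the adjoint pair of multiplication by \<open>u\<close> and differentiation along \<open>u\<close> is
  a scalar; reality of \<open>q\<close> and symmetry of the pairing cancel the remaining second order terms.\<close>

lemma sym_pairing_commutator:
  assumes q: "q \<in> sym_real p" and u: "u \<in> p" and v: "v \<in> p"
  shows "sym_pairing B p (sym_gen p u \<otimes>\<^bsub>sym_alg p\<^esub> q) (sym_gen p v \<otimes>\<^bsub>sym_alg p\<^esub> q) -
      sym_pairing B p (sym_deriv p (\<beta> u) q) (sym_deriv p (\<beta> v) q) =
    cform B v (cconj u) * sym_pairing B p q q"
proof -
  obtain a where a: "a \<in> carrier F" "q = cl a"
    using q by (auto simp: sym_real_def sym_alg_eq S.carrier_quotient)
  \<comment> \<open>The hermitian pairing conjugates its first argument, so the multiplier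
    \<open>u\<close> reaches the bilinear pairing as its conjugate.\<close>
  define u' where "u' = cconj u"
  have u': "u' \<in> p" using u by (simp add: u'_def cconj_p)
  have real: "cj a - a \<in> S.J"
    using q by (simp add: sym_real_def a sym_conj_cl S.cl_eq_iff)
  \<comment> \<open>Reality of \<open>q\<close> says that a representative and its conjugate differ
    by an element of the ideal, on which the bilinear pairing vanishes.\<close>
  have replace: "pairing (der (\<beta> w) (cj a)) b = pairing (der (\<beta> w) a) b" if "b \<in> carrier F" for w b
    using pairing_J_left[OF der_J[OF \<beta>_dual_space real, of w] that] by simp
  have "sym_pairing B p (sym_gen p u \<otimes>\<^bsub>sym_alg p\<^esub> q) (sym_gen p v \<otimes>\<^bsub>sym_alg p\<^esub> q) =
      pairing (generator u' * cj a) (generator v * a)"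
    using u v a(1) by (simp add: a(2) sym_gen_eq sym_alg_eq S.mult_cl sym_pairing_cl cj_mult u'_def)
  \<comment> \<open>The factor \<open>v\<close> moves to the left as a derivative; the Leibniz rule
    applied to \<open>generator u' * cj a\<close> gives the scalar term, and in the other term
    \<open>u'\<close> moves to the right as a derivative.\<close>
  also have "\<dots> = \<beta> v u' * pairing (cj a) a + pairing (der (\<beta> v) (cj a)) (der (\<beta> u') a)"
    using u' a(1) by (simp add: pairing_generator_right der_mult pm_scale_mult_left pairing_generator_left)
  \<comment> \<open>The conjugate is replaced by \<open>a\<close>, the symmetric pairing exchanges
    the two derivatives, and the conjugate is restored on the other one.\<close>
  also have "pairing (der (\<beta> v) (cj a)) (der (\<beta> u') a) = pairing (der (\<beta> u') (cj a)) (der (\<beta> v) a)"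
    using a(1) pairing_symmetric[of "der (\<beta> v) a" "der (\<beta> u') a"] by (simp add: replace)
  also have "\<dots> = sym_pairing B p (sym_deriv p (\<beta> u) q) (sym_deriv p (\<beta> v) q)"
    using a(1) by (simp add: a(2) sym_deriv_cl \<beta>_dual_space sym_pairing_cl cj_der u'_def)
  also have "pairing (cj a) a = sym_pairing B p q q"
    using a by (simp add: sym_pairing_cl)
  also have "\<beta> v u' = cform B v (cconj u)"
    using u' by (simp add: \<beta>_def u'_def)
  finally show ?thesis by simp
qed

section \<open>The Weyl algebra\<close>

lemma dual_space_closed:
  assumes "\<alpha> \<in> dual_space p"
  shows "\<alpha>' \<in> dual_space p \<Longrightarrow> \<alpha> + \<alpha>' \<in> dual_space p" "(\<lambda>x. c * \<alpha> x) \<in> dual_space p"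
  using assms by (auto simp: dual_space_def algebra_simps)

lemma p_add_Pair: "(a, b) \<in> p \<Longrightarrow> (c, d) \<in> p \<Longrightarrow> (a + c, b + d) \<in> p"
  using p_add[of "(a, b)" "(c, d)"] by simp

sublocale W: presentation "weyl_space p" "weyl_relations p"
  rewrites "carrier (weyl_space p) = p \<times> dual_space p" and "add (weyl_space p) = (+)"
    and "smult (weyl_space p) = (\<lambda>c (v, \<alpha>). (cscale c v, \<lambda>x. c * \<alpha> x))"
  by unfold_locales
     (auto simp: weyl_space_def weyl_relations_def p_add_Pair p_scale dual_space_closed
       intro!: free_algebra_closed mult_in_free_algebra single_in_free_algebra)

lemma weyl_eq: "weyl p = quotient_record (free_algebra (p \<times> dual_space p)) W.J"
  by (simp add: weyl_def W.presented_algebra_eq)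

lemma weyl_gen_eq: "weyl_gen p x = W.J +>\<^bsub>free_algebra (p \<times> dual_space p)\<^esub> generator x"
  by (simp add: weyl_gen_def W.presented_gen_eq)

definition weyl_op :: "'g weyl_vec \<Rightarrow> ('g \<times> 'g) free_alg \<Rightarrow> ('g \<times> 'g) free_alg" where
  "weyl_op x y = generator (fst x) * y + der (snd x) y"

lemma linear_weyl_op: "Vector_Spaces.linear pm_scale pm_scale (weyl_op x)"
  by (simp add: Vector_Spaces.linear_iff vector_space_pm_scale weyl_op_def algebra_simps
      pm_scale_mult_right pm.scale_right_distrib)

lemma weyl_op_closed: "x \<in> p \<times> dual_space p \<Longrightarrow> y \<in> carrier F \<Longrightarrow> weyl_op x y \<in> carrier F"
  by (auto simp: weyl_op_def)

text \<open>On the free algebra the mixed commutators give the symplectic form exactly and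
  derivations commute exactly. Only multiplications fail to commute, and their commutators lie in
  the ideal of S(p).\<close>

lemma weyl_action_cl:
  assumes a: "a \<in> carrier (free_algebra (p \<times> dual_space p))" and y: "y \<in> carrier F"
  shows "weyl_action p (W.J +>\<^bsub>free_algebra (p \<times> dual_space p)\<^esub> a) (cl y) = cl (free_act pm_scale weyl_op a y)"
  unfolding weyl_action_def sym_alg_eq
proof (rule W.presented_action_quotient[OF S.quotient_space_axioms])
  show "(case x of (v, \<alpha>) \<Rightarrow> \<lambda>q. add Sym (mult Sym (sym_gen p v) q) (sym_deriv p \<alpha> q)) (cl y) = cl (weyl_op x y)"
    if "x \<in> p \<times> dual_space p" "y \<in> carrier F" for x y
    using that by (auto simp: sym_gen_eq S.mult_cl sym_deriv_cl S.add_cl weyl_op_def)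
  show "weyl_op x y \<in> S.J" if "x \<in> p \<times> dual_space p" "y \<in> S.J" for x y
    unfolding weyl_op_def using that
    by (intro pm.subspace_add[OF S.subspace_J] S.J_mult(1) der_J) auto
  show "weyl_op (x + x') y - weyl_op x y - weyl_op x' y \<in> S.J"
    if "x \<in> p \<times> dual_space p" "x' \<in> p \<times> dual_space p" "y \<in> carrier F" for x x' y
  proof -
    have "weyl_op (x + x') y - weyl_op x y - weyl_op x' y =
        (generator (fst x + fst x') - generator (fst x) - generator (fst x')) * y"
      using der_fun_add[of "snd x" "snd x'" y] by (simp add: weyl_op_def algebra_simps plus_fun_def)
    then show ?thesis
      using that by (auto intro!: S.J_mult(2) S.generator_add_in_J)
  qed
  show "weyl_op (case x of (v, \<alpha>) \<Rightarrow> (cscale c v, \<lambda>x. c * \<alpha> x)) y - pm_scale c (weyl_op x y) \<in> S.J"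
    if "x \<in> p \<times> dual_space p" "y \<in> carrier F" for c x y
  proof -
    have "weyl_op (case x of (v, \<alpha>) \<Rightarrow> (cscale c v, \<lambda>x. c * \<alpha> x)) y - pm_scale c (weyl_op x y) =
        (generator (cscale c (fst x)) - pm_scale c (generator (fst x))) * y"
      by (simp add: weyl_op_def algebra_simps case_prod_unfold der_fun_scale pm_scale_mult_left
          pm.scale_right_distrib)
    then show ?thesis
      using that by (auto intro!: S.J_mult(2) S.generator_scale_in_J)
  qed
  show "free_act pm_scale weyl_op r y \<in> S.J" if "r \<in> weyl_relations p" "y \<in> carrier F" for r y
    using that(1) unfolding weyl_relations_def
  proof (elim CollectE exE conjE)
    fix x x' assume r: "r = generator x * generator x' - generator x' * generator x -
        Poly_Mapping.single 0 (weyl_omega x x')"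
      and x: "x \<in> p \<times> dual_space p" "x' \<in> p \<times> dual_space p"
    have "free_act pm_scale weyl_op r y = weyl_op x (weyl_op x' y) - weyl_op x' (weyl_op x y) -
        pm_scale (weyl_omega x x') y"
      by (simp add: r pm.free_act_diff_left pm.free_act_mult[OF linear_weyl_op])
    \<comment> \<open>The two mixed terms of the Leibniz rule cancel against the scalar
      \<open>weyl_omega x x'\<close>.\<close>
    also have "\<dots> = (generator (fst x) * generator (fst x') - generator (fst x') * generator (fst x)) * y"
      by (simp add: weyl_op_def weyl_omega_def case_prod_unfold der_mult pm_scale_mult_left
          pm.scale_left_diff_distrib der_commute[of "snd x"] algebra_simps)
    also have "\<dots> \<in> S.J"
      using x that(2) by (auto intro!: S.J_mult(2) generator_commutator_in_J)
    finally show ?thesis .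
  qed
qed (use a y linear_weyl_op weyl_op_closed in auto)

lemma bilinear_weyl_action: "bilinear_action (weyl p) (sym_alg p) (weyl_action p)"
  unfolding weyl_eq sym_alg_eq
  by (rule W.bilinear_action_quotient[OF S.quotient_space_axioms weyl_action_cl])
     (auto simp: linear_weyl_op intro!: weyl_op_closed)

lemma weyl_action_gen:
  assumes "q \<in> carrier (sym_alg p)"
  shows "v \<in> p \<Longrightarrow> weyl_action p (weyl_gen p (v, 0)) q = sym_gen p v \<otimes>\<^bsub>sym_alg p\<^esub> q"
    and "\<alpha> \<in> dual_space p \<Longrightarrow> weyl_action p (weyl_gen p (0, \<alpha>)) q = sym_deriv p \<alpha> q"
proof -
  obtain a where a: "a \<in> carrier F" "q = cl a"
    using assms by (auto simp: sym_alg_eq S.carrier_quotient)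
  have zero: "0 \<in> dual_space p" by (simp add: dual_space_def)
  show "weyl_action p (weyl_gen p (v, 0)) q = sym_gen p v \<otimes>\<^bsub>sym_alg p\<^esub> q" if "v \<in> p"
  proof -
    have "der 0 a = 0" using der_fun_scale[of 0 "\<lambda>_. 0" a] by (simp add: zero_fun_def)
    then show ?thesis
      using that a zero by (simp add: weyl_gen_eq weyl_action_cl weyl_op_def sym_gen_eq sym_alg_eq S.mult_cl)
  qed
  show "weyl_action p (weyl_gen p (0, \<alpha>)) q = sym_deriv p \<alpha> q" if "\<alpha> \<in> dual_space p"
  proof -
    \<comment> \<open>The letter 0 of the free algebra is not its zero element; it vanishes only
      modulo the linear relations.\<close>
    have "generator 0 \<in> S.J"
      using S.generator_scale_in_J[OF p_0, of 0] by simp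
    then have "weyl_op (0, \<alpha>) a - der \<alpha> a \<in> S.J"
      using a S.J_mult(2) by (simp add: weyl_op_def)
    then show ?thesis
      using that a p_0 by (simp add: weyl_gen_eq weyl_action_cl sym_deriv_cl S.cl_eq_iff)
  qed
qed

end

section \<open>Dual bases\<close>

text \<open>The target is arbitrary so that the same sums over dual bases can be formed from
  products of generators modulo a relation ideal and from composites of operators applied to a
  vector.\<close>

definition bilinear_map ::
  "('g::real_vector \<times> 'g) set \<Rightarrow> (complex \<Rightarrow> 'n \<Rightarrow> 'n) \<Rightarrow> ('g \<times> 'g \<Rightarrow> 'g \<times> 'g \<Rightarrow> 'n::ab_group_add) \<Rightarrow> bool" where
  "bilinear_map V s T \<longleftrightarrow>
     (\<forall>a\<in>V. \<forall>a'\<in>V. \<forall>b\<in>V. T (a + a') b = T a b + T a' b \<and> T b (a + a') = T b a + T b a') \<and>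
     (\<forall>c. \<forall>a\<in>V. \<forall>b\<in>V. T (cscale c a) b = s c (T a b) \<and> T a (cscale c b) = s c (T a b))"

lemma bilinear_map_sum:
  assumes "bilinear_map V s T" "cs.subspace V" "complex_space s" "\<And>i. i \<in> A \<Longrightarrow> f i \<in> V" "b \<in> V"
  shows "T (\<Sum>i\<in>A. cscale (c i) (f i)) b = (\<Sum>i\<in>A. s (c i) (T (f i) b))"
    and "T b (\<Sum>i\<in>A. cscale (c i) (f i)) = (\<Sum>i\<in>A. s (c i) (T b (f i)))"
proof -
  interpret complex_space s by fact
  note V = cs.subspace_0[OF assms(2)] cs.subspace_sum[OF assms(2)] cs.subspace_scale[OF assms(2)]
  note T = assms(1)[unfolded bilinear_map_def]
  have "T (cscale 0 b) b = s 0 (T b b)" "T b (cscale 0 b) = s 0 (T b b)"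
    using T assms(5) by blast+
  then have T0: "T 0 b = 0" "T b 0 = 0" by simp_all
  have "T (\<Sum>i\<in>A. cscale (c i) (f i)) b = (\<Sum>i\<in>A. s (c i) (T (f i) b)) \<and>
      T b (\<Sum>i\<in>A. cscale (c i) (f i)) = (\<Sum>i\<in>A. s (c i) (T b (f i)))"
    using assms(4)
  proof (induction A rule: infinite_finite_induct)
    case (insert x A)
    then have "(\<Sum>i\<in>A. cscale (c i) (f i)) \<in> V" "cscale (c x) (f x) \<in> V" "f x \<in> V"
      by (auto intro!: V)
    then show ?case using insert T assms(5) by simp
  qed (simp_all add: T0)
  then show "T (\<Sum>i\<in>A. cscale (c i) (f i)) b = (\<Sum>i\<in>A. s (c i) (T (f i) b))"
    "T b (\<Sum>i\<in>A. cscale (c i) (f i)) = (\<Sum>i\<in>A. s (c i) (T b (f i)))" by auto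
qed

context real_form
begin

lemma cform_sum_right: "cform B v (sum f A) = (\<Sum>i\<in>A. cform B v (f i))"
  by (induction A rule: infinite_finite_induct) (simp_all add: cform_simps)

lemma dual_basesD:
  assumes "dual_bases B V n w w'" "i < n"
  shows "w i \<in> V" "w' i \<in> V" "j < n \<Longrightarrow> cform B (w i) (w' j) = (if i = j then 1 else 0)"
  using assms cs.span_superset[of "w ` {..<n}"] by (auto simp: dual_bases_def is_basis_def)

lemma dual_bases_subspace: "dual_bases B V n w w' \<Longrightarrow> cs.subspace V"
  using cs.subspace_span by (auto simp: dual_bases_def is_basis_def)

text \<open>The right-hand side is linear in \<open>x\<close> and fixes every \<open>w i\<close> by
  duality, and these span \<open>V\<close>.\<close>

lemma basis_expansion:
  assumes d: "dual_bases B V n w w'" and x: "x \<in> V"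
  shows "x = (\<Sum>i<n. cscale (cform B x (w' i)) (w i))"
proof -
  define E where "E x = (\<Sum>i<n. cscale (cform B x (w' i)) (w i))" for x
  have "E (x + y) = E x + E y" "E (cscale c x) = cscale c (E x)" "E 0 = 0" for x y c
    by (simp_all add: E_def cform_simps cs.scale_left_distrib sum.distrib cs.scale_sum_right)
  then have "cs.subspace {x. E x = x}"
    by (auto simp: cs.subspace_def)
  moreover have "E (w i) = w i" if "i < n" for i
  proof -
    have "E (w i) = (\<Sum>j<n. if i = j then w j else 0)"
      unfolding E_def using dual_basesD(3)[OF d that] by (intro sum.cong) auto
    then show ?thesis using that by simp
  qed
  ultimately have "cs.span (w ` {..<n}) \<subseteq> {x. E x = x}"
    by (intro cs.span_minimal) auto
  then have "E x = x" using d x by (auto simp: dual_bases_def is_basis_def)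
  then show ?thesis by (simp add: E_def)
qed

text \<open>\<open>w'\<close> is given only by its pairings with \<open>w\<close>, not as a basis.
  The error of the expansion is orthogonal to all \<open>w j\<close>, hence to \<open>V\<close>, and
  nondegeneracy on \<open>V\<close> makes it vanish.\<close>

lemma dual_basis_expansion:
  assumes d: "dual_bases B V n w w'" and x: "x \<in> V"
    and nondegenerate: "\<And>x. x \<in> V \<Longrightarrow> (\<And>y. y \<in> V \<Longrightarrow> cform B x y = 0) \<Longrightarrow> x = 0"
  shows "x = (\<Sum>i<n. cscale (cform B (w i) x) (w' i))"
proof -
  note V = dual_bases_subspace[OF d]
  define e where "e = x - (\<Sum>i<n. cscale (cform B (w i) x) (w' i))"
  have eV: "e \<in> V" unfolding e_def
    using x dual_basesD[OF d] by (intro cs.subspace_diff[OF V] cs.subspace_sum[OF V] cs.subspace_scale[OF V]) auto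
  have w: "cform B e (w j) = 0" if "j < n" for j
  proof -
    have "cform B e (w j) = cform B (w j) e" by (rule cform_symmetric)
    also have "\<dots> = cform B (w j) x - (\<Sum>i<n. cform B (w i) x * (if j = i then 1 else 0))"
      using dual_basesD(3)[OF d that] by (simp add: e_def cform_simps cform_sum_right)
    also have "\<dots> = 0" using that by (simp add: if_distrib cong: if_cong)
    finally show ?thesis .
  qed
  have "cform B e y = 0" if "y \<in> V" for y
    by (subst basis_expansion[OF d that]) (simp add: cform_sum_right cform_simps w)
  then have "e = 0" by (rule nondegenerate[OF eV])
  then show ?thesis by (simp add: e_def)
qed

text \<open>Expressed in \<open>w\<close> alone, both sums have as coefficients the Gram matrix of
  \<open>w'\<close>, which is symmetric.\<close>

lemma dual_sum_flip:
  assumes d: "dual_bases B V n w w'" and s: "complex_space s" and T: "bilinear_map V s T"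
  shows "(\<Sum>i<n. T (w i) (w' i)) = (\<Sum>i<n. T (w' i) (w i))"
proof -
  interpret complex_space s by fact
  note w = dual_basesD[OF d] and bs = bilinear_map_sum[OF T dual_bases_subspace[OF d] s]
  have "(\<Sum>i<n. T (w i) (w' i)) = (\<Sum>i<n. T (w i) (\<Sum>j<n. cscale (cform B (w' i) (w' j)) (w j)))"
    using w by (intro sum.cong refl arg_cong[where f = "T _"] basis_expansion[OF d]) auto
  also have "\<dots> = (\<Sum>i<n. \<Sum>j<n. s (cform B (w' i) (w' j)) (T (w i) (w j)))"
    using w by (intro sum.cong refl bs) auto
  also have "\<dots> = (\<Sum>i<n. \<Sum>j<n. s (cform B (w' i) (w' j)) (T (w j) (w i)))"
    by (subst sum.swap) (simp add: cform_symmetric)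
  also have "\<dots> = (\<Sum>i<n. T (\<Sum>j<n. cscale (cform B (w' i) (w' j)) (w j)) (w i))"
    using w by (intro sum.cong refl bs[symmetric]) auto
  also have "\<dots> = (\<Sum>i<n. T (w' i) (w i))"
    using w by (intro sum.cong refl arg_cong[where f = "\<lambda>x. T x _"] basis_expansion[OF d, symmetric]) auto
  finally show ?thesis .
qed

text \<open>The matrix of \<open>D\<close> in the basis \<open>w\<close> is, by skewness, minus the
  transpose of its matrix in \<open>w'\<close>; expanding \<open>D (w i)\<close> and collecting in
  the other slot therefore produces the second sum with opposite sign. With \<open>D\<close> = ad x
  this is the invariance of the Casimir tensor.\<close>

lemma dual_sum_invariant:
  assumes d: "dual_bases B V n w w'" and s: "complex_space s" and T: "bilinear_map V s T"
    and nondegenerate: "\<And>x. x \<in> V \<Longrightarrow> (\<And>y. y \<in> V \<Longrightarrow> cform B x y = 0) \<Longrightarrow> x = 0"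
    and D: "\<And>x. x \<in> V \<Longrightarrow> D x \<in> V" and skew: "\<And>x y. x \<in> V \<Longrightarrow> y \<in> V \<Longrightarrow> cform B (D x) y = - cform B x (D y)"
  shows "(\<Sum>i<n. T (D (w i)) (w' i) + T (w i) (D (w' i))) = 0"
proof -
  interpret complex_space s by fact
  note w = dual_basesD[OF d] and bs = bilinear_map_sum[OF T dual_bases_subspace[OF d] s]
  have "(\<Sum>i<n. T (D (w i)) (w' i)) = (\<Sum>i<n. T (\<Sum>j<n. cscale (cform B (D (w i)) (w' j)) (w j)) (w' i))"
    using w D by (intro sum.cong refl arg_cong[where f = "\<lambda>x. T x _"] basis_expansion[OF d]) auto
  also have "\<dots> = (\<Sum>i<n. \<Sum>j<n. s (- cform B (w i) (D (w' j))) (T (w j) (w' i)))"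
    using w by (intro sum.cong refl) (subst bs, auto simp: skew)
  also have "\<dots> = - (\<Sum>j<n. \<Sum>i<n. s (cform B (w i) (D (w' j))) (T (w j) (w' i)))"
    by (subst sum.swap) (simp add: sum_negf)
  also have "(\<Sum>j<n. \<Sum>i<n. s (cform B (w i) (D (w' j))) (T (w j) (w' i))) =
      (\<Sum>j<n. T (w j) (\<Sum>i<n. cscale (cform B (w i) (D (w' j))) (w' i)))"
    using w by (intro sum.cong refl bs[symmetric]) auto
  also have "\<dots> = (\<Sum>j<n. T (w j) (D (w' j)))"
    using w D by (intro sum.cong refl arg_cong[where f = "T _"] dual_basis_expansion[OF d _ nondegenerate, symmetric]) auto
  finally show ?thesis by (simp add: sum.distrib)
qed

text \<open>Orthogonality makes \<open>y\<close> and \<open>z\<close> together a dual system for g.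
  Each \<open>w i\<close> is expanded in it, and summation over i reassembles \<open>y'\<close> and
  \<open>z'\<close> from their expansions in \<open>w'\<close>.\<close>

lemma dual_sum_split:
  assumes d: "dual_bases B UNIV n w w'" and dk: "dual_bases B k nk y y'" and dp: "dual_bases B p np z z'"
    and s: "complex_space s" and T: "bilinear_map UNIV s T"
    and nondegenerate: "\<And>x. (\<And>y. cform B x y = 0) \<Longrightarrow> x = 0"
    and decomposition: "\<And>x. \<exists>a\<in>k. \<exists>b\<in>p. x = a + b"
    and orthogonal: "\<And>a b. a \<in> k \<Longrightarrow> b \<in> p \<Longrightarrow> cform B a b = 0"
  shows "(\<Sum>i<n. T (w i) (w' i)) = (\<Sum>j<nk. T (y j) (y' j)) + (\<Sum>j<np. T (z j) (z' j))"
proof -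
  interpret complex_space s by fact
  note bs = bilinear_map_sum[OF T cs.subspace_UNIV s]
  have T_add: "T (a + b) c = T a c + T b c" for a b c
    using T unfolding bilinear_map_def by blast
  have expand: "x = (\<Sum>j<nk. cscale (cform B x (y' j)) (y j)) + (\<Sum>j<np. cscale (cform B x (z' j)) (z j))" for x
  proof -
    obtain a b where ab: "a \<in> k" "b \<in> p" "x = a + b" using decomposition by blast
    have "cform B x (y' j) = cform B a (y' j)" if "j < nk" for j
      using orthogonal[OF dual_basesD(2)[OF dk that] ab(2)] by (simp add: ab(3) cform_simps cform_symmetric)
    moreover have "cform B x (z' j) = cform B b (z' j)" if "j < np" for j
      using orthogonal[OF ab(1) dual_basesD(2)[OF dp that]] by (simp add: ab(3) cform_simps)
    ultimately have "(\<Sum>j<nk. cscale (cform B x (y' j)) (y j)) = a" "(\<Sum>j<np. cscale (cform B x (z' j)) (z j)) = b"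
      using basis_expansion[OF dk ab(1)] basis_expansion[OF dp ab(2)] by simp_all
    then show ?thesis using ab by simp
  qed
  have collect: "(\<Sum>i<n. \<Sum>j<N. s (cform B (w i) (v' j)) (T (v j) (w' i))) = (\<Sum>j<N. T (v j) (v' j))"
    for N :: nat and v v'
  proof -
    have "(\<Sum>j<N. \<Sum>i<n. s (cform B (w i) (v' j)) (T (v j) (w' i))) =
        (\<Sum>j<N. T (v j) (\<Sum>i<n. cscale (cform B (w i) (v' j)) (w' i)))"
      by (intro sum.cong refl bs[symmetric]) auto
    also have "\<dots> = (\<Sum>j<N. T (v j) (v' j))"
      using nondegenerate
      by (intro sum.cong refl arg_cong[where f = "T _"] dual_basis_expansion[OF d _, symmetric]) auto
    finally show ?thesis by (subst sum.swap)
  qed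
  have "(\<Sum>i<n. T (w i) (w' i)) = (\<Sum>i<n. T ((\<Sum>j<nk. cscale (cform B (w i) (y' j)) (y j)) +
      (\<Sum>j<np. cscale (cform B (w i) (z' j)) (z j))) (w' i))"
    by (intro sum.cong refl arg_cong[where f = "\<lambda>x. T x _"] expand)
  also have "\<dots> = (\<Sum>i<n. (\<Sum>j<nk. s (cform B (w i) (y' j)) (T (y j) (w' i))) +
      (\<Sum>j<np. s (cform B (w i) (z' j)) (T (z j) (w' i))))"
    by (simp add: T_add bs)
  also have "\<dots> = (\<Sum>j<nk. T (y j) (y' j)) + (\<Sum>j<np. T (z j) (z' j))"
    by (simp add: sum.distrib collect)
  finally show ?thesis .
qed

end

text \<open>Composing with such an \<open>f\<close> turns a map that is bilinear modulo \<open>N\<close> into a bilinear one.\<close>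

lemma (in complex_space) projection_along_subspace:
  assumes "subspace N"
  obtains f where "Vector_Spaces.linear scale scale f" "\<And>x. f x = 0 \<longleftrightarrow> x \<in> N"
proof -
  interpret vector_space_pair scale scale ..
  obtain B where B: "B \<subseteq> N" "independent B" "span B = N"
    using basis_exists[of N] assms by (metis span_minimal subset_antisym)
  define C where "C = extend_basis B"
  have C: "B \<subseteq> C" "independent C" "span C = UNIV"
    using B(2) by (simp_all add: C_def extend_basis_superset independent_extend_basis)
  \<comment> \<open>A basis of the subspace is sent to 0 and the remaining basis vectors are fixed.
    Hence x - f x lies in \<open>N\<close> for all x, and f x = 0 forces x into
    \<open>N\<close>.\<close>
  obtain f where f: "Vector_Spaces.linear scale scale f" "\<forall>x\<in>C. f x = (if x \<in> B then 0 else x)"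
    using linear_independent_extend[OF C(2), of "\<lambda>x. if x \<in> B then 0 else x"] by blast
  interpret f: Vector_Spaces.linear scale scale f by (rule f(1))
  have "B \<subseteq> {x. f x = 0}" using f(2) C(1) by auto
  moreover have "subspace {x. f x = 0}"
    by (auto simp: subspace_def f.add f.scale)
  ultimately have "N \<subseteq> {x. f x = 0}"
    using span_minimal[of B "{x. f x = 0}"] B(3) by simp
  moreover have "C \<subseteq> {x. x - f x \<in> N}"
    using f(2) B(1) subspace_0[OF assms] by auto
  moreover have "subspace {x. x - f x \<in> N}"
  proof -
    have add: "x + y - f (x + y) = (x - f x) + (y - f y)"
      and scale: "scale c x - f (scale c x) = scale c (x - f x)" for x y c
      by (simp_all add: f.add f.scale scale_right_diff_distrib)
    show ?thesis
      unfolding subspace_def mem_Collect_eq add scale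
      using subspace_0[OF assms] subspace_add[OF assms] subspace_scale[OF assms] by (auto simp: f.zero)
  qed
  ultimately have "\<And>x. x - f x \<in> N" "N \<subseteq> {x. f x = 0}"
    using span_minimal[of C "{x. x - f x \<in> N}"] C(3) by auto
  then have "f x = 0 \<longleftrightarrow> x \<in> N" for x
    by (metis (mono_tags) diff_zero mem_Collect_eq subset_iff)
  then show ?thesis using that f(1) by blast
qed

section \<open>Enveloping algebras and their modules\<close>

locale enveloping_algebra =
  fixes br :: "'g::real_vector \<Rightarrow> 'g \<Rightarrow> 'g" and L :: "('g \<times> 'g) set"
  assumes subspace_L: "cs.subspace L" and bracket_closed: "x \<in> L \<Longrightarrow> y \<in> L \<Longrightarrow> cbracket br x y \<in> L"
begin

sublocale E: presentation "vspace L cscale" "env_relations br L"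
  rewrites "carrier (vspace L cscale) = L" and "add (vspace L cscale) = (+)"
    and "smult (vspace L cscale) = cscale"
  by unfold_locales
     (auto simp: env_relations_def bracket_closed cs.subspace_add[OF subspace_L] cs.subspace_scale[OF subspace_L]
       intro!: free_algebra_closed mult_in_free_algebra)

abbreviation "F \<equiv> free_algebra L"
abbreviation "Env \<equiv> quotient_record F E.J"
abbreviation cl :: "('g \<times> 'g) free_alg \<Rightarrow> ('g \<times> 'g) free_alg set" where "cl a \<equiv> E.J +>\<^bsub>F\<^esub> a"

lemma env_eq: "env br L = Env"
  by (simp add: env_def E.presented_algebra_eq)

lemma env_gen_eq: "env_gen br L v = cl (generator v)"
  by (simp add: env_gen_def E.presented_gen_eq)

lemma bracket_relation_in_J:
  "x \<in> L \<Longrightarrow> y \<in> L \<Longrightarrow>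
    generator x * generator y - generator y * generator x - generator (cbracket br x y) \<in> E.J"
  by (rule subsetD[OF E.relations_in_J], rule UnI2, unfold env_relations_def) blast

lemma casimir_eq:
  assumes "\<And>i. i < n \<Longrightarrow> w i \<in> L" "\<And>i. i < n \<Longrightarrow> w' i \<in> L"
  shows "casimir br L n w w' = cl (\<Sum>i<n. generator (w i) * generator (w' i))"
proof -
  have "casimir br L n w w' = finsum Env (\<lambda>i. cl (generator (w i) * generator (w' i))) {..<n}"
    unfolding casimir_def env_eq env_gen_eq
    by (rule abelian_monoid.finsum_cong'[OF E.abelian_monoid_quotient refl])
       (use assms in \<open>auto simp: E.carrier_quotient E.mult_cl\<close>)
  also have "\<dots> = cl (\<Sum>i<n. generator (w i) * generator (w' i))"
    by (rule E.finsum_cl) (use assms in auto)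
  finally show ?thesis .
qed

text \<open>The commutator with x acts on a product of two generators as the derivation ad x, modulo
  the ideal, so \<open>dual_sum_invariant\<close> settles generators. Words and linear combinations
  follow.\<close>

lemma casimir_commutes:
  assumes B: "real_form B" and d: "dual_bases B L n w w'"
    and nondegenerate: "\<And>x. x \<in> L \<Longrightarrow> (\<And>y. y \<in> L \<Longrightarrow> cform B x y = 0) \<Longrightarrow> x = 0"
    and invariant: "\<And>x y z. x \<in> L \<Longrightarrow> y \<in> L \<Longrightarrow> z \<in> L \<Longrightarrow>
      cform B (cbracket br x y) z = - cform B y (cbracket br x z)"
    and a: "a \<in> carrier F"
  defines "\<Omega> \<equiv> \<Sum>i<n. generator (w i) * generator (w' i)"
  shows "a * \<Omega> - \<Omega> * a \<in> E.J"
proof -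
  interpret real_form B by fact
  note w = dual_basesD[OF d]
  have \<Omega>: "\<Omega> \<in> carrier F" unfolding \<Omega>_def by (intro sum_in_free_algebra mult_in_free_algebra) (auto simp: w)
  \<comment> \<open>A linear map with kernel exactly the ideal: congruences become equations, so
    products of generators become a truly bilinear map.\<close>
  obtain f :: "('g \<times> 'g) free_alg \<Rightarrow> ('g \<times> 'g) free_alg"
    where f: "Vector_Spaces.linear pm_scale pm_scale f" "\<And>x. f x = 0 \<longleftrightarrow> x \<in> E.J"
    by (rule pm.projection_along_subspace[OF E.subspace_J]) blast
  interpret f: Vector_Spaces.linear pm_scale pm_scale f by fact
  have f_eq: "f x = f y" if "x - y \<in> E.J" for x y
    using f(2)[of "x - y"] that by (simp add: f.diff)
  have T: "bilinear_map L pm_scale (\<lambda>u v. f (generator u * generator v))"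
    unfolding bilinear_map_def
  proof (intro conjI ballI allI)
    fix u u' v assume L: "u \<in> L" "u' \<in> L" "v \<in> L"
    show "f (generator (u + u') * generator v) = f (generator u * generator v) + f (generator u' * generator v)"
      unfolding f.add[symmetric]
      by (rule f_eq) (use L E.J_mult(2)[OF E.generator_add_in_J[OF L(1,2)], of "generator v"] in
        \<open>simp add: algebra_simps\<close>)
    show "f (generator v * generator (u + u')) = f (generator v * generator u) + f (generator v * generator u')"
      unfolding f.add[symmetric]
      by (rule f_eq) (use L E.J_mult(1)[OF E.generator_add_in_J[OF L(1,2)], of "generator v"] in
        \<open>simp add: algebra_simps\<close>)
  next
    fix c u v assume L: "u \<in> L" "v \<in> L"
    show "f (generator (cscale c u) * generator v) = pm_scale c (f (generator u * generator v))"
      unfolding f.scale[symmetric]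
      by (rule f_eq) (use L E.J_mult(2)[OF E.generator_scale_in_J[OF L(1), of c], of "generator v"] in
        \<open>simp add: algebra_simps pm_scale_mult_left\<close>)
    show "f (generator u * generator (cscale c v)) = pm_scale c (f (generator u * generator v))"
      unfolding f.scale[symmetric]
      by (rule f_eq) (use L E.J_mult(1)[OF E.generator_scale_in_J[OF L(2), of c], of "generator u"] in
        \<open>simp add: algebra_simps pm_scale_mult_right\<close>)
  qed
  have gen: "generator x * \<Omega> - \<Omega> * generator x \<in> E.J" if x: "x \<in> L" for x
  proof -
    have "f (generator x * (generator u * generator v) - generator u * generator v * generator x) =
        f (generator (cbracket br x u) * generator v) + f (generator u * generator (cbracket br x v))"
      if "u \<in> L" "v \<in> L" for u v
    proof -
      have "generator x * (generator u * generator v) - generator u * generator v * generator x -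
          (generator (cbracket br x u) * generator v + generator u * generator (cbracket br x v)) =
          (generator x * generator u - generator u * generator x - generator (cbracket br x u)) * generator v +
          generator u * (generator x * generator v - generator v * generator x - generator (cbracket br x v))"
        by (simp add: algebra_simps)
      also have "\<dots> \<in> E.J"
        using x that
        by (intro pm.subspace_add[OF E.subspace_J] E.J_mult(2) E.J_mult(1)[of _ "generator u"] bracket_relation_in_J) auto
      finally show ?thesis
        unfolding f.add[symmetric] by (rule f_eq)
    qed
    then have "f (generator x * \<Omega> - \<Omega> * generator x) = (\<Sum>i<n.
        f (generator (cbracket br x (w i)) * generator (w' i)) + f (generator (w i) * generator (cbracket br x (w' i))))"
      using w by (simp add: \<Omega>_def sum_distrib_left sum_distrib_right f.sum flip: sum_subtractf)
    also have "\<dots> = 0"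
      by (rule dual_sum_invariant[OF d pm.complex_space_axioms T nondegenerate])
         (use x bracket_closed invariant in auto)
    finally show ?thesis using f(2) by blast
  qed
  have word: "Poly_Mapping.single (Mon vs) 1 * \<Omega> - \<Omega> * Poly_Mapping.single (Mon vs) 1 \<in> E.J" if "set vs \<subseteq> L" for vs
    using that
  proof (induction vs)
    case Nil
    then show ?case by (simp add: zero_free_monoid_def[symmetric] pm.subspace_0[OF E.subspace_J])
  next
    case (Cons v vs)
    let ?u = "Poly_Mapping.single (Mon vs) (1 :: complex)"
    \<comment> \<open>The commutator with \<Omega> obeys the Leibniz rule on the product of
      \<open>v\<close> and the rest of the word.\<close>
    have "generator v * (?u * \<Omega> - \<Omega> * ?u) + (generator v * \<Omega> - \<Omega> * generator v) * ?u \<in> E.J"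
      using Cons gen[of v]
      by (intro pm.subspace_add[OF E.subspace_J] E.J_mult) (auto intro!: single_in_free_algebra)
    then show ?case by (simp add: single_Cons algebra_simps)
  qed
  show ?thesis
    using a
  proof (induction a rule: free_algebra_induct)
    case zero
    show ?case by (simp add: pm.subspace_0[OF E.subspace_J])
  next
    case (add a w c)
    have "pm_scale c (Poly_Mapping.single w 1 * \<Omega> - \<Omega> * Poly_Mapping.single w 1) \<in> E.J"
      using word[of "letters w"] add.hyps by (intro pm.subspace_scale[OF E.subspace_J]) simp
    then have "Poly_Mapping.single w c * \<Omega> - \<Omega> * Poly_Mapping.single w c \<in> E.J"
      using pm_scale_mult_left[of c "Poly_Mapping.single w 1" \<Omega>] pm_scale_mult_right[of \<Omega> c "Poly_Mapping.single w 1"]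
      by (simp add: pm.scale_right_diff_distrib)
    then show ?case
      using pm.subspace_add[OF E.subspace_J add.IH, of "Poly_Mapping.single w c * \<Omega> - \<Omega> * Poly_Mapping.single w c"]
      by (simp add: algebra_simps)
  qed
qed

lemma free_act_generator_mult:
  assumes "lie_module br L s \<rho>" "x \<in> L"
  shows "free_act s \<rho> (generator x * generator z) m = \<rho> x (\<rho> z m)"
proof -
  interpret complex_space s
    using assms by (intro complex_space.intro) (simp add: lie_module_def)
  have "free_act s \<rho> (generator x * generator z) m = free_act s \<rho> (generator x) (free_act s \<rho> (generator z) m)"
    by (rule free_act_mult) (use assms in \<open>auto simp: generator_def lie_module_def\<close>)
  then show ?thesis by simp
qed

lemma env_action_cl:
  assumes "lie_module br L s \<rho>"
  shows "env_action s \<rho> (cl a) m = free_act s \<rho> a m"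
proof -
  interpret complex_space s
    using assms by (intro complex_space.intro) (simp add: lie_module_def)
  have "free_act s \<rho> r y = 0" if "r \<in> env_relations br L" for r y
    using that assms unfolding env_relations_def
    by (elim CollectE exE conjE)
       (simp add: free_act_diff_left free_act_generator_mult[OF assms] lie_module_def)
  then show ?thesis
    using assms unfolding env_action_def
    by (intro E.presented_action_vspace) (auto simp: lie_module_def complex_space_axioms)
qed

end

lemma (in enveloping_algebra) env_action_casimir:
  assumes l: "lie_module br L s \<rho>" and w: "\<And>i. i < n \<Longrightarrow> w i \<in> L" "\<And>i. i < n \<Longrightarrow> w' i \<in> L"
  shows "env_action s \<rho> (casimir br L n w w') m = (\<Sum>i<n. \<rho> (w i) (\<rho> (w' i) m))"
proof -
  interpret complex_space s
    using l by (intro complex_space.intro) (simp add: lie_module_def)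
  show ?thesis
    using w by (simp add: casimir_eq env_action_cl[OF l] free_act_sum_left free_act_generator_mult[OF l])
qed

section \<open>Schur's lemma\<close>

context complex_space
begin

text \<open>The vector p(C) v, evaluated by Horner's scheme.\<close>

definition poly_op :: "('n \<Rightarrow> 'n) \<Rightarrow> complex poly \<Rightarrow> 'n \<Rightarrow> 'n" where
  "poly_op C p v = fold_coeffs (\<lambda>a x. scale a v + C x) p 0"

lemma poly_op_0 [simp]: "poly_op C 0 v = 0"
  by (simp add: poly_op_def)

context
  fixes C assumes C: "Vector_Spaces.linear scale scale C"
begin

interpretation C: Vector_Spaces.linear scale scale C by (rule C)

lemma poly_op_pCons [simp]: "poly_op C (pCons a p) v = scale a v + C (poly_op C p v)"
  by (cases "p = 0 \<and> a = 0") (auto simp: poly_op_def C.zero)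

lemma poly_op_add: "poly_op C (p + q) v = poly_op C p v + poly_op C q v"
  by (induction p q rule: poly_induct2) (simp_all add: C.add scale_left_distrib)

lemma poly_op_smult: "poly_op C (Polynomial.smult c p) v = scale c (poly_op C p v)"
  by (induction p) (simp_all add: C.scale scale_right_distrib)

lemma poly_op_sum: "poly_op C (sum f A) v = (\<Sum>i\<in>A. poly_op C (f i) v)"
  by (induction A rule: infinite_finite_induct) (simp_all add: poly_op_add)

lemma poly_op_monom: "poly_op C (monom c n) v = scale c ((C ^^ n) v)"
  by (induction n) (simp_all add: monom_0 monom_Suc C.zero C.scale)

text \<open>Split off a root, p = (X - a) q. Then q(C) v is annihilated by C - a: either it is the
  eigenvector, or q is an annihilating polynomial of smaller degree. A nonzero constant cannot
  annihilate \<open>v\<close>.\<close>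

lemma eigenvector_of_annihilator:
  assumes "p \<noteq> 0" "poly_op C p v = 0" "v \<noteq> 0"
  shows "\<exists>a u. u \<noteq> 0 \<and> C u = scale a u"
  using assms(1,2)
proof (induction "degree p" arbitrary: p rule: less_induct)
  case less
  show ?case
  proof (cases "degree p = 0")
    case True
    then obtain c where "p = [:c:]" by (rule degree_eq_zeroE)
    then show ?thesis using less.prems assms(3) by (simp add: C.zero)
  next
    case False
    then obtain a where "poly p a = 0"
      using fundamental_theorem_of_algebra[of p] by (auto simp: constant_degree)
    then obtain q where q: "p = [:- a, 1:] * q"
      by (auto simp: poly_eq_0_iff_dvd dvd_def)
    have "poly_op C p v = C (poly_op C q v) - scale a (poly_op C q v)"
    proof -
      have "p = pCons 0 q + Polynomial.smult (- a) q" by (simp add: q)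
      then have "poly_op C p v = poly_op C (pCons 0 q) v + poly_op C (Polynomial.smult (- a) q) v"
        by (simp only: poly_op_add)
      then show ?thesis by (simp only: poly_op_smult poly_op_pCons) simp
    qed
    then have eigen: "C (poly_op C q v) = scale a (poly_op C q v)"
      using less.prems by simp
    have "q \<noteq> 0" using less.prems q by auto
    then have "degree p = degree [:- a, 1:] + degree q"
      unfolding q by (intro degree_mult_eq) auto
    then have "degree q < degree p" by simp
    then show ?thesis
      using less.hyps[of q] \<open>q \<noteq> 0\<close> eigen by blast
  qed
qed

lemma eigenvector_exists:
  assumes F: "finite F" "span F = UNIV" and v: "(v :: 'n) \<noteq> 0"
  shows "\<exists>a u. u \<noteq> 0 \<and> C u = scale a u"
proof -
  define f where "f i = (C ^^ i) v" for i
  have "\<exists>p. p \<noteq> 0 \<and> poly_op C p v = 0"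
  \<comment> \<open>The index set has card F + 1 elements, too many for independence. Dependence
    concerns the set of values, so repeated powers are treated separately: there X^i - X^j
    annihilates \<open>v\<close>.\<close>
  proof (cases "inj_on f {..card F}")
    case True
    then have "card (f ` {..card F}) = Suc (card F)" by (simp add: card_image)
    then have "dependent (f ` {..card F})"
      using independent_span_bound[OF F(1), of "f ` {..card F}"] F(2) by auto
    then obtain g x where g: "x \<in> f ` {..card F}" "g x \<noteq> 0" "(\<Sum>x\<in>f ` {..card F}. scale (g x) x) = 0"
      using dependent_finite[of "f ` {..card F}"] by auto
    define p where "p = (\<Sum>i\<le>card F. monom (g (f i)) i)"
    have "coeff p i = g (f i)" if "i \<le> card F" for i
      using that by (simp add: p_def coeff_sum)
    then have "p \<noteq> 0" using g by force
    moreover have "poly_op C p v = 0"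
      using g(3) True by (simp add: p_def poly_op_sum poly_op_monom sum.reindex flip: f_def)
    ultimately show ?thesis by blast
  next
    case False
    then obtain i j where ij: "i \<noteq> j" "f i = f j" by (auto simp: inj_on_def)
    have "coeff (monom 1 i + monom (- 1) j) i = (1 :: complex)" using ij by simp
    then have "monom 1 i + monom (- 1 :: complex) j \<noteq> 0" by force
    moreover have "poly_op C (monom 1 i + monom (- 1) j) v = 0"
      using ij by (simp add: poly_op_add poly_op_monom f_def)
    ultimately show ?thesis by blast
  qed
  then show ?thesis using eigenvector_of_annihilator v by blast
qed

end
end

text \<open>The eigenspace of an eigenvalue of \<open>C\<close> is a nonzero submodule, hence
  everything.\<close>

lemma schur:
  fixes s :: "complex \<Rightarrow> 's \<Rightarrow> 's::ab_group_add"
  assumes simple: "simple_findim_lie_module br L s \<rho>" and C: "Vector_Spaces.linear s s C"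
    and commute: "\<And>x v. x \<in> L \<Longrightarrow> C (\<rho> x v) = \<rho> x (C v)"
  obtains c where "\<And>v. C v = s c v"
proof -
  have l: "lie_module br L s \<rho>" using simple by (simp add: simple_findim_lie_module_def)
  interpret complex_space s
    using l by (intro complex_space.intro) (simp add: lie_module_def)
  interpret C: Vector_Spaces.linear s s C by fact
  obtain F where "finite F" "span F = UNIV"
    using simple by (auto simp: simple_findim_lie_module_def)
  moreover obtain v :: 's where "v \<noteq> 0"
    using simple by (auto simp: simple_findim_lie_module_def)
  ultimately obtain c u where u: "u \<noteq> 0" "C u = s c u"
    using eigenvector_exists[OF C] by blast
  define W where "W = {v. C v = s c v}"
  have "subspace W"
    by (auto simp: W_def subspace_def C.add C.scale C.zero scale_right_distrib mult.commute)
  moreover have "\<rho> x ` W \<subseteq> W" if "x \<in> L" for x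
  proof -
    have "Vector_Spaces.linear s s (\<rho> x)"
      using l that by (simp add: lie_module_def)
    then have "\<rho> x (s c v) = s c (\<rho> x v)" for v
      by (simp add: Vector_Spaces.linear_iff)
    then show ?thesis using commute[OF that] by (auto simp: W_def)
  qed
  ultimately have "W = {0} \<or> W = UNIV"
    using simple by (auto simp: simple_findim_lie_module_def)
  then have "W = UNIV" using u by (auto simp: W_def)
  then show ?thesis using that by (auto simp: W_def)
qed

text \<open>Used for the whole complexification and for that of \<open>k0\<close>, so one proof
  covers both Casimir elements.\<close>

locale quadratic_subalgebra = enveloping_algebra br L + real_form B
  for br :: "'g::real_vector \<Rightarrow> 'g \<Rightarrow> 'g" and L and B :: "'g \<Rightarrow> 'g \<Rightarrow> real" +
  assumes nondegenerate: "x \<in> L \<Longrightarrow> (\<And>y. y \<in> L \<Longrightarrow> cform B x y = 0) \<Longrightarrow> x = 0"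
    and invariant: "x \<in> L \<Longrightarrow> y \<in> L \<Longrightarrow> z \<in> L \<Longrightarrow>
      cform B (cbracket br x y) z = - cform B y (cbracket br x z)"
begin

text \<open>Invariance of the Casimir tensor is applied directly to composites of operators, so that
  the operator commutes with \<open>L\<close> and Schur's lemma applies.\<close>

lemma casimir_acts_by_scalar:
  fixes s :: "complex \<Rightarrow> 's \<Rightarrow> 's::ab_group_add"
  assumes simple: "simple_findim_lie_module br L s \<rho>" and d: "dual_bases B L n w w'"
  shows "(\<Sum>i<n. \<rho> (w i) (\<rho> (w' i) v)) = s (acting_scalar s \<rho> (casimir br L n w w')) v"
proof -
  note w = dual_basesD[OF d]
  have l: "lie_module br L s \<rho>" using simple by (simp add: simple_findim_lie_module_def)
  note ld = l[unfolded lie_module_def]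
  interpret complex_space s
    using ld by (intro complex_space.intro) simp
  define C where "C v = (\<Sum>i<n. \<rho> (w i) (\<rho> (w' i) v))" for v
  have lin: "\<rho> x (u + v) = \<rho> x u + \<rho> x v" "\<rho> x (s c u) = s c (\<rho> x u)" if "x \<in> L" for x u v c
    using ld that by (auto simp: Vector_Spaces.linear_iff)
  have \<rho>_sum: "\<rho> x (sum f A) = (\<Sum>i\<in>A. \<rho> x (f i))" if "x \<in> L" for x f and A :: "nat set"
    using lin[OF that] lin(2)[OF that, of 0]
    by (induction A rule: infinite_finite_induct) simp_all
  have "Vector_Spaces.linear s s C"
    using vector_space_axioms w
    by (simp add: Vector_Spaces.linear_iff C_def lin sum.distrib scale_sum_right)
  moreover have "C (\<rho> x v) = \<rho> x (C v)" if x: "x \<in> L" for x v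
  proof -
    have "bilinear_map L s (\<lambda>a b. \<rho> a (\<rho> b v))"
      using ld by (auto simp: bilinear_map_def lin)
    then have "0 = (\<Sum>i<n. \<rho> (cbracket br x (w i)) (\<rho> (w' i) v) + \<rho> (w i) (\<rho> (cbracket br x (w' i)) v))"
      by (rule dual_sum_invariant[OF d complex_space_axioms _ nondegenerate, symmetric])
         (use x bracket_closed invariant in auto)
    \<comment> \<open>Writing both brackets as commutators of operators, the terms with
      \<open>x\<close> between \<open>w i\<close> and \<open>w' i\<close> cancel.\<close>
    also have "\<dots> = (\<Sum>i<n. \<rho> x (\<rho> (w i) (\<rho> (w' i) v)) - \<rho> (w i) (\<rho> (w' i) (\<rho> x v)))"
    proof (intro sum.cong refl)
      fix i assume "i \<in> {..<n}"
      then have i: "w i \<in> L" "w' i \<in> L" using w by auto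
      have "\<rho> (w i) (a - b) = \<rho> (w i) a - \<rho> (w i) b" for a b
        using lin(1)[OF i(1), of "a - b" b] by (simp add: algebra_simps)
      then show "\<rho> (cbracket br x (w i)) (\<rho> (w' i) v) + \<rho> (w i) (\<rho> (cbracket br x (w' i)) v) =
          \<rho> x (\<rho> (w i) (\<rho> (w' i) v)) - \<rho> (w i) (\<rho> (w' i) (\<rho> x v))"
        using ld x i by simp
    qed
    also have "\<dots> = \<rho> x (C v) - C (\<rho> x v)"
      by (simp add: C_def \<rho>_sum x sum_subtractf)
    finally show ?thesis by simp
  qed
  ultimately obtain c where c: "\<And>v. C v = s c v"
    using schur[OF simple] by blast
  have action: "env_action s \<rho> (casimir br L n w w') v = s c v" for v
    using w by (simp add: env_action_casimir[OF l] flip: c C_def)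
  \<comment> \<open>A nonzero vector makes the scalar unique, as the definite description in
    \<open>acting_scalar\<close> requires.\<close>
  obtain u :: 's where "u \<noteq> 0"
    using simple by (auto simp: simple_findim_lie_module_def)
  then have "acting_scalar s \<rho> (casimir br L n w w') = c"
    unfolding acting_scalar_def action by (intro the_equality) auto
  then show ?thesis using c by (simp flip: C_def)
qed

text \<open>The vectors on which the Casimir operator has the right eigenvalue form a subspace, and
  it contains the image of every homomorphism from the simple module.\<close>

lemma casimir_isotypic:
  assumes simple: "simple_findim_lie_module br L sS \<sigma>" and d: "dual_bases B L n w w'"
    and l: "lie_module br L sM \<pi>" and m: "m \<in> isotypic_component L sS \<sigma> sM \<pi>"
  shows "(\<Sum>i<n. \<pi> (w i) (\<pi> (w' i) m)) = sM (acting_scalar sS \<sigma> (casimir br L n w w')) m"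
proof -
  note w = dual_basesD[OF d] and ld = l[unfolded lie_module_def]
  interpret complex_space sM
    using ld by (intro complex_space.intro) simp
  define c where "c = acting_scalar sS \<sigma> (casimir br L n w w')"
  define W where "W = {m. (\<Sum>i<n. \<pi> (w i) (\<pi> (w' i) m)) = sM c m}"
  have lin: "\<pi> x (u + v) = \<pi> x u + \<pi> x v" "\<pi> x (sM c u) = sM c (\<pi> x u)" if "x \<in> L" for x u v c
    using ld that by (auto simp: Vector_Spaces.linear_iff)
  have zero: "\<pi> x 0 = 0" if "x \<in> L" for x
    using lin(2)[OF that, of 0] by simp
  have "subspace W"
    using w by (auto simp: W_def subspace_def lin zero sum.distrib scale_right_distrib mult.commute
        simp flip: scale_sum_right)
  moreover have "f v \<in> W"
    if "Vector_Spaces.linear sS sM f" "\<forall>x\<in>L. \<forall>v. f (\<sigma> x v) = \<pi> x (f v)" for f v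
  proof -
    interpret f: Vector_Spaces.linear sS sM f by fact
    have "(\<Sum>i<n. \<pi> (w i) (\<pi> (w' i) (f v))) = f (\<Sum>i<n. \<sigma> (w i) (\<sigma> (w' i) v))"
      using w that(2) by (simp add: f.sum)
    then show ?thesis
      by (simp add: W_def c_def casimir_acts_by_scalar[OF simple d] f.scale)
  qed
  ultimately have "isotypic_component L sS \<sigma> sM \<pi> \<subseteq> W"
    unfolding isotypic_component_def by (intro span_minimal) auto
  then show ?thesis using m by (auto simp: W_def c_def)
qed

end

lemma casimir_in_env_center:
  assumes "quadratic_subalgebra br UNIV B" and d: "dual_bases B UNIV n w w'"
  shows "casimir br UNIV n w w' \<in> env_center br"
proof -
  interpret quadratic_subalgebra br UNIV B by fact
  have F: "a \<in> carrier F" for a by (simp add: carrier_free_algebra)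
  have "a * (\<Sum>i<n. generator (w i) * generator (w' i)) - (\<Sum>i<n. generator (w i) * generator (w' i)) * a \<in> E.J" for a
    by (rule casimir_commutes[OF real_form_axioms d nondegenerate invariant F]) auto
  then show ?thesis
    by (auto simp: env_center_def env_eq E.carrier_quotient casimir_eq F E.mult_cl E.cl_eq_iff)
qed

section \<open>Sums of simple tensors\<close>

lemma (in quotient_space) tensor_factor_closed:
  "X \<in> carrier Q \<Longrightarrow> Y \<in> carrier Q \<Longrightarrow> X \<oplus>\<^bsub>Q\<^esub> Y \<in> carrier Q"
  "X \<in> carrier Q \<Longrightarrow> c \<odot>\<^bsub>Q\<^esub> X \<in> carrier Q"
  using vs.subspace_add[OF subspace_carrier] vs.subspace_scale[OF subspace_carrier]
  by (auto simp: carrier_quotient add_cl smult_cl)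

context tensor_product
begin

lemma finsum_simple_tensor:
  assumes "finite S" "\<And>i. i \<in> S \<Longrightarrow> a i \<in> carrier V" "\<And>i. i \<in> S \<Longrightarrow> b i \<in> carrier W"
  shows "finsum (tensor V W) (\<lambda>i. simple_tensor V W (a i) (b i)) S =
    tensor_class V W (\<Sum>i\<in>S. Poly_Mapping.single (a i, b i) 1)"
  unfolding tensor_eq simple_tensor_eq tensor_class_eq
  by (rule finsum_cl) (use assms in \<open>auto intro: single_F\<close>)

lemma sum_single_F:
  assumes "\<And>i. i \<in> S \<Longrightarrow> a i \<in> carrier V" "\<And>i. i \<in> S \<Longrightarrow> b i \<in> carrier W"
  shows "(\<Sum>i\<in>S. Poly_Mapping.single (a i, b i) 1) \<in> carrier F"
  using assms by (intro pm.subspace_sum[OF subspace_F] single_F) auto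

lemma tensor_action_sum:
  fixes U :: "(complex, 'u) Module.module" and X :: "(complex, 'w) Module.module"
  assumes U: "tensor_product U X"
    and actU: "bilinear_action U V actU" and actW: "bilinear_action X W actW"
    and u: "\<And>i. i \<in> S \<Longrightarrow> u i \<in> carrier U" and x: "\<And>i. i \<in> S \<Longrightarrow> x i \<in> carrier X"
    and a: "a \<in> carrier V" and b: "b \<in> carrier W"
  shows "tensor_action V W actU actW (tensor_class U X (\<Sum>i\<in>S. Poly_Mapping.single (u i, x i) 1))
      (simple_tensor V W a b) =
    tensor_class V W (\<Sum>i\<in>S. Poly_Mapping.single (actU (u i) a, actW (x i) b) 1)"
proof -
  interpret T: tensor_product U X by fact
  show ?thesis
    unfolding simple_tensor_def
    by (subst tensor_action_cl[OF U actU actW T.sum_single_F single_F])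
       (use u x a b in \<open>auto simp: pm.lin_sum\<close>)
qed

lemma tensor_form_sum:
  assumes h: "sesquilinear_on V h" and h': "sesquilinear_on W h'"
    and a: "\<And>i. i \<in> S \<Longrightarrow> a i \<in> carrier V" and b: "\<And>i. i \<in> S \<Longrightarrow> b i \<in> carrier W"
  shows "tensor_form h h' (tensor_class V W (\<Sum>i\<in>S. Poly_Mapping.single (a i, b i) 1))
      (tensor_class V W (\<Sum>i\<in>S. Poly_Mapping.single (a i, b i) 1)) =
    (\<Sum>i\<in>S. \<Sum>j\<in>S. h (a i) (a j) * h' (b i) (b j))"
proof -
  interpret c: complex_space "(*) :: complex \<Rightarrow> _"
    by unfold_locales (auto simp: algebra_simps)
  interpret cc: complex_space "\<lambda>c. (*) (cnj c) :: complex \<Rightarrow> _"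
    by unfold_locales (auto simp: algebra_simps)
  show ?thesis
    by (subst tensor_form_cl[OF h h' sum_single_F sum_single_F])
       (use a b in \<open>auto simp: c.lin_sum cc.lin_sum c.lin_single cc.lin_single intro: sum.swap\<close>)
qed

end

section \<open>Hermitian forms and the star operation on generators\<close>

lemma sesquilinear_on_hermitian:
  assumes "nondegenerate_hermitian s h"
  shows "sesquilinear_on (vspace UNIV s) h"
proof -
  note H = assms[unfolded nondegenerate_hermitian_def]
  have h: "h m (a + b) = h m a + h m b" "h m (s c a) = c * h m a" "h b a = cnj (h a b)" for m a b c
    by (rule H[THEN conjunct1, rule_format], rule H[THEN conjunct2, THEN conjunct1, rule_format],
        rule H[THEN conjunct2, THEN conjunct2, THEN conjunct1, rule_format])
  have "h (a + a') b = h a b + h a' b" "h (s c a) b = cnj c * h a b" for a a' b c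
    by (metis h(1,3) complex_cnj_add, metis h(2,3) complex_cnj_mult)
  then show ?thesis by (simp add: sesquilinear_on_def h(1,2))
qed

text \<open>Invariance is specialised to the class of a single letter. The work lies in showing that
  the star of this coset is the coset of the starred letter, that is, that the star respects the
  relations of U(g).\<close>

lemma star_invariant_generator:
  assumes br: "bilinear br" "\<And>x. br x x = 0"
    and l: "lie_module br UNIV s \<pi>" and inv: "star_invariant br s \<pi> h"
  shows "h (\<pi> x m) m' = h m (\<pi> (- cconj x) m')"
proof -
  have alt: "br u v = - br v u" for u v
    using br(2)[of "u + v"] unfolding bilinear_ladd[OF br(1)] bilinear_radd[OF br(1)]
    by (simp add: br(2) eq_neg_iff_add_eq_0 add.commute)
  interpret enveloping_algebra br UNIV by unfold_locales auto
  define st where "st = conj_extend (\<lambda>w :: ('a \<times> 'a) free_monoid. Mon (rev (map (\<lambda>x. - cconj x) (letters w))))"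
  have st_gen: "st (generator v) = generator (- cconj v)" for v
    by (simp add: st_def generator_def)
  have st_mult: "st (a * b) = st b * st a" for a b
    unfolding st_def by (rule conj_extend_antimult) (simp add: plus_free_monoid_def)
  have cconj_uminus: "cconj (- v) = - cconj v" for v :: "'a \<times> 'a"
    by (simp add: cconj_def case_prod_unfold)
  \<comment> \<open>The two minus signs cancel; the remaining one comes from reversing the order of
    the arguments, as the anti-involution does.\<close>
  have bracket: "cbracket br (- cconj v) (- cconj u) = - cconj (cbracket br u v)" for u v
  proof -
    obtain a b c d where "u = (a, b)" "v = (c, d)" by (cases u; cases v)
    then show ?thesis
      using alt[of c a] alt[of d b] alt[of c b] alt[of d a]
      by (simp add: cbracket_def cconj_def bilinear_lneg[OF br(1)] bilinear_rneg[OF br(1)])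
  qed
  have "env_star (cl (generator x)) = cl (st (generator x))"
    unfolding env_star_def st_def
  proof (rule E.conj_extend_image_cl, fold st_def)
    show "st ` linear_relations (vspace UNIV cscale) \<subseteq> E.J"
    proof (rule image_subsetI)
      fix r assume "r \<in> linear_relations (vspace (UNIV :: ('a \<times> 'a) set) cscale)"
      then consider v w where "r = generator (v + w) - generator v - generator w"
        | c v where "r = generator (cscale c v) - pm_scale c (generator v)"
        unfolding linear_relations_def by auto
      then show "st r \<in> E.J"
      proof cases
        case 1
        have "st r = generator (- cconj v + - cconj w) - generator (- cconj v) - generator (- cconj w)"
          unfolding 1 by (simp add: st_def) (simp add: st_gen flip: st_def)
        then show ?thesis by (simp only: E.generator_add_in_J UNIV_I)
      next
        case 2
        have "st r = generator (cscale (cnj c) (- cconj v)) - pm_scale (cnj c) (generator (- cconj v))"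
          unfolding 2 by (simp add: st_def) (simp add: st_gen flip: st_def)
        then show ?thesis by (simp only: E.generator_scale_in_J UNIV_I)
      qed
    qed
    show "st ` env_relations br UNIV \<subseteq> E.J"
    proof (rule image_subsetI)
      fix r assume "r \<in> env_relations br UNIV"
      then obtain u v where r: "r = generator u * generator v - generator v * generator u - generator (cbracket br u v)"
        unfolding env_relations_def by blast
      have "st r = st (generator u * generator v) - st (generator v * generator u) - st (generator (cbracket br u v))"
        by (simp add: r st_def)
      also have "\<dots> = generator (- cconj v) * generator (- cconj u) - generator (- cconj u) * generator (- cconj v) -
          generator (cbracket br (- cconj v) (- cconj u))"
        by (simp add: st_mult st_gen bracket)
      finally show "st r \<in> E.J" by (simp only: bracket_relation_in_J UNIV_I)
    qed
  qed (auto simp: plus_free_monoid_def rev_map comp_def cconj_uminus)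
  moreover have "h (env_action s \<pi> (cl (generator x)) m) m' =
      h m (env_action s \<pi> (env_star (cl (generator x))) m')"
    using inv by (simp add: star_invariant_def env_eq E.carrier_quotient)
  ultimately show ?thesis
  proof -
    interpret complex_space s
      using l by (intro complex_space.intro) (simp add: lie_module_def)
    show ?thesis
      using \<open>h (env_action s \<pi> _ m) m' = _\<close> \<open>env_star _ = _\<close> by (simp add: env_action_cl[OF l] st_gen)
  qed
qed

section \<open>The complexified graded Lie algebra\<close>

context graded_quadratic_lie_algebra
begin

sublocale real_form B
  by unfold_locales (simp_all add: form_bilinear form_symmetric)

lemma subspace_Times: "subspace V \<Longrightarrow> cs.subspace (V \<times> V)"
  by (auto simp: cs.subspace_def cscale_Pair zero_prod_def subspace_0
      intro!: subspace_add subspace_diff subspace_scale)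

lemma cform_invariant: "cform B (cbracket br x y) z = - cform B y (cbracket br x z)"
proof -
  have "B (br a b) c = - B b (br a c)" for a b c
    using form_invariant[of a b c] by simp
  then show ?thesis
    by (cases x; cases y; cases z)
       (simp add: cform_def cbracket_def complex_eq_iff bilinear_ladd[OF form_bilinear]
         bilinear_radd[OF form_bilinear] bilinear_lsub[OF form_bilinear] bilinear_rsub[OF form_bilinear])
qed

lemma cform_real: "cform B (a, b) (c, 0) = Complex (B a c) (B b c)"
  by (simp add: cform_def bilinear_rzero[OF form_bilinear])

sublocale full: quadratic_subalgebra br UNIV B
proof
  fix x :: "'g \<times> 'g" assume *: "\<And>y. y \<in> UNIV \<Longrightarrow> cform B x y = 0"
  obtain a b where x: "x = (a, b)" by (cases x)
  \<comment> \<open>Testing against real vectors separates the real and imaginary parts of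
    x.\<close>
  have "B a c = 0 \<and> B b c = 0" for c
    using *[of "(c, 0)"] by (simp add: x cform_real complex_eq_iff)
  then have "a = 0" "b = 0" using form_nondegenerate by blast+
  then show "x = 0" by (simp add: x zero_prod_def)
qed (auto simp: cform_invariant)

lemma cform_orthogonal: "x \<in> k0 \<times> k0 \<Longrightarrow> y \<in> p0 \<times> p0 \<Longrightarrow> cform B x y = 0"
  by (auto simp: cform_def form_orthogonal complex_eq_iff)

lemma decomposition: "\<exists>a\<in>k0 \<times> k0. \<exists>b\<in>p0 \<times> p0. x = a + b"
proof -
  obtain u v where x: "x = (u, v)" by (cases x)
  obtain a b a' b' where "a \<in> k0" "b \<in> p0" "u = a + b" "a' \<in> k0" "b' \<in> p0" "v = a' + b'"
    using direct_sum(2)[of u] direct_sum(2)[of v] by blast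
  then show ?thesis by (auto simp: x intro!: bexI[of _ "(a, a')"] bexI[of _ "(b, b')"])
qed

sublocale even: quadratic_subalgebra br "k0 \<times> k0" B
proof
  show "cs.subspace (k0 \<times> k0)" by (rule subspace_Times[OF subspaces(1)])
  show "cbracket br x y \<in> k0 \<times> k0" if "x \<in> k0 \<times> k0" "y \<in> k0 \<times> k0" for x y
    using that subspaces(1) by (auto simp: cbracket_def grading_kk intro!: subspace_add subspace_diff)
  fix x assume x: "x \<in> k0 \<times> k0" and *: "\<And>y. y \<in> k0 \<times> k0 \<Longrightarrow> cform B x y = 0"
  \<comment> \<open>An element of k orthogonal to k is also orthogonal to p, so nondegeneracy on k
    is inherited from g.\<close>
  have "cform B x y = 0" for y
  proof -
    obtain a b where "a \<in> k0 \<times> k0" "b \<in> p0 \<times> p0" "y = a + b" using decomposition by blast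
    then show ?thesis using * cform_orthogonal[OF x] by (simp add: cform_simps)
  qed
  then show "x = 0" by (intro full.nondegenerate) auto
qed (simp add: cform_invariant)

sublocale odd: symmetric_algebra B "p0 \<times> p0"
proof
  show "cs.subspace (p0 \<times> p0)" by (rule subspace_Times[OF subspaces(2)])
  show "cconj v \<in> p0 \<times> p0" if "v \<in> p0 \<times> p0" for v
    using that subspaces(2) by (auto simp: cconj_def intro!: subspace_neg)
qed

end

text \<open>Both functionals are linear on \<open>p\<close>, agree on the basis \<open>z\<close> and
  vanish off \<open>p\<close>. This identifies the derivations occurring in \<open>Dminus\<close>
  with those to which the commutator identity applies.\<close>

lemma (in symmetric_algebra) dual_basis_eq_\<beta>:
  assumes d: "dual_bases B p n z z'" and \<alpha>: "\<alpha> \<in> dual_space p"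
    and z: "\<And>j. j < n \<Longrightarrow> \<alpha> (z j) = (if i = j then 1 else 0)" and i: "i < n"
  shows "\<alpha> = \<beta> (z' i)"
proof -
  note zp = dual_basesD[OF d]
  have zero: "\<alpha> 0 = 0" if "\<alpha> \<in> dual_space p" for \<alpha>
    using dual_spaceD(2)[OF that p_0, of 0] by simp
  have "cs.subspace {x \<in> p. \<alpha> x = \<beta> (z' i) x}"
    using dual_spaceD[OF \<alpha>] dual_spaceD[OF \<beta>_dual_space] zero[OF \<alpha>] zero[OF \<beta>_dual_space]
    by (simp add: cs.subspace_def p_0 p_add p_scale)
  moreover have "z ` {..<n} \<subseteq> {x \<in> p. \<alpha> x = \<beta> (z' i) x}"
    using zp z i by (auto simp: \<beta>_def cform_symmetric[of "z' i"])
  ultimately have "cs.span (z ` {..<n}) \<subseteq> {x \<in> p. \<alpha> x = \<beta> (z' i) x}"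
    by (rule cs.span_minimal[rotated])
  then have "\<alpha> x = \<beta> (z' i) x" if "x \<in> p" for x
    using d that by (auto simp: dual_bases_def is_basis_def)
  moreover have "\<alpha> x = \<beta> (z' i) x" if "x \<notin> p" for x
    using \<alpha> that by (cases x) (simp add: dual_space_def \<beta>_def)
  ultimately show ?thesis by blast
qed

lemma Dplus_Dminus_difference:
  fixes br :: "'g::real_normed_vector \<Rightarrow> 'g \<Rightarrow> 'g"
    and sM :: "complex \<Rightarrow> 'm \<Rightarrow> 'm::ab_group_add"
    and sS :: "complex \<Rightarrow> 's \<Rightarrow> 's::ab_group_add"
  assumes graded: "graded_quadratic_lie_algebra br B k0 p0"
    and module: "lie_module br UNIV sM \<pi>"
    and hermitian: "nondegenerate_hermitian sM hM" and star: "star_invariant br sM \<pi> hM"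
    and character: "infinitesimal_character br sM \<pi> chi"
    and simple: "simple_findim_lie_module br (k0 \<times> k0) sS \<sigma>"
    and dg: "dual_bases B UNIV ng w w'" and dk: "dual_bases B (k0 \<times> k0) nk y y'"
    and dp: "dual_bases B (p0 \<times> p0) np z z'"
    and zs: "\<And>i. i < np \<Longrightarrow> zs i \<in> dual_space (p0 \<times> p0)"
      "\<And>i j. i < np \<Longrightarrow> j < np \<Longrightarrow> zs i (z j) = (if i = j then 1 else 0)"
    and m: "m \<in> isotypic_component (k0 \<times> k0) sS \<sigma> sM \<pi>" and q: "q \<in> sym_real (p0 \<times> p0)"
  defines "p \<equiv> p0 \<times> p0" and "M \<equiv> vspace (UNIV :: 'm set) sM"
  defines "act \<equiv> tensor_action M (sym_alg p) (env_action sM \<pi>) (weyl_action p)"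
    and "form \<equiv> tensor_form hM (sym_pairing B p)" and "x \<equiv> simple_tensor M (sym_alg p) m q"
  shows "form (act (Dplus br p np z z') x) (act (Dplus br p np z z') x) -
      form (act (Dminus br p np z zs) x) (act (Dminus br p np z zs) x) =
    (- chi (casimir br UNIV ng w w') + acting_scalar sS \<sigma> (casimir br (k0 \<times> k0) nk y y')) * form x x"
proof -
  interpret graded_quadratic_lie_algebra br B k0 p0 by (rule graded)
  interpret sM: complex_space sM
    using module by (intro complex_space.intro) (simp add: lie_module_def)
  note \<pi> = module[unfolded lie_module_def, THEN conjunct2]
  have linear_\<pi>: "Vector_Spaces.linear sM sM (\<pi> v)" for v
    by (rule \<pi>[THEN conjunct1, rule_format, OF UNIV_I])
  define P where "P = sym_alg p"
  define pair where "pair = sym_pairing B p"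
  have qP: "q \<in> carrier P"
    using q by (simp add: sym_real_def P_def p_def)
  note zp = dual_basesD[OF dp, folded p_def]
  have P_closed: "X \<in> carrier P \<Longrightarrow> Y \<in> carrier P \<Longrightarrow> X \<oplus>\<^bsub>P\<^esub> Y \<in> carrier P"
      "X \<in> carrier P \<Longrightarrow> c \<odot>\<^bsub>P\<^esub> X \<in> carrier P" for X Y c
    using odd.S.tensor_factor_closed unfolding P_def p_def odd.sym_alg_eq by blast+
  have MP: "tensor_product M P"
    by unfold_locales (simp_all add: M_def P_closed)
  then interpret MP: tensor_product M P .
  have UW: "tensor_product (env br UNIV) (weyl p)"
    unfolding full.env_eq p_def odd.weyl_eq
    by unfold_locales (fact full.E.tensor_factor_closed odd.W.tensor_factor_closed)+
  then interpret UW: tensor_product "env br UNIV" "weyl p" .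
  have actM: "bilinear_action (env br UNIV) M (env_action sM \<pi>)"
    unfolding full.env_eq M_def
    by (rule full.E.bilinear_action_vspace[OF sM.complex_space_axioms full.env_action_cl[OF module]])
       (rule linear_\<pi>)
  have actP: "bilinear_action (weyl p) P (weyl_action p)"
    unfolding P_def p_def by (rule odd.bilinear_weyl_action)
  have hM: "sesquilinear_on M hM"
    unfolding M_def by (rule sesquilinear_on_hermitian[OF hermitian])
  have pair: "sesquilinear_on P pair"
    unfolding P_def pair_def p_def by (rule odd.sesquilinear_sym_pairing)
  have env_gen: "env_gen br UNIV v \<in> carrier (env br UNIV)" "env_action sM \<pi> (env_gen br UNIV v) m = \<pi> v m" for v
    by (simp_all add: full.env_eq full.env_gen_eq full.E.carrier_quotient full.env_action_cl[OF module])
  have weyl_gen: "weyl_gen p (v, \<alpha>) \<in> carrier (weyl p)" if "v \<in> p" "\<alpha> \<in> dual_space p" for v \<alpha>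
    using that unfolding p_def odd.weyl_eq odd.weyl_gen_eq odd.W.carrier_quotient by auto
  have zero: "0 \<in> dual_space p" "0 \<in> p"
    using odd.p_0 by (simp_all add: dual_space_def p_def)
  \<comment> \<open>One expansion for both operators: they differ only in the Weyl letter
    \<open>g i\<close>, which is \<open>(z' i, 0)\<close> for \<open>Dplus\<close> and
    \<open>(0, zs i)\<close> for \<open>Dminus\<close>.\<close>
  have act_sum: "form (act D x) (act D x) =
      (\<Sum>i<np. \<Sum>j<np. hM (\<pi> (z i) m) (\<pi> (z j) m) *
        pair (weyl_action p (weyl_gen p (g i)) q) (weyl_action p (weyl_gen p (g j)) q))"
    if g: "\<And>i. i < np \<Longrightarrow> g i \<in> p \<times> dual_space p"
      and D: "D = (\<Oplus>\<^bsub>tensor (env br UNIV) (weyl p)\<^esub>i\<in>{..<np}.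
        simple_tensor (env br UNIV) (weyl p) (env_gen br UNIV (z i)) (weyl_gen p (g i)))" for g D
  proof -
    have gW: "weyl_gen p (g i) \<in> carrier (weyl p)" if "i \<in> {..<np}" for i
      using g[of i] that weyl_gen[of "fst (g i)" "snd (g i)"] by (auto simp: mem_Times_iff)
    have "act D x = tensor_class M P
        (\<Sum>i<np. Poly_Mapping.single (\<pi> (z i) m, weyl_action p (weyl_gen p (g i)) q) 1)"
      unfolding act_def D x_def P_def[symmetric]
      by (subst UW.finsum_simple_tensor, simp, rule env_gen, erule gW,
          subst MP.tensor_action_sum[OF UW actM actP])
         (use gW qP env_gen in \<open>auto simp: M_def\<close>)
    moreover have "weyl_action p (weyl_gen p (g i)) q \<in> carrier P" if "i \<in> {..<np}" for i
      using actP gW[OF that] qP by (simp add: bilinear_action_def)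
    ultimately show ?thesis
      unfolding form_def pair_def[symmetric]
      by (simp only:) (rule MP.tensor_form_sum[OF hM pair], simp_all add: M_def)
  qed
  have plus: "form (act (Dplus br p np z z') x) (act (Dplus br p np z z') x) =
      (\<Sum>i<np. \<Sum>j<np. hM (\<pi> (z i) m) (\<pi> (z j) m) *
        pair (sym_gen p (z' i) \<otimes>\<^bsub>P\<^esub> q) (sym_gen p (z' j) \<otimes>\<^bsub>P\<^esub> q))"
    using zp zero odd.weyl_action_gen(1)[folded p_def P_def, OF qP]
    by (subst act_sum[of "\<lambda>i. (z' i, 0)", OF _ Dplus_def]) (auto intro!: sum.cong)
  have minus: "form (act (Dminus br p np z zs) x) (act (Dminus br p np z zs) x) =
      (\<Sum>i<np. \<Sum>j<np. hM (\<pi> (z i) m) (\<pi> (z j) m) *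
        pair (sym_deriv p (odd.\<beta> (z' i)) q) (sym_deriv p (odd.\<beta> (z' j)) q))"
    using zs(1) zero odd.weyl_action_gen(2)[folded p_def P_def, OF qP] odd.dual_basis_eq_\<beta>[OF dp zs(1) zs(2)]
    by (subst act_sum[of "\<lambda>i. (0, zs i)", OF _ Dminus_def]) (auto intro!: sum.cong simp: p_def)
  have h: "hM u (a + b) = hM u a + hM u b" "hM u (sM c a) = c * hM u a" for u a b c
    using hM by (simp_all add: sesquilinear_on_def M_def)
  have h_diff: "hM u (a - b) = hM u a - hM u b" for u a b
    using h(1)[of u "a - b" b] by simp
  have h_sum: "hM u (sum f A) = (\<Sum>i\<in>A. hM u (f i))" for u f and A :: "nat set"
    using h(2)[of u 0 0] by (induction A rule: infinite_finite_induct) (simp_all add: h)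
  have \<pi>_linear: "\<pi> (u + v) b = \<pi> u b + \<pi> v b" "\<pi> (cscale c u) b = sM c (\<pi> u b)"
      "\<pi> u (b + b') = \<pi> u b + \<pi> u b'" "\<pi> u (sM c b) = sM c (\<pi> u b)" for u v b b' c
    by (rule \<pi>[THEN conjunct2, THEN conjunct1, rule_format, OF UNIV_I UNIV_I],
        rule \<pi>[THEN conjunct2, THEN conjunct2, THEN conjunct1, rule_format, OF UNIV_I],
        use linear_\<pi>[of u] in \<open>simp_all add: Vector_Spaces.linear_iff\<close>)
  have \<pi>_uminus: "\<pi> (- u) b = - \<pi> u b" for u b
    using \<pi>_linear(2)[of "-1" u b] by (simp add: cs.scale_minus_left)
  have \<pi>_sum: "\<pi> (\<Sum>i\<in>A. f i) b = (\<Sum>i\<in>A. \<pi> (f i) b)" for f b and A :: "nat set"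
    using \<pi>_linear(2)[of 0 0 b] by (induction A rule: infinite_finite_induct) (simp_all add: \<pi>_linear)
  have adjoint: "hM (\<pi> u a) b = - hM a (\<pi> (cconj u) b)" for u a b
    using star_invariant_generator[OF bracket_bilinear bracket_alternating module star, of u a b]
      h_diff[of a 0 "\<pi> (cconj u) b"] h_diff[of a 0 0]
    by (simp add: \<pi>_uminus)
  \<comment> \<open>The conjugate of the expansion of \<open>cconj v\<close> in the basis
    \<open>z\<close>.\<close>
  have conj_expansion: "(\<Sum>i<np. cscale (cform B v (cconj (z' i))) (cconj (z i))) = v" if "v \<in> p" for v
  proof -
    have "cconj (sum f A) = (\<Sum>i\<in>A. cconj (f i))" for f :: "nat \<Rightarrow> 'g \<times> 'g" and A
      by (induction A rule: infinite_finite_induct) simp_all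
    then have "(\<Sum>i<np. cscale (cform B v (cconj (z' i))) (cconj (z i))) =
        cconj (\<Sum>i<np. cscale (cform B (cconj v) (z' i)) (z i))"
      by (simp flip: cform_cconj)
    also have "\<dots> = cconj (cconj v)"
      using basis_expansion[OF dp, of "cconj v"] odd.cconj_p[of v] that by (simp add: p_def)
    finally show ?thesis by simp
  qed
  have bilinear: "bilinear_map V sM (\<lambda>u v. \<pi> u (\<pi> v m))" for V
    by (simp add: bilinear_map_def \<pi>_linear)
  have casimirs: "(\<Sum>i<ng. \<pi> (w i) (\<pi> (w' i) m)) = sM (chi (casimir br UNIV ng w w')) m"
    "(\<Sum>i<nk. \<pi> (y i) (\<pi> (y' i) m)) = sM (acting_scalar sS \<sigma> (casimir br (k0 \<times> k0) nk y y')) m"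
  proof -
    show "(\<Sum>i<ng. \<pi> (w i) (\<pi> (w' i) m)) = sM (chi (casimir br UNIV ng w w')) m"
      using character casimir_in_env_center[OF full.quadratic_subalgebra_axioms dg]
        full.env_action_casimir[OF module, of ng w w' m]
      by (simp add: infinitesimal_character_def)
    have "lie_module br (k0 \<times> k0) sM \<pi>" using module by (simp add: lie_module_def)
    then show "(\<Sum>i<nk. \<pi> (y i) (\<pi> (y' i) m)) = sM (acting_scalar sS \<sigma> (casimir br (k0 \<times> k0) nk y y')) m"
      by (rule even.casimir_isotypic[OF simple dk _ m])
  qed
  \<comment> \<open>Moving the first operator across the form will leave \<open>z'\<close> on the
    left, while the Casimir convention has it on the right.\<close>
  have "(\<Sum>j<np. \<pi> (z' j) (\<pi> (z j) m)) = (\<Sum>j<np. \<pi> (z j) (\<pi> (z' j) m))"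
    by (rule dual_sum_flip[OF dp sM.complex_space_axioms bilinear, symmetric])
  also have "\<dots> = sM (chi (casimir br UNIV ng w w')) m -
      sM (acting_scalar sS \<sigma> (casimir br (k0 \<times> k0) nk y y')) m"
    using dual_sum_split[OF dg dk dp sM.complex_space_axioms bilinear _ decomposition cform_orthogonal]
      full.nondegenerate by (simp add: casimirs)
  finally have casimir_p: "(\<Sum>j<np. \<pi> (z' j) (\<pi> (z j) m)) = \<dots>" .
  have "form (act (Dplus br p np z z') x) (act (Dplus br p np z z') x) -
      form (act (Dminus br p np z zs) x) (act (Dminus br p np z zs) x) =
    (\<Sum>i<np. \<Sum>j<np. hM (\<pi> (z i) m) (\<pi> (z j) m) * (cform B (z' j) (cconj (z' i)) * pair q q))"
    unfolding plus minus sum_subtractf[symmetric] right_diff_distrib[symmetric]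
    using odd.sym_pairing_commutator[OF q] zp
    by (intro sum.cong refl arg_cong[where f = "\<lambda>c. _ * c"]) (simp add: P_def p_def pair_def)
  \<comment> \<open>With j outermost, \<open>adjoint\<close> moves \<open>z i\<close> to the second
    argument as its conjugate, and linearity there absorbs the scalars into the sum over i that
    \<open>conj_expansion\<close> evaluates.\<close>
  also have "\<dots> = (\<Sum>j<np. - hM m (\<pi> (\<Sum>i<np. cscale (cform B (z' j) (cconj (z' i))) (cconj (z i))) (\<pi> (z j) m))) * pair q q"
    by (subst sum.swap)
       (simp add: adjoint \<pi>_sum \<pi>_linear h_sum h sum_distrib_left sum_distrib_right sum_negf mult_ac)
  also have "\<dots> = - hM m (\<Sum>j<np. \<pi> (z' j) (\<pi> (z j) m)) * pair q q"
    using zp by (simp add: conj_expansion h_sum sum_negf)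
  also have "\<dots> = (- chi (casimir br UNIV ng w w') + acting_scalar sS \<sigma> (casimir br (k0 \<times> k0) nk y y')) *
      (hM m m * pair q q)"
    unfolding casimir_p h_diff h by (simp add: algebra_simps)
  \<comment> \<open>A simple tensor is read as a sum over a one-element index set.\<close>
  also have "hM m m * pair q q = form x x"
    using MP.tensor_form_sum[OF hM pair, of "{()}" "\<lambda>_. m" "\<lambda>_. q"] qP
    by (simp add: form_def x_def pair_def P_def M_def simple_tensor_def)
  finally show ?thesis .
qed

theorem corollary3p14:
  fixes br :: "'g::real_normed_vector \<Rightarrow> 'g \<Rightarrow> 'g"
    and B :: "'g \<Rightarrow> 'g \<Rightarrow> real"
    and k0 p0 :: "'g set"
    and K :: "'k::{t2_space, second_countable_topology} monoid"
    and atlas :: "('k, 'g) chart set"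
    and U :: "'k set" and \<phi> :: "'k \<Rightarrow> 'g" and \<psi> :: "'g \<Rightarrow> 'k"
    and Ad :: "'k \<Rightarrow> 'g \<times> 'g \<Rightarrow> 'g \<times> 'g"
    and sM :: "complex \<Rightarrow> 'm \<Rightarrow> 'm::ab_group_add"
    and \<pi> :: "'g \<times> 'g \<Rightarrow> 'm \<Rightarrow> 'm"
    and \<kappa> :: "'k \<Rightarrow> 'm \<Rightarrow> 'm"
    and hM :: "'m \<Rightarrow> 'm \<Rightarrow> complex"
    and chi :: "('g \<times> 'g) free_alg set \<Rightarrow> complex"
    and sS :: "complex \<Rightarrow> 's \<Rightarrow> 's::ab_group_add"
    and \<sigma> :: "'g \<times> 'g \<Rightarrow> 's \<Rightarrow> 's"
    and ng nk np :: nat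
    and w w' y y' z z' :: "nat \<Rightarrow> 'g \<times> 'g"
    and zs :: "nat \<Rightarrow> 'g \<times> 'g \<Rightarrow> complex"
    and m :: 'm
    and q :: "('g \<times> 'g) free_alg set"
  defines "k \<equiv> k0 \<times> k0" and "p \<equiv> p0 \<times> p0"
  defines "M \<equiv> vspace (UNIV :: 'm set) sM" and "P \<equiv> sym_alg p"
  defines "act \<equiv> tensor_action M P (env_action sM \<pi>) (weyl_action p)"
    and "form \<equiv> tensor_form hM (sym_pairing B p)"
    and "\<Omega>g \<equiv> casimir br UNIV ng w w'" and "\<Omega>k \<equiv> casimir br k nk y y'"
    and "Dp \<equiv> Dplus br p np z z'" and "Dm \<equiv> Dminus br p np z zs"
    and "x \<equiv> simple_tensor M P m q"
  assumes "graded_quadratic_lie_algebra br B k0 p0"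
    and "gK_module K k0 atlas br U \<phi> \<psi> Ad sM \<pi> \<kappa>"
    and "admissible sM \<kappa>"
    and "nondegenerate_hermitian sM hM" and "star_invariant br sM \<pi> hM"
    and "infinitesimal_character br sM \<pi> chi"
    and "simple_findim_lie_module br k sS \<sigma>"
    and "dual_bases B UNIV ng w w'"
    and "dual_bases B k nk y y'"
    and "dual_bases B p np z z'"
    and "\<And>i. i < np \<Longrightarrow> zs i \<in> dual_space p"
    and "\<And>i j. \<lbrakk>i < np; j < np\<rbrakk> \<Longrightarrow> zs i (z j) = (if i = j then 1 else 0)"
    and "m \<in> isotypic_component k sS \<sigma> sM \<pi>"
    and "q \<in> sym_real p"
  shows "form (act Dp x) (act Dp x) - form (act Dm x) (act Dm x) =
           (- chi \<Omega>g + acting_scalar sS \<sigma> \<Omega>k) * form x x"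
  unfolding k_def p_def M_def P_def act_def form_def \<Omega>g_def \<Omega>k_def Dp_def Dm_def x_def
  by (rule Dplus_Dminus_difference)
     (use assms gK_module.g_module in \<open>auto simp: k_def p_def\<close>)

end
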